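(* Let $\mathbb{K}=\mathbb{R}$ or $\mathbb{C}$, let $x=(x_1,\dots,x_m)$, and let $I$ be an ideal in $\mathbb{K}\{x\}$ generated by a regular sequence $\{f_1,\dots,f_k\}$. Then there exist $\mu_0\in\mathbb{N}$ and a linear change of coordinates $\varphi$ in $\mathbb{K}^m$ for which $\mathbb{K}\{x\}/\varphi(I)$ is a finite $\mathbb{K}\{\tilde{x}\}$-module, where $\tilde{x}=(x_{k+1},\dots,x_m)$, such that, for every $\mu\geq\mu_0$ and for every $k$-tuple $\{g_1,\dots,g_k\}$ in $\mathbb{K}\{x\}$ satisfying $j^\mu g_i=j^\mu f_i$ for $i=1,\dots,k$, we have: (i) the $k$-tuple $\{g_1,\dots,g_k\}$ forms a regular sequence in $\mathbb{K}\{x\}$; (ii) the ideal $J:=(g_1,\dots,g_k)\cdot\mathbb{K}\{x\}$ satisfies, after the linear change of coordinates $\varphi$, the equality of diagrams $\mathfrak{N}(\varphi(J))=\mathfrak{N}(\varphi(I))$.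
   Context: $\mathbb{K}\{x\}$ is the ring of convergent power series in $x$ over $\mathbb{K}$, with maximal ideal $\mathfrak{m}_x$; $\mathbb{N}$ contains $0$. For $\mu\in\mathbb{N}$ and $f\in\mathbb{K}\{x\}$, the $\mu$-jet $j^\mu f$ is the image of $f$ in $\mathbb{K}\{x\}/\mathfrak{m}_x^{\mu+1}$. A linear change of coordinates $\varphi$ is the $\mathbb{K}$-algebra automorphism of $\mathbb{K}\{x\}$ given by $f(x)\mapsto f(Ax)$ for some $A\in GL_m(\mathbb{K})$. When $k=m$, $\tilde{x}$ is empty and $\mathbb{K}\{\tilde{x}\}=\mathbb{K}$. A sequence $a_1,\dots,a_k$ in a ring $A$ is a regular sequence if the ideal $(a_1,\dots,a_k)$ is proper, $a_1$ is a non-zerodivisor in $A$ and, for each $i=1,\dots,k-1$, the image of $a_{i+1}$ is a non-zerodivisor in $A/(a_1,\dots,a_i)$. Diagram of initial exponents: $\mathbb{N}^m$ is totally ordered by the lexicographic ordering of the $(m+1)$-tuples $(|\beta|,\beta_1,\dots,\beta_m)$, where $\beta=(\beta_1,\dots,\beta_m)$ and $|\beta|=\beta_1+\dots+\beta_m$. For $F=\sum_{\beta}f_\beta x^\beta\in\mathbb{K}\{x\}\setminus\{0\}$, the support is $\mathrm{supp}(F)=\{\beta\in\mathbb{N}^m: f_\beta\neq0\}$ and the initial exponent $\exp(F)$ is the minimum of $\mathrm{supp}(F)$ with respect to this ordering. For an ideal $J$ in $\mathbb{K}\{x\}$, its diagram of initial exponents is $\mathfrak{N}(J)=\{\exp(F):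 F\in J\setminus\{0\}\}\subset\mathbb{N}^m$. *)

theory Defs
  imports
    "HOL-Analysis.Infinite_Sum"
    "HOL-Algebra.QuotRing"
    "HOL-Algebra.Ideal_Product"
    "HOL-Algebra.Module"
    "Jordan_Normal_Form.Matrix"
begin

text \<open>
  The base field \<open>\<real>\<close> or \<open>\<complex>\<close> is rendered by the sort \<open>{real_normed_field, banach}\<close>: it has the
  instances \<open>real\<close> and \<open>complex\<close> and, by the Gelfand--Mazur theorem, no others up to isometric
  isomorphism.

  Variables and sequence entries are numbered from \<open>0\<close>, so the coordinates are \<open>x 0, \<dots>, x (m - 1)\<close>, the sequence is
  \<open>f 0, \<dots>, f (k - 1)\<close>, and the tail coordinates are \<open>x k, \<dots>, x (m - 1)\<close>. An exponent in
  \<open>\<nat>\<^sup>m\<close> is a function \<open>nat \<Rightarrow> nat\<close> that vanishes from \<open>m\<close> on, and a power series is its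
  coefficient function, extended by \<open>0\<close> outside \<open>\<nat>\<^sup>m\<close>.
\<close>

section \<open>The ring of convergent power series\<close>

definition exponents :: "nat \<Rightarrow> (nat \<Rightarrow> nat) set" where
  "exponents m = {\<beta>. \<forall>i\<ge>m. \<beta> i = 0}"

definition deg :: "nat \<Rightarrow> (nat \<Rightarrow> nat) \<Rightarrow> nat" where
  "deg m \<beta> = (\<Sum>i<m. \<beta> i)"

definition convergent_series :: "nat \<Rightarrow> ((nat \<Rightarrow> nat) \<Rightarrow> 'a::{real_normed_field,banach}) set" where
  "convergent_series m = {f. (\<forall>\<beta>. \<beta> \<notin> exponents m \<longrightarrow> f \<beta> = 0) \<and>
     (\<exists>r>0. (\<lambda>\<beta>. norm (f \<beta>) * r ^ deg m \<beta>) summable_on exponents m)}"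

definition series_mult ::
  "nat \<Rightarrow> ((nat \<Rightarrow> nat) \<Rightarrow> 'a) \<Rightarrow> ((nat \<Rightarrow> nat) \<Rightarrow> 'a) \<Rightarrow> (nat \<Rightarrow> nat) \<Rightarrow> 'a::{real_normed_field,banach}"
  where "series_mult m f g \<beta> =
    (\<Sum>(\<gamma>, \<delta>) | \<gamma> \<in> exponents m \<and> \<delta> \<in> exponents m \<and> (\<lambda>i. \<gamma> i + \<delta> i) = \<beta>. f \<gamma> * g \<delta>)"

definition cps :: "nat \<Rightarrow> ((nat \<Rightarrow> nat) \<Rightarrow> 'a::{real_normed_field,banach}) ring" where
  "cps m = \<lparr>carrier = convergent_series m,
     mult = series_mult m,
     one = (\<lambda>\<beta>. if \<beta> = (\<lambda>_. 0) then 1 else 0),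
     zero = (\<lambda>_. 0),
     add = (\<lambda>f g \<beta>. f \<beta> + g \<beta>)\<rparr>"

definition cps_tail :: "nat \<Rightarrow> nat \<Rightarrow> ((nat \<Rightarrow> nat) \<Rightarrow> 'a::{real_normed_field,banach}) ring" where
  "cps_tail k m = (cps m)
     \<lparr>carrier := {f \<in> convergent_series m. \<forall>\<beta>. f \<beta> \<noteq> 0 \<longrightarrow> (\<forall>i<k. \<beta> i = 0)}\<rparr>"

section \<open>Jets\<close>

definition cps_max_ideal :: "nat \<Rightarrow> ((nat \<Rightarrow> nat) \<Rightarrow> 'a::{real_normed_field,banach}) set" where
  "cps_max_ideal m = {f \<in> carrier (cps m). f (\<lambda>_. 0) = 0}"

definition jet :: "nat \<Rightarrow> nat \<Rightarrow> ((nat \<Rightarrow> nat) \<Rightarrow> 'a::{real_normed_field,banach}) \<Rightarrow> ((nat \<Rightarrow> nat) \<Rightarrow> 'a) set"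
  where "jet m \<mu> f = (cps_max_ideal m [^]\<^bsub>ideals_set (cps m)\<^esub> (\<mu> + 1)) +>\<^bsub>cps m\<^esub> f"

section \<open>Regular sequences\<close>

definition nonzerodivisor :: "('b, 'c) ring_scheme \<Rightarrow> 'b \<Rightarrow> bool" where
  "nonzerodivisor R a \<longleftrightarrow>
     a \<in> carrier R \<and> (\<forall>b\<in>carrier R. a \<otimes>\<^bsub>R\<^esub> b = \<zero>\<^bsub>R\<^esub> \<longrightarrow> b = \<zero>\<^bsub>R\<^esub>)"

text \<open>The empty sequence (\<open>k = 0\<close>) counts as regular in a nonzero ring.\<close>

definition regular_sequence :: "('b, 'c) ring_scheme \<Rightarrow> nat \<Rightarrow> (nat \<Rightarrow> 'b) \<Rightarrow> bool" where
  "regular_sequence R k a \<longleftrightarrow>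
     (\<forall>i<k. a i \<in> carrier R) \<and>
     Idl\<^bsub>R\<^esub> (a ` {..<k}) \<noteq> carrier R \<and>
     (0 < k \<longrightarrow> nonzerodivisor R (a 0)) \<and>
     (\<forall>i. 0 < i \<and> i < k \<longrightarrow>
        nonzerodivisor (R Quot (Idl\<^bsub>R\<^esub> (a ` {..<i}))) (Idl\<^bsub>R\<^esub> (a ` {..<i}) +>\<^bsub>R\<^esub> a i))"

section \<open>Linear changes of coordinates\<close>

definition general_linear :: "nat \<Rightarrow> 'a::{real_normed_field,banach} mat set" where
  "general_linear m = {A \<in> carrier_mat m m. invertible_mat A}"

text \<open>The \<open>i\<close>-th component \<open>\<Sum>j<m. A $$ (i, j) * x j\<close> of \<open>A x\<close>, as a power series.\<close>

definition linear_component ::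
  "nat \<Rightarrow> 'a mat \<Rightarrow> nat \<Rightarrow> (nat \<Rightarrow> nat) \<Rightarrow> 'a::{real_normed_field,banach}" where
  "linear_component m A i \<beta> =
     (\<Sum>j<m. if \<beta> = (\<lambda>l. if l = j then 1 else 0) then A $$ (i, j) else 0)"

text \<open>
  The series \<open>f (A x) = (\<Sum>\<beta>. f \<beta> * (A x) ^ \<beta>)\<close>. As \<open>(A x) ^ \<beta>\<close> is homogeneous of degree \<open>deg m \<beta>\<close>,
  only the finitely many \<open>\<beta>\<close> of the same degree as \<open>\<gamma>\<close> contribute to the coefficient of \<open>x ^ \<gamma>\<close>.
\<close>

definition linear_change ::
  "nat \<Rightarrow> 'a mat \<Rightarrow> ((nat \<Rightarrow> nat) \<Rightarrow> 'a) \<Rightarrow> (nat \<Rightarrow> nat) \<Rightarrow> 'a::{real_normed_field,banach}" where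
  "linear_change m A f \<gamma> =
     (\<Sum>\<beta> | \<beta> \<in> exponents m \<and> deg m \<beta> = deg m \<gamma>.
        f \<beta> * (\<Otimes>\<^bsub>cps m\<^esub>i\<in>{..<m}. linear_component m A i [^]\<^bsub>cps m\<^esub> \<beta> i) \<gamma>)"

section \<open>Quotients as modules over the tail variables\<close>

definition finite_module :: "('r, 'c) ring_scheme \<Rightarrow> ('r, 'b, 'd) module_scheme \<Rightarrow> bool" where
  "finite_module R M \<longleftrightarrow> module R M \<and>
     (\<exists>G. finite G \<and> G \<subseteq> carrier M \<and>
       (\<forall>v\<in>carrier M. \<exists>c\<in>G \<rightarrow> carrier R. v = (\<Oplus>\<^bsub>M\<^esub>g\<in>G. c g \<odot>\<^bsub>M\<^esub> g)))"

text \<open>\<open>R Quot J\<close> as a module over any subring of \<open>R\<close>: a scalar acts by multiplication by its class.\<close>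

definition quotient_module :: "('b, 'c) ring_scheme \<Rightarrow> 'b set \<Rightarrow> ('b, 'b set) module" where
  "quotient_module R J =
     \<lparr>carrier = carrier (R Quot J), mult = mult (R Quot J), one = one (R Quot J),
      zero = zero (R Quot J), add = add (R Quot J),
      smult = (\<lambda>c v. (J +>\<^bsub>R\<^esub> c) \<otimes>\<^bsub>R Quot J\<^esub> v)\<rparr>"

section \<open>The diagram of initial exponents\<close>

definition exponent_less :: "nat \<Rightarrow> (nat \<Rightarrow> nat) \<Rightarrow> (nat \<Rightarrow> nat) \<Rightarrow> bool" where
  "exponent_less m \<beta> \<gamma> \<longleftrightarrow>
     (deg m \<beta> # map \<beta> [0..<m], deg m \<gamma> # map \<gamma> [0..<m]) \<in> lex less_than"

definition series_support :: "((nat \<Rightarrow> nat) \<Rightarrow> 'a::zero) \<Rightarrow> (nat \<Rightarrow> nat) set" where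
  "series_support F = {\<beta>. F \<beta> \<noteq> 0}"

definition initial_exponent :: "nat \<Rightarrow> ((nat \<Rightarrow> nat) \<Rightarrow> 'a::zero) \<Rightarrow> nat \<Rightarrow> nat" where
  "initial_exponent m F = (THE \<beta>. \<beta> \<in> series_support F \<and>
     (\<forall>\<gamma>\<in>series_support F. \<gamma> \<noteq> \<beta> \<longrightarrow> exponent_less m \<beta> \<gamma>))"

definition diagram :: "nat \<Rightarrow> ((nat \<Rightarrow> nat) \<Rightarrow> 'a::{real_normed_field,banach}) set \<Rightarrow> (nat \<Rightarrow> nat) set"
  where "diagram m J = initial_exponent m ` (J - {\<zero>\<^bsub>cps m\<^esub>})"

end

theory Submission
  imports Defs "HOL-Library.Function_Algebras" "HOL-Computational_Algebra.Polynomial"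
    "Jordan_Normal_Form.Determinant"
begin

text \<open>
  Everything rests on one analytic fact, the division theorem \<open>divide\<close>: if each of finitely many
  convergent series \<open>F\<^sub>j\<close> is a monomial \<open>x\<^bsup>\<alpha> j\<^esup>\<close> plus terms of larger weight, then every convergent \<open>h\<close> is
  \<open>\<Sum>\<^sub>j q\<^sub>j F\<^sub>j + R\<close>, where no exponent of \<open>R\<close> is divisible by an \<open>\<alpha> j\<close>. Replacing \<open>F\<^sub>j\<close> by its monomial makes
  this trivial, and for small radius the error is a contraction in a weighted \<open>\<ell>\<^sup>1\<close> norm.

  The diagram of an ideal has finitely many vertices (Dickson), and finitely many initial exponents
  are minimal for suitable positive weights. Hence an ideal can be divided by a standard basis.
  This gives the Artin--Rees property \<open>artin_rees\<close> (an element of order \<open>p\<close> of the ideal has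
  coefficients of order \<open>p - c\<close> with respect to the generators) and Krull's theorem \<open>ideal_closed\<close>.

  Perturbation. Let \<open>f\<close> be regular and \<open>g\<close> agree with \<open>f\<close> up to a high degree. By regularity and
  Artin--Rees, the relations of \<open>f\<close> are Koszul relations with coefficients of controlled order
  (\<open>koszul_syzygy\<close>). If \<open>h = \<Sum>\<^sub>i a\<^sub>i g\<^sub>i\<close> has a higher order than the \<open>a\<^sub>i\<close> suggest, then so has
  \<open>\<Sum>\<^sub>i a\<^sub>i f\<^sub>i\<close>, so \<open>a\<close> is a Koszul relation of \<open>f\<close> up to higher order; subtracting the Koszul relation
  of \<open>g\<close> with the same coefficients raises the order of \<open>a\<close> and does not change \<open>h\<close>. Iterating until
  the order of \<open>a\<close> is that of \<open>h\<close> minus a constant, \<open>\<Sum>\<^sub>i a\<^sub>i f\<^sub>i\<close> gets the same lowest-degree part as \<open>h\<close>, so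
  the diagrams agree. For \<open>h = 0\<close> the iteration shows that \<open>a\<close> is a Koszul relation of \<open>g\<close> modulo
  arbitrarily high order, and Krull's theorem makes \<open>g\<close> regular (\<open>regular_perturbation\<close>).

  The coordinates are found one at a time (\<open>noether_normalization\<close>). If the ring modulo
  \<open>f\<^sub>0, \<dots>, f\<^bsub>i-1\<^esub>\<close> is finite over the series in \<open>x\<^sub>i, x\<^bsub>i+1\<^esub>, \<dots>\<close>, then the powers of \<open>f\<^sub>i\<close> are linearly dependent
  over those; cancelling the lowest power gives a nonzero series \<open>c\<close> in \<open>x\<^sub>i, x\<^bsub>i+1\<^esub>, \<dots>\<close> that lies in the ideal of
  \<open>f\<^sub>0, \<dots>, f\<^sub>i\<close>. A linear change makes \<open>c\<close> contain a pure power of \<open>x\<^sub>i\<close>, which eliminates \<open>x\<^sub>i\<close>.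

  The proof works with a type of formal power series that is a commutative ring, inside which the
  convergent series in \<open>m\<close> variables form a subring; the algebraic structures of the theorem are
  images of subsets of this type under the coefficient map.
\<close>

section \<open>Formal power series in countably many variables\<close>

definition finsupp :: "(nat \<Rightarrow> nat) \<Rightarrow> bool" where
  "finsupp \<beta> \<longleftrightarrow> finite {i. \<beta> i \<noteq> 0}"

lemma finsupp_zero [simp]: "finsupp 0"
  by (simp add: finsupp_def)

lemma finsupp_mono: "finsupp \<beta> \<Longrightarrow> \<gamma> \<le> \<beta> \<Longrightarrow> finsupp \<gamma>"
  unfolding finsupp_def by (erule finite_subset[rotated]) (auto simp: le_fun_def, metis le_zero_eq less_nat_zero_code not_gr_zero)

lemma finsupp_add: "finsupp \<beta> \<Longrightarrow> finsupp \<gamma> \<Longrightarrow> finsupp (\<beta> + \<gamma>)"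
  unfolding finsupp_def by (rule finite_subset[of _ "{i. \<beta> i \<noteq> 0} \<union> {i. \<gamma> i \<noteq> 0}"]) auto

text \<open>
  Restricting to exponents of finite support makes every coefficient of a product a finite sum and,
  for any number \<open>m\<close> of variables, turns the series in \<open>m\<close> variables into a subset of one ring type.
\<close>

typedef (overloaded) 'a pseries =
  "{f :: (nat \<Rightarrow> nat) \<Rightarrow> 'a::zero. \<forall>\<beta>. f \<beta> \<noteq> 0 \<longrightarrow> finsupp \<beta>}"
  morphisms cf Abs_pseries
  by (rule exI[of _ "\<lambda>_. 0"]) simp

definition series :: "((nat \<Rightarrow> nat) \<Rightarrow> 'a::zero) \<Rightarrow> 'a pseries" where
  "series f = Abs_pseries (\<lambda>\<beta>. if finsupp \<beta> then f \<beta> else 0)"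

lemma cf_series: "cf (series f) \<beta> = (if finsupp \<beta> then f \<beta> else 0)"
  unfolding series_def by (subst Abs_pseries_inverse) auto

lemma cf_infinite: "\<not> finsupp \<beta> \<Longrightarrow> cf F \<beta> = 0"
  using cf[of F] by auto

lemma pseries_eqI: "(\<And>\<beta>. cf F \<beta> = cf G \<beta>) \<Longrightarrow> F = G"
  by (simp add: cf_inject[symmetric] fun_eq_iff)

definition splits :: "(nat \<Rightarrow> nat) \<Rightarrow> ((nat \<Rightarrow> nat) \<times> (nat \<Rightarrow> nat)) set" where
  "splits \<beta> = {(\<gamma>, \<delta>). \<gamma> + \<delta> = \<beta>}"

lemma finite_below:
  assumes "finsupp \<beta>"
  shows "finite {\<gamma>::nat \<Rightarrow> nat. \<gamma> \<le> \<beta>}"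
proof -
  let ?A = "{i. \<beta> i \<noteq> 0}"
  have "finite {\<gamma>. \<forall>x. (x \<in> ?A \<longrightarrow> \<gamma> x \<in> {..Max (\<beta> ` ?A)}) \<and> (x \<notin> ?A \<longrightarrow> \<gamma> x = 0)}"
    by (rule finite_set_of_finite_funs) (use assms in \<open>auto simp: finsupp_def\<close>)
  moreover have "{\<gamma>. \<gamma> \<le> \<beta>} \<subseteq>
      {\<gamma>. \<forall>x. (x \<in> ?A \<longrightarrow> \<gamma> x \<in> {..Max (\<beta> ` ?A)}) \<and> (x \<notin> ?A \<longrightarrow> \<gamma> x = 0)}"
  proof clarsimp
    fix \<gamma> x assume a: "\<gamma> \<le> \<beta>"
    have "\<gamma> x \<le> \<beta> x" using a by (simp add: le_fun_def)
    then show "(0 < \<beta> x \<longrightarrow> \<gamma> x \<le> Max (\<beta> ` {i. 0 < \<beta> i})) \<and> (\<beta> x = 0 \<longrightarrow> \<gamma> x = 0)"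
      using assms by (auto simp: finsupp_def intro!: le_trans[OF _ Max_ge])
  qed
  ultimately show ?thesis by (rule finite_subset[rotated])
qed

lemma finite_splits:
  assumes "finsupp \<beta>"
  shows "finite (splits \<beta>)"
proof (rule finite_subset)
  show "splits \<beta> \<subseteq> {\<gamma>. \<gamma> \<le> \<beta>} \<times> {\<gamma>. \<gamma> \<le> \<beta>}"
    by (auto simp: splits_def le_fun_def)
  show "finite ({\<gamma>. \<gamma> \<le> \<beta>} \<times> {\<gamma>. \<gamma> \<le> \<beta>})"
    using finite_below[OF assms] by simp
qed

instantiation pseries :: (comm_ring_1) comm_ring_1
begin

definition "0 = series (\<lambda>_. 0 :: 'a)"
definition "1 = series (\<lambda>\<beta>. if \<beta> = 0 then 1 else 0 :: 'a)"
definition "F + G = series (\<lambda>\<beta>. cf F \<beta> + cf G \<beta> :: 'a)"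
definition "F - G = series (\<lambda>\<beta>. cf F \<beta> - cf G \<beta> :: 'a)"
definition "- F = series (\<lambda>\<beta>. - cf F \<beta> :: 'a)"
definition "F * G = series (\<lambda>\<beta>. \<Sum>(\<gamma>, \<delta>)\<in>splits \<beta>. cf F \<gamma> * cf G \<delta> :: 'a)"

lemma cf_zero_aux: "cf (0 :: 'a pseries) \<beta> = 0"
  by (simp add: zero_pseries_def cf_series)
lemma cf_one_aux: "cf (1 :: 'a pseries) \<beta> = (if \<beta> = 0 then 1 else 0)"
  by (simp add: one_pseries_def cf_series)
lemma cf_add_aux: "cf (F + G :: 'a pseries) \<beta> = cf F \<beta> + cf G \<beta>"
  by (simp add: plus_pseries_def cf_series cf_infinite)
lemma cf_diff_aux: "cf (F - G :: 'a pseries) \<beta> = cf F \<beta> - cf G \<beta>"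
  by (simp add: minus_pseries_def cf_series cf_infinite)
lemma cf_uminus_aux: "cf (- F :: 'a pseries) \<beta> = - cf F \<beta>"
  by (simp add: uminus_pseries_def cf_series cf_infinite)

lemma cf_times_aux:
  "cf (F * G :: 'a pseries) \<beta> = (\<Sum>(\<gamma>, \<delta>)\<in>splits \<beta>. cf F \<gamma> * cf G \<delta>)"
proof (cases "finsupp \<beta>")
  case True
  then show ?thesis by (simp add: times_pseries_def cf_series)
next
  case False
  have "cf F \<gamma> * cf G \<delta> = 0" if "(\<gamma>, \<delta>) \<in> splits \<beta>" for \<gamma> \<delta>
  proof -
    have "\<not> finsupp \<gamma> \<or> \<not> finsupp \<delta>" using that False finsupp_add by (auto simp: splits_def)
    then show ?thesis by (auto simp: cf_infinite)
  qed
  then show ?thesis using False by (subst sum.neutral) (auto simp: times_pseries_def cf_series)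
qed

instance
proof
  fix F G H :: "'a pseries"
  show "F * G * H = F * (G * H)"
  proof (rule pseries_eqI)
    fix \<beta>
    show "cf (F * G * H) \<beta> = cf (F * (G * H)) \<beta>"
    proof (cases "finsupp \<beta>")
      case True
      have fin: "finite (splits \<gamma>)" if "\<gamma> \<le> \<beta>" for \<gamma>
        by (rule finite_splits[OF finsupp_mono[OF True that]])
      have fin1: "\<forall>x\<in>splits \<beta>. finite (splits (fst x))" "\<forall>x\<in>splits \<beta>. finite (splits (snd x))"
        using fin by (auto simp: splits_def le_fun_def)
      have "cf (F * G * H) \<beta> =
          (\<Sum>x\<in>splits \<beta>. \<Sum>y\<in>splits (fst x). cf F (fst y) * cf G (snd y) * cf H (snd x))"
        by (simp add: cf_times_aux sum_distrib_right case_prod_beta)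
      also have "\<dots> = (\<Sum>(x, y)\<in>Sigma (splits \<beta>) (\<lambda>x. splits (fst x)).
          cf F (fst y) * cf G (snd y) * cf H (snd x))"
        using fin1 finite_splits[OF True] by (subst sum.Sigma) auto
      also have "\<dots> = (\<Sum>(x, y)\<in>Sigma (splits \<beta>) (\<lambda>x. splits (snd x)).
          cf F (fst x) * (cf G (fst y) * cf H (snd y)))"
        by (rule sum.reindex_bij_witness
            [where i = "\<lambda>((a, b), (c, d)). ((a + c, d), (a, c))" and j = "\<lambda>((a, b), (c, d)). ((c, d + b), (d, b))"])
           (auto simp: splits_def algebra_simps)
      also have "\<dots> = (\<Sum>x\<in>splits \<beta>. \<Sum>y\<in>splits (snd x). cf F (fst x) * (cf G (fst y) * cf H (snd y)))"
        using fin1 finite_splits[OF True] by (subst sum.Sigma) auto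
      also have "\<dots> = cf (F * (G * H)) \<beta>"
        by (simp add: cf_times_aux sum_distrib_left case_prod_beta)
      finally show ?thesis .
    qed (simp add: cf_infinite)
  qed
  have comm: "F * G = G * F" for F G :: "'a pseries"
  proof (rule pseries_eqI)
    fix \<beta>
    show "cf (F * G) \<beta> = cf (G * F) \<beta>"
      unfolding cf_times_aux
      by (rule sum.reindex_bij_witness[where i = prod.swap and j = prod.swap])
         (auto simp: splits_def algebra_simps)
  qed
  show "F * G = G * F" by (rule comm)
  show "1 * F = F"
  proof (rule pseries_eqI)
    fix \<beta>
    show "cf (1 * F) \<beta> = cf F \<beta>"
    proof (cases "finsupp \<beta>")
      case True
      have "cf (1 * F) \<beta> = (\<Sum>(\<gamma>, \<delta>)\<in>{(0, \<beta>)}. cf 1 \<gamma> * cf F \<delta>)"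
        unfolding cf_times_aux
        by (rule sum.mono_neutral_right[OF finite_splits[OF True]])
           (auto simp: splits_def cf_one_aux split: if_splits)
      then show ?thesis by (simp add: cf_one_aux)
    qed (simp add: cf_infinite)
  qed
  show "(F + G) * H = F * H + G * H"
    by (rule pseries_eqI)
       (simp add: cf_times_aux cf_add_aux sum.distrib[symmetric] case_prod_beta algebra_simps)
  show "F + G + H = F + (G + H)" "F + G = G + F" "0 + F = F" "- F + F = 0" "F - G = F + - G"
    by (rule pseries_eqI; simp add: cf_add_aux cf_zero_aux cf_diff_aux cf_uminus_aux algebra_simps)+
  have "cf (0 :: 'a pseries) 0 \<noteq> cf 1 0" by (simp add: cf_zero_aux cf_one_aux)
  then show "(0 :: 'a pseries) \<noteq> 1" by metis
qed

end

lemma cf_zero [simp]: "cf 0 \<beta> = (0 :: 'a::comm_ring_1)"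
  and cf_one: "cf 1 \<beta> = (if \<beta> = 0 then 1 else 0 :: 'a)"
  and cf_add [simp]: "cf (F + G) \<beta> = cf F \<beta> + (cf G \<beta> :: 'a)"
  and cf_diff [simp]: "cf (F - G) \<beta> = cf F \<beta> - (cf G \<beta> :: 'a)"
  and cf_uminus [simp]: "cf (- F) \<beta> = - (cf F \<beta> :: 'a)"
  and cf_times: "cf (F * G) \<beta> = (\<Sum>(\<gamma>, \<delta>)\<in>splits \<beta>. cf F \<gamma> * cf G \<delta> :: 'a)"
  by (simp_all add: cf_zero_aux cf_one_aux cf_add_aux cf_diff_aux cf_uminus_aux cf_times_aux)

lemma cf_sum [simp]: "cf (sum f A) \<beta> = (\<Sum>x\<in>A. cf (f x) \<beta> :: 'a::comm_ring_1)"
  by (induction A rule: infinite_finite_induct) auto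

lemma cf_times_nonzeroE:
  assumes "cf (F * G) \<beta> \<noteq> (0 :: 'a::comm_ring_1)"
  obtains \<gamma> \<delta> where "\<gamma> + \<delta> = \<beta>" "cf F \<gamma> \<noteq> 0" "cf G \<delta> \<noteq> 0"
proof -
  obtain x where x: "x \<in> splits \<beta>" "(\<lambda>(\<gamma>, \<delta>). cf F \<gamma> * cf G \<delta>) x \<noteq> 0"
    using assms unfolding cf_times by (meson sum.not_neutral_contains_not_neutral)
  then have "fst x + snd x = \<beta>" "cf F (fst x) \<noteq> 0" "cf G (snd x) \<noteq> 0"
    by (auto simp: splits_def case_prod_beta)
  then show ?thesis using that by blast
qed

definition const :: "'a::comm_ring_1 \<Rightarrow> 'a pseries" where
  "const c = series (\<lambda>\<beta>. if \<beta> = 0 then c else 0)"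

definition xpow :: "(nat \<Rightarrow> nat) \<Rightarrow> 'a::comm_ring_1 pseries" where
  "xpow \<alpha> = series (\<lambda>\<beta>. if \<beta> = \<alpha> then 1 else 0)"

lemma cf_const: "cf (const c) \<beta> = (if \<beta> = 0 then c else 0)"
  by (simp add: const_def cf_series)

lemma cf_xpow: "finsupp \<alpha> \<Longrightarrow> cf (xpow \<alpha>) \<beta> = (if \<beta> = \<alpha> then 1 else 0)"
  by (auto simp: xpow_def cf_series)

lemma cf_xpow_times:
  assumes "finsupp \<alpha>"
  shows "cf (xpow \<alpha> * F) \<beta> = (if \<alpha> \<le> \<beta> then cf F (\<beta> - \<alpha>) else (0 :: 'a::comm_ring_1))"
proof (cases "finsupp \<beta>")
  case True
  show ?thesis
  proof (cases "\<alpha> \<le> \<beta>")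
    case le: True
    have "cf (xpow \<alpha> * F) \<beta> = (\<Sum>(\<gamma>, \<delta>)\<in>{(\<alpha>, \<beta> - \<alpha>)}. cf (xpow \<alpha>) \<gamma> * cf F \<delta>)"
      unfolding cf_times
    proof (rule sum.mono_neutral_right[OF finite_splits[OF True]])
      show "{(\<alpha>, \<beta> - \<alpha>)} \<subseteq> splits \<beta>"
        using le by (auto simp: splits_def fun_eq_iff le_fun_def)
      show "\<forall>i\<in>splits \<beta> - {(\<alpha>, \<beta> - \<alpha>)}. (case i of (\<gamma>, \<delta>) \<Rightarrow> cf (xpow \<alpha>) \<gamma> * cf F \<delta>) = 0"
        by (auto simp: splits_def cf_xpow[OF assms] split: if_splits)
    qed
    then show ?thesis using le by (simp add: cf_xpow[OF assms])
  next
    case False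
    then show ?thesis unfolding cf_times
      by (auto intro!: sum.neutral simp: splits_def cf_xpow[OF assms] le_fun_def)
  qed
next
  case False
  have "\<not> finsupp (\<beta> - \<alpha>)"
  proof
    assume "finsupp (\<beta> - \<alpha>)"
    then have "finsupp (\<beta> - \<alpha> + \<alpha>)" using assms by (rule finsupp_add)
    moreover have "\<beta> x \<le> (\<beta> - \<alpha> + \<alpha>) x" for x by (simp add: le_diff_conv[symmetric])
    ultimately have "finsupp \<beta>" by (meson finsupp_mono le_funI)
    then show False using False by simp
  qed
  then show ?thesis using False by (simp add: cf_infinite)
qed

lemma cf_const_times: "cf (const c * F) \<beta> = c * cf F (\<beta> :: nat \<Rightarrow> nat)"
proof (cases "finsupp \<beta>")
  case True
  have "cf (const c * F) \<beta> = (\<Sum>(\<gamma>, \<delta>)\<in>{(0, \<beta>)}. cf (const c) \<gamma> * cf F \<delta>)"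
    unfolding cf_times
    by (rule sum.mono_neutral_right[OF finite_splits[OF True]])
       (auto simp: splits_def cf_const split: if_splits)
  then show ?thesis by (simp add: cf_const)
qed (simp add: cf_infinite)

section \<open>Convergence\<close>

definition wt :: "nat \<Rightarrow> (nat \<Rightarrow> nat) \<Rightarrow> (nat \<Rightarrow> nat) \<Rightarrow> nat" where
  "wt m w \<beta> = (\<Sum>i<m. w i * \<beta> i)"

lemma wt_add: "wt m w (\<beta> + \<gamma>) = wt m w \<beta> + wt m w \<gamma>"
  by (simp add: wt_def sum.distrib algebra_simps)

lemma wt_zero [simp]: "wt m w 0 = 0"
  by (simp add: wt_def)

lemma wt_one: "wt m (\<lambda>_. 1) \<beta> = deg m \<beta>"
  by (simp add: wt_def deg_def)

lemma deg_add: "deg m (\<beta> + \<gamma>) = deg m \<beta> + deg m \<gamma>"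
  by (simp add: deg_def sum.distrib)

lemma deg_zero [simp]: "deg m 0 = 0"
  by (simp add: deg_def)

lemma exponent_diff_add:
  assumes "\<alpha> \<le> \<beta>"
  shows "\<beta> - \<alpha> + \<alpha> = (\<beta> :: nat \<Rightarrow> nat)"
proof
  fix i show "(\<beta> - \<alpha> + \<alpha>) i = \<beta> i" using le_funD[OF assms, of i] by simp
qed

lemma exponents_add: "\<beta> \<in> exponents m \<Longrightarrow> \<gamma> \<in> exponents m \<Longrightarrow> \<beta> + \<gamma> \<in> exponents m"
  and exponents_zero: "0 \<in> exponents m"
  and exponents_addD: "\<beta> + \<gamma> \<in> exponents m \<Longrightarrow> \<beta> \<in> exponents m"
  and exponents_addD': "\<beta> + \<gamma> \<in> exponents m \<Longrightarrow> \<gamma> \<in> exponents m"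
  by (auto simp: exponents_def)

lemma exponents_finsupp:
  assumes "\<beta> \<in> exponents m"
  shows "finsupp \<beta>"
  unfolding finsupp_def
proof (rule finite_subset)
  show "{i. \<beta> i \<noteq> 0} \<subseteq> {..<m}"
  proof
    fix i assume "i \<in> {i. \<beta> i \<noteq> 0}"
    then show "i \<in> {..<m}" using assms by (cases "m \<le> i") (auto simp: exponents_def)
  qed
qed simp

lemma finite_wt_le:
  assumes "\<forall>i<m. 0 < w i"
  shows "finite {\<beta> \<in> exponents m. wt m w \<beta> \<le> n}"
proof (rule finite_subset)
  show "finite {\<gamma>. \<forall>x. (x \<in> {..<m} \<longrightarrow> \<gamma> x \<in> {..n}) \<and> (x \<notin> {..<m} \<longrightarrow> \<gamma> x = (0::nat))}"
    by (rule finite_set_of_finite_funs) auto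
  show "{\<beta> \<in> exponents m. wt m w \<beta> \<le> n} \<subseteq>
      {\<gamma>. \<forall>x. (x \<in> {..<m} \<longrightarrow> \<gamma> x \<in> {..n}) \<and> (x \<notin> {..<m} \<longrightarrow> \<gamma> x = (0::nat))}"
  proof clarsimp
    fix \<beta> x assume b: "\<beta> \<in> exponents m" "wt m w \<beta> \<le> n"
    have "\<beta> x \<le> n" if "x < m"
    proof -
      have "\<beta> x \<le> w x * \<beta> x" using assms that by (cases "w x") auto
      also have "\<dots> \<le> wt m w \<beta>" unfolding wt_def by (rule member_le_sum) (use that in auto)
      finally show ?thesis using b by simp
    qed
    then show "(x < m \<longrightarrow> \<beta> x \<le> n) \<and> (\<not> x < m \<longrightarrow> \<beta> x = 0)"
      using b by (auto simp: exponents_def)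
  qed
qed

definition supp_in :: "nat \<Rightarrow> 'a::comm_ring_1 pseries \<Rightarrow> bool" where
  "supp_in m F \<longleftrightarrow> (\<forall>\<beta>. cf F \<beta> \<noteq> 0 \<longrightarrow> \<beta> \<in> exponents m)"

text \<open>
  The weighted \<open>\<ell>\<^sup>1\<close> norm \<open>\<Sum>\<^sub>\<beta> |F\<^sub>\<beta>| r\<^bsup>w(\<beta>)\<^esup>\<close> is at most \<open>C\<close>. Bounding the partial sums by weight, which are
  finite sums for positive weights, avoids infinite sums altogether.
\<close>

definition norm_bound ::
  "nat \<Rightarrow> (nat \<Rightarrow> nat) \<Rightarrow> real \<Rightarrow> real \<Rightarrow> 'a::real_normed_field pseries \<Rightarrow> bool" where
  "norm_bound m w r C F \<longleftrightarrow>
     (\<forall>n. (\<Sum>\<beta> | \<beta> \<in> exponents m \<and> wt m w \<beta> \<le> n. norm (cf F \<beta>) * r ^ wt m w \<beta>) \<le> C)"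

lemma norm_bound_nonneg: "norm_bound m w r C F \<Longrightarrow> 0 \<le> r \<Longrightarrow> 0 \<le> C"
  unfolding norm_bound_def by (erule allE[of _ 0], rule order_trans[OF sum_nonneg]) auto

lemma norm_bound_add:
  assumes "norm_bound m w r C F" "norm_bound m w r D G" "0 \<le> r"
  shows "norm_bound m w r (C + D) (F + G)"
  unfolding norm_bound_def
proof
  fix n
  let ?S = "{\<beta> \<in> exponents m. wt m w \<beta> \<le> n}"
  have "(\<Sum>\<beta>\<in>?S. norm (cf (F + G) \<beta>) * r ^ wt m w \<beta>) \<le>
      (\<Sum>\<beta>\<in>?S. norm (cf F \<beta>) * r ^ wt m w \<beta> + norm (cf G \<beta>) * r ^ wt m w \<beta>)"
    by (rule sum_mono) (simp add: assms(3) distrib_right[symmetric] mult_right_mono norm_triangle_ineq)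
  also have "\<dots> \<le> C + D"
    using assms(1,2) unfolding norm_bound_def sum.distrib by (intro add_mono) auto
  finally show "(\<Sum>\<beta>\<in>?S. norm (cf (F + G) \<beta>) * r ^ wt m w \<beta>) \<le> C + D" .
qed

lemma norm_bound_dominated:
  assumes "norm_bound m w r C F" "\<And>\<beta>. norm (cf G \<beta>) \<le> norm (cf F \<beta>)" "0 \<le> r"
  shows "norm_bound m w r C G"
  unfolding norm_bound_def
proof
  fix n
  have "(\<Sum>\<beta> | \<beta> \<in> exponents m \<and> wt m w \<beta> \<le> n. norm (cf G \<beta>) * r ^ wt m w \<beta>) \<le>
     (\<Sum>\<beta> | \<beta> \<in> exponents m \<and> wt m w \<beta> \<le> n. norm (cf F \<beta>) * r ^ wt m w \<beta>)"
    by (rule sum_mono) (simp add: assms mult_right_mono)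
  also have "\<dots> \<le> C" using assms(1) unfolding norm_bound_def by blast
  finally show "(\<Sum>\<beta> | \<beta> \<in> exponents m \<and> wt m w \<beta> \<le> n. norm (cf G \<beta>) * r ^ wt m w \<beta>) \<le> C" .
qed

lemma norm_bound_weaken: "norm_bound m w r C F \<Longrightarrow> C \<le> D \<Longrightarrow> norm_bound m w r D F"
  unfolding norm_bound_def by (meson order_trans)

lemma norm_bound_radius:
  assumes "norm_bound m w r C F" "0 \<le> r'" "r' \<le> r"
  shows "norm_bound m w r' C F"
  unfolding norm_bound_def
proof
  fix n
  have "(\<Sum>\<beta> | \<beta> \<in> exponents m \<and> wt m w \<beta> \<le> n. norm (cf F \<beta>) * r' ^ wt m w \<beta>) \<le>
     (\<Sum>\<beta> | \<beta> \<in> exponents m \<and> wt m w \<beta> \<le> n. norm (cf F \<beta>) * r ^ wt m w \<beta>)"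
    by (rule sum_mono) (simp add: assms mult_left_mono power_mono)
  also have "\<dots> \<le> C" using assms(1) unfolding norm_bound_def by blast
  finally show "(\<Sum>\<beta> | \<beta> \<in> exponents m \<and> wt m w \<beta> \<le> n. norm (cf F \<beta>) * r' ^ wt m w \<beta>) \<le> C" .
qed

lemma norm_bound_uminus: "norm_bound m w r C (- F) = norm_bound m w r C F"
  by (simp add: norm_bound_def)

text \<open>
  Terms of weight \<open>\<le> n\<close> of the product only involve terms of weight \<open>\<le> n\<close> of the factors, so its partial sum is
  bounded by the product of theirs.
\<close>

lemma norm_bound_mult:
  assumes F: "norm_bound m w r C F" and G: "norm_bound m w r D G" and r: "0 \<le> r"
    and w: "\<forall>i<m. 0 < w i"
  shows "norm_bound m w r (C * D) (F * G)"
  unfolding norm_bound_def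
proof
  fix n
  let ?S = "{\<beta> \<in> exponents m. wt m w \<beta> \<le> n}"
  let ?f = "\<lambda>\<beta>. norm (cf F \<beta>) * r ^ wt m w \<beta>" and ?g = "\<lambda>\<beta>. norm (cf G \<beta>) * r ^ wt m w \<beta>"
  have fin: "finite ?S" by (rule finite_wt_le[OF w])
  have "(\<Sum>\<beta>\<in>?S. norm (cf (F * G) \<beta>) * r ^ wt m w \<beta>) \<le> (\<Sum>\<beta>\<in>?S. \<Sum>x\<in>splits \<beta>. ?f (fst x) * ?g (snd x))"
  proof (rule sum_mono)
    fix \<beta>
    have "norm (cf (F * G) \<beta>) * r ^ wt m w \<beta> \<le>
        (\<Sum>x\<in>splits \<beta>. norm (cf F (fst x)) * norm (cf G (snd x))) * r ^ wt m w \<beta>"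
      unfolding cf_times case_prod_beta
      by (rule mult_right_mono[OF order_trans[OF norm_sum]]) (auto simp: norm_mult r)
    also have "\<dots> = (\<Sum>x\<in>splits \<beta>. ?f (fst x) * ?g (snd x))"
      unfolding sum_distrib_right
      by (rule sum.cong) (auto simp: splits_def wt_add power_add algebra_simps)
    finally show "norm (cf (F * G) \<beta>) * r ^ wt m w \<beta> \<le> (\<Sum>x\<in>splits \<beta>. ?f (fst x) * ?g (snd x))" .
  qed
  also have "\<dots> = (\<Sum>(\<beta>, x)\<in>Sigma ?S splits. ?f (fst x) * ?g (snd x))"
    by (rule sum.Sigma) (use fin exponents_finsupp finite_splits in auto)
  also have "\<dots> = (\<Sum>x\<in>snd ` Sigma ?S splits. ?f (fst x) * ?g (snd x))"
    by (subst sum.reindex) (auto simp: inj_on_def splits_def case_prod_beta)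
  also have "\<dots> \<le> (\<Sum>x\<in>?S \<times> ?S. ?f (fst x) * ?g (snd x))"
    by (rule sum_mono2) (use fin r in \<open>auto simp: splits_def wt_add dest: exponents_addD exponents_addD'\<close>)
  also have "\<dots> = (\<Sum>\<beta>\<in>?S. ?f \<beta>) * (\<Sum>\<beta>\<in>?S. ?g \<beta>)"
    by (simp add: sum_product sum.cartesian_product case_prod_beta)
  also have "\<dots> \<le> C * D"
    using F G norm_bound_nonneg[OF F r] r unfolding norm_bound_def by (intro mult_mono sum_nonneg) auto
  finally show "(\<Sum>\<beta>\<in>?S. norm (cf (F * G) \<beta>) * r ^ wt m w \<beta>) \<le> C * D" .
qed

text \<open>
  Convergence does not depend on the positive weights: since \<open>|\<beta>| \<le> w(\<beta>) \<le> M|\<beta>|\<close> for some \<open>M\<close>,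
  passing from one to the other only changes the radius.
\<close>

definition conv :: "nat \<Rightarrow> 'a::{real_normed_field,banach} pseries set" where
  "conv m = {F. cf F \<in> convergent_series m}"

lemma conv_iff_norm_bound:
  assumes w: "\<forall>i<m. 0 < w i"
  shows "F \<in> conv m \<longleftrightarrow> supp_in m F \<and> (\<exists>r C. 0 < r \<and> norm_bound m w r C F)"
proof (intro iffI conjI)
  assume F: "F \<in> conv m"
  show "supp_in m F" using F by (auto simp: conv_def convergent_series_def supp_in_def)
  obtain r where r: "r > 0" "(\<lambda>\<beta>. norm (cf F \<beta>) * r ^ deg m \<beta>) summable_on exponents m"
    using F by (auto simp: conv_def convergent_series_def)
  let ?C = "infsum (\<lambda>\<beta>. norm (cf F \<beta>) * r ^ deg m \<beta>) (exponents m)"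
  define t where "t = min 1 r"
  have t: "0 < t" "t \<le> 1" "t \<le> r" using r by (auto simp: t_def)
  have "norm_bound m w t ?C F"
    unfolding norm_bound_def
  proof
    fix n
    let ?S = "{\<beta> \<in> exponents m. wt m w \<beta> \<le> n}"
    have "(\<Sum>\<beta>\<in>?S. norm (cf F \<beta>) * t ^ wt m w \<beta>) \<le> (\<Sum>\<beta>\<in>?S. norm (cf F \<beta>) * r ^ deg m \<beta>)"
    proof (rule sum_mono, rule mult_left_mono)
      fix \<beta>
      have "deg m \<beta> \<le> wt m w \<beta>" unfolding deg_def wt_def by (rule sum_mono) (use w in auto)
      then have "t ^ wt m w \<beta> \<le> t ^ deg m \<beta>" using t by (intro power_decreasing) auto
      also have "\<dots> \<le> r ^ deg m \<beta>" using t by (intro power_mono) auto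
      finally show "t ^ wt m w \<beta> \<le> r ^ deg m \<beta>" .
    qed auto
    also have "\<dots> \<le> ?C"
      by (rule finite_sum_le_infsum[OF r(2) finite_wt_le[OF w]]) (use r in auto)
    finally show "(\<Sum>\<beta>\<in>?S. norm (cf F \<beta>) * t ^ wt m w \<beta>) \<le> ?C" .
  qed
  then show "\<exists>r C. 0 < r \<and> norm_bound m w r C F" using t by blast
next
  assume F: "supp_in m F \<and> (\<exists>r C. 0 < r \<and> norm_bound m w r C F)"
  then obtain r0 C where r0: "0 < r0" "norm_bound m w r0 C F" by blast
  define r where "r = min 1 r0"
  have r: "0 < r" "r \<le> 1" "norm_bound m w r C F"
    using r0 norm_bound_radius[OF r0(2), of r] by (auto simp: r_def)
  define M where "M = (\<Sum>i<m. w i)"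
  have "(\<lambda>\<beta>. norm (cf F \<beta>) * (r ^ M) ^ deg m \<beta>) summable_on exponents m"
  proof (rule nonneg_bdd_above_summable_on)
    show "bdd_above (sum (\<lambda>\<beta>. norm (cf F \<beta>) * (r ^ M) ^ deg m \<beta>) ` {S. S \<subseteq> exponents m \<and> finite S})"
    proof (rule bdd_aboveI2)
      fix S assume "S \<in> {S. S \<subseteq> exponents m \<and> finite S}"
      then have S: "S \<subseteq> exponents m" "finite S" by auto
      define n where "n = Max (wt m w ` S)"
      have "(\<Sum>\<beta>\<in>S. norm (cf F \<beta>) * (r ^ M) ^ deg m \<beta>) \<le> (\<Sum>\<beta>\<in>S. norm (cf F \<beta>) * r ^ wt m w \<beta>)"
      proof (rule sum_mono, rule mult_left_mono)
        fix \<beta>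
        have "wt m w \<beta> \<le> (\<Sum>i<m. M * \<beta> i)" unfolding wt_def M_def
          by (intro sum_mono mult_right_mono member_le_sum) auto
        then have "wt m w \<beta> \<le> M * deg m \<beta>" by (simp add: deg_def sum_distrib_left)
        then show "(r ^ M) ^ deg m \<beta> \<le> r ^ wt m w \<beta>"
          using r by (simp add: power_mult[symmetric] power_decreasing)
      qed auto
      also have "\<dots> \<le> (\<Sum>\<beta> | \<beta> \<in> exponents m \<and> wt m w \<beta> \<le> n. norm (cf F \<beta>) * r ^ wt m w \<beta>)"
        by (rule sum_mono2[OF finite_wt_le[OF w]]) (use S r in \<open>auto simp: n_def\<close>)
      also have "\<dots> \<le> C" using r unfolding norm_bound_def by blast
      finally show "(\<Sum>\<beta>\<in>S. norm (cf F \<beta>) * (r ^ M) ^ deg m \<beta>) \<le> C" .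
    qed
  qed (use r in auto)
  then have "\<exists>s>0. (\<lambda>\<beta>. norm (cf F \<beta>) * s ^ deg m \<beta>) summable_on exponents m"
    using r by (intro exI[of _ "r ^ M"]) auto
  then show "F \<in> conv m" using F by (auto simp: conv_def convergent_series_def supp_in_def)
qed

lemmas conv_iff_deg = conv_iff_norm_bound[where w = "\<lambda>_. 1", simplified]

lemma supp_in_mult: "supp_in m F \<Longrightarrow> supp_in m G \<Longrightarrow> supp_in m (F * G)"
  unfolding supp_in_def by (metis cf_times_nonzeroE exponents_add)

lemma conv_supp: "F \<in> conv m \<Longrightarrow> supp_in m F"
  by (simp add: conv_iff_deg)

lemma conv_suppD: "F \<in> conv m \<Longrightarrow> cf F \<beta> \<noteq> 0 \<Longrightarrow> \<beta> \<in> exponents m"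
  using conv_supp[of F m] by (auto simp: supp_in_def)

lemma conv_common_radius:
  assumes w: "\<forall>i<m. 0 < w i" and "F \<in> conv m" "G \<in> conv m"
  obtains r C D where "0 < r" "norm_bound m w r C F" "norm_bound m w r D G"
proof -
  obtain r C s D where "0 < r" "norm_bound m w r C F" "0 < s" "norm_bound m w s D G"
    using assms by (auto simp: conv_iff_norm_bound)
  then show ?thesis
    using that[of "min r s" C D] norm_bound_radius[of m w r C F "min r s"]
      norm_bound_radius[of m w s D G "min r s"] by auto
qed

lemma conv_add: assumes "F \<in> conv m" "G \<in> conv m" shows "F + G \<in> conv m"
proof -
  obtain r C D where "0 < r" "norm_bound m (\<lambda>_. 1) r C F" "norm_bound m (\<lambda>_. 1) r D G"
    by (rule conv_common_radius[OF _ assms, of "\<lambda>_. 1"]) auto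
  then have "norm_bound m (\<lambda>_. 1) r (C + D) (F + G)" by (intro norm_bound_add) auto
  moreover have "supp_in m (F + G)"
    using assms[THEN conv_supp] unfolding supp_in_def by (metis add.right_neutral cf_add)
  ultimately show ?thesis using \<open>0 < r\<close> by (auto simp: conv_iff_deg)
qed

lemma conv_mult: assumes "F \<in> conv m" "G \<in> conv m" shows "F * G \<in> conv m"
proof -
  obtain r C D where "0 < r" "norm_bound m (\<lambda>_. 1) r C F" "norm_bound m (\<lambda>_. 1) r D G"
    by (rule conv_common_radius[OF _ assms, of "\<lambda>_. 1"]) auto
  then have "norm_bound m (\<lambda>_. 1) r (C * D) (F * G)" by (intro norm_bound_mult) auto
  then show ?thesis using \<open>0 < r\<close> assms[THEN conv_supp] supp_in_mult by (auto simp: conv_iff_deg)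
qed

lemma conv_dominated:
  assumes "F \<in> conv m" "\<And>\<beta>. norm (cf G \<beta>) \<le> norm (cf F \<beta>)"
  shows "G \<in> conv m"
proof -
  have "supp_in m G" using conv_supp[OF assms(1)] assms(2) unfolding supp_in_def
    by (metis norm_le_zero_iff norm_zero)
  moreover obtain r C where "0 < r" "norm_bound m (\<lambda>_. 1) r C F" using assms(1) by (auto simp: conv_iff_deg)
  then have "0 < r \<and> norm_bound m (\<lambda>_. 1) r C G"
    using norm_bound_dominated[OF _ assms(2)] by auto
  ultimately show ?thesis by (auto simp: conv_iff_deg)
qed

lemma conv_uminus: "F \<in> conv m \<Longrightarrow> - F \<in> conv m"
  by (rule conv_dominated) auto

lemma conv_diff: "F \<in> conv m \<Longrightarrow> G \<in> conv m \<Longrightarrow> F - G \<in> conv m"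
  using conv_add[of F m "- G"] conv_uminus by fastforce

lemma conv_single:
  assumes "\<alpha> \<in> exponents m" "\<And>\<beta>. \<beta> \<noteq> \<alpha> \<Longrightarrow> cf F \<beta> = 0"
  shows "F \<in> conv m"
proof -
  have "norm_bound m (\<lambda>_. 1) 1 (norm (cf F \<alpha>)) F"
    unfolding norm_bound_def
  proof
    fix n
    let ?S = "{\<beta> \<in> exponents m. wt m (\<lambda>_. 1) \<beta> \<le> n}"
    have fin: "finite ?S" by (rule finite_wt_le) auto
    have "(\<Sum>\<beta>\<in>?S. norm (cf F \<beta>) * 1 ^ wt m (\<lambda>_. 1) \<beta>) = (\<Sum>\<beta>\<in>?S. if \<beta> = \<alpha> then norm (cf F \<alpha>) else 0)"
      by (rule sum.cong) (auto simp: assms)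
    also have "\<dots> \<le> norm (cf F \<alpha>)" using fin by (simp add: sum.delta)
    finally show "(\<Sum>\<beta>\<in>?S. norm (cf F \<beta>) * 1 ^ wt m (\<lambda>_. 1) \<beta>) \<le> norm (cf F \<alpha>)" .
  qed
  moreover have "supp_in m F" using assms unfolding supp_in_def by metis
  ultimately show ?thesis unfolding conv_iff_norm_bound[where w = "\<lambda>_. 1", simplified]
    by (intro conjI exI[of _ 1] exI[of _ "norm (cf F \<alpha>)"]) auto
qed

lemma conv_const: "const c \<in> conv m"
  by (rule conv_single[of 0]) (auto simp: cf_const exponents_zero)

lemma conv_xpow: "\<alpha> \<in> exponents m \<Longrightarrow> xpow \<alpha> \<in> conv m"
  by (rule conv_single[of \<alpha>]) (auto simp: cf_xpow[OF exponents_finsupp])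

lemma const_zero: "const 0 = 0" and const_one: "const 1 = 1"
  by (rule pseries_eqI; simp add: cf_const cf_one)+

lemma conv_zero: "0 \<in> conv m" and conv_one: "1 \<in> conv m"
  using conv_const[of 0 m] conv_const[of 1 m] by (simp_all add: const_zero const_one)

lemma conv_sum: "(\<And>x. x \<in> A \<Longrightarrow> f x \<in> conv m) \<Longrightarrow> sum f A \<in> conv m"
  by (induction A rule: infinite_finite_induct) (auto intro: conv_zero conv_add)

lemma conv_prod: "(\<And>x. x \<in> A \<Longrightarrow> f x \<in> conv m) \<Longrightarrow> prod f A \<in> conv m"
  by (induction A rule: infinite_finite_induct) (auto intro: conv_one conv_mult)

lemma conv_power: "F \<in> conv m \<Longrightarrow> F ^ n \<in> conv m"
  by (induction n) (auto intro: conv_one conv_mult)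

lemmas conv_closed = conv_zero conv_one conv_const conv_xpow conv_add conv_mult conv_diff
  conv_uminus conv_sum conv_prod conv_power

text \<open>The quotient by \<open>x\<^sup>\<alpha>\<close> of the part of \<open>F\<close> with exponents satisfying \<open>P\<close> and divisible by \<open>\<alpha>\<close>.\<close>

definition shift :: "(nat \<Rightarrow> nat) \<Rightarrow> ((nat \<Rightarrow> nat) \<Rightarrow> bool) \<Rightarrow> 'a::comm_ring_1 pseries \<Rightarrow> 'a pseries" where
  "shift \<alpha> P F = series (\<lambda>\<gamma>. if P (\<gamma> + \<alpha>) then cf F (\<gamma> + \<alpha>) else 0)"

lemma cf_shift:
  assumes "finsupp \<alpha>"
  shows "cf (shift \<alpha> P F) \<gamma> = (if P (\<gamma> + \<alpha>) then cf F (\<gamma> + \<alpha>) else 0)"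
proof -
  have "cf F (\<gamma> + \<alpha>) = 0" if "\<not> finsupp \<gamma>"
    using that by (intro cf_infinite) (auto elim!: contrapos_nn finsupp_mono simp: le_fun_def)
  then show ?thesis by (auto simp: shift_def cf_series)
qed

lemma norm_bound_shift:
  assumes F: "norm_bound m w r C F" and \<alpha>: "\<alpha> \<in> exponents m" and r: "0 < r"
    and w: "\<forall>i<m. 0 < w i"
  shows "norm_bound m w r (C / r ^ wt m w \<alpha>) (shift \<alpha> P F)"
  unfolding norm_bound_def
proof
  fix n
  let ?S = "{\<beta> \<in> exponents m. wt m w \<beta> \<le> n}" and ?T = "{\<beta> \<in> exponents m. wt m w \<beta> \<le> n + wt m w \<alpha>}"
  have "(\<Sum>\<beta>\<in>?S. norm (cf (shift \<alpha> P F) \<beta>) * r ^ wt m w \<beta>) * r ^ wt m w \<alpha> \<le>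
      (\<Sum>\<beta>\<in>?S. norm (cf F (\<beta> + \<alpha>)) * r ^ wt m w (\<beta> + \<alpha>))"
    unfolding sum_distrib_right
    by (rule sum_mono) (use r in \<open>auto simp: cf_shift[OF exponents_finsupp[OF \<alpha>]] wt_add power_add\<close>)
  also have "\<dots> = (\<Sum>\<beta>\<in>(\<lambda>\<beta>. \<beta> + \<alpha>) ` ?S. norm (cf F \<beta>) * r ^ wt m w \<beta>)"
    by (subst sum.reindex) (auto simp: inj_on_def)
  also have "\<dots> \<le> (\<Sum>\<beta>\<in>?T. norm (cf F \<beta>) * r ^ wt m w \<beta>)"
    by (rule sum_mono2[OF finite_wt_le[OF w]]) (use r \<alpha> exponents_add in \<open>auto simp: wt_add\<close>)
  also have "\<dots> \<le> C" using F unfolding norm_bound_def by blast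
  finally show "(\<Sum>\<beta>\<in>?S. norm (cf (shift \<alpha> P F) \<beta>) * r ^ wt m w \<beta>) \<le> C / r ^ wt m w \<alpha>"
    using r by (simp add: field_simps)
qed

lemma conv_shift: assumes "F \<in> conv m" "\<alpha> \<in> exponents m" shows "shift \<alpha> P F \<in> conv m"
proof -
  obtain r C where "0 < r" "norm_bound m (\<lambda>_. 1) r C F" using assms by (auto simp: conv_iff_deg)
  then have "norm_bound m (\<lambda>_. 1) r (C / r ^ wt m (\<lambda>_. 1) \<alpha>) (shift \<alpha> P F)"
    by (intro norm_bound_shift assms) auto
  moreover have "supp_in m (shift \<alpha> P F)" unfolding supp_in_def cf_shift[OF exponents_finsupp[OF assms(2)]]
    using conv_suppD[OF assms(1)] exponents_addD by meson
  ultimately show ?thesis using \<open>0 < r\<close> by (auto simp: conv_iff_deg)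
qed

section \<open>Division with convergent quotients\<close>

text \<open>
  Membership in the \<open>p\<close>-th power of the maximal ideal, read off from the coefficients.
\<close>

definition order_ge :: "nat \<Rightarrow> nat \<Rightarrow> 'a::comm_ring_1 pseries \<Rightarrow> bool" where
  "order_ge m p F \<longleftrightarrow> (\<forall>\<beta>. cf F \<beta> \<noteq> 0 \<longrightarrow> p \<le> deg m \<beta>)"

lemma order_ge_zero [simp]: "order_ge m p 0"
  and order_ge_0 [simp]: "order_ge m 0 F"
  and order_ge_uminus [simp]: "order_ge m p (- F) = order_ge m p F"
  and order_ge_mono: "order_ge m p F \<Longrightarrow> q \<le> p \<Longrightarrow> order_ge m q F"
  by (auto simp: order_ge_def)

lemma order_ge_add: "order_ge m p F \<Longrightarrow> order_ge m p G \<Longrightarrow> order_ge m p (F + G)"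
  unfolding order_ge_def by (metis add.right_neutral cf_add)

lemma order_ge_diff: "order_ge m p F \<Longrightarrow> order_ge m p G \<Longrightarrow> order_ge m p (F - G)"
  using order_ge_add[of m p F "- G"] by simp

lemma order_ge_sum: "(\<And>x. x \<in> A \<Longrightarrow> order_ge m p (f x)) \<Longrightarrow> order_ge m p (sum f A)"
  by (induction A rule: infinite_finite_induct) (auto intro: order_ge_add)

lemma order_ge_mult: "order_ge m p F \<Longrightarrow> order_ge m q G \<Longrightarrow> order_ge m (p + q) (F * G)"
  unfolding order_ge_def by (metis add_mono cf_times_nonzeroE deg_add)

lemma order_ge_mult': "order_ge m p F \<Longrightarrow> order_ge m q G \<Longrightarrow> r \<le> p + q \<Longrightarrow> order_ge m r (F * G)"
  using order_ge_mult order_ge_mono by blast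

lemma norm_bound_sum:
  assumes "\<And>x. x \<in> A \<Longrightarrow> norm_bound m w r C (f x)" "finite A" "0 \<le> r"
  shows "norm_bound m w r (real (card A) * C) (sum f A)"
  using assms(2,1)
proof (induction A rule: finite_induct)
  case (insert x A)
  then have "norm_bound m w r (C + real (card A) * C) (f x + sum f A)"
    using assms(3) by (intro norm_bound_add) auto
  then show ?case using insert by (simp add: algebra_simps)
qed (simp add: norm_bound_def)

lemma conv_eventually_norm_bound:
  assumes "F \<in> conv m" "\<forall>i<m. 0 < w i"
  obtains C where "\<forall>\<^sub>F r in at_right 0. norm_bound m w r C F"
proof -
  obtain r C where r: "0 < r" "norm_bound m w r C F" using assms by (auto simp: conv_iff_norm_bound)
  have "\<forall>\<^sub>F t in at_right 0. norm_bound m w t C F"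
    unfolding eventually_at_right_field
    using norm_bound_radius[OF r(2)] r(1) by (intro exI[of _ r]) auto
  then show ?thesis by (rule that)
qed

text \<open>
  Passing from a radius \<open>r0\<close> to a smaller radius \<open>r\<close> multiplies the norm of a term of weight \<open>> W\<close> by at most
  \<open>(r / r0)\<^bsup>W+1\<^esup>\<close>, which contains one factor \<open>r\<close> more than \<open>r\<^sup>W\<close>.
\<close>

lemma eventually_norm_bound_small:
  assumes F: "F \<in> conv m" and w: "\<forall>i<m. 0 < w i" and W: "\<And>\<beta>. cf F \<beta> \<noteq> 0 \<Longrightarrow> W < wt m w \<beta>"
    and \<epsilon>: "0 < \<epsilon>"
  shows "\<forall>\<^sub>F r in at_right 0. norm_bound m w r (\<epsilon> * r ^ W) F"
proof -
  obtain r0 C where r0: "0 < r0" "norm_bound m w r0 C F" using F w by (auto simp: conv_iff_norm_bound)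
  have C: "0 \<le> C" using norm_bound_nonneg[OF r0(2)] r0 by simp
  define b where "b = min r0 (\<epsilon> * r0 ^ Suc W / (C + 1))"
  have b: "0 < b" using r0 C \<epsilon> by (simp add: b_def)
  have "norm_bound m w r (\<epsilon> * r ^ W) F" if r: "0 < r" "r < b" for r
    unfolding norm_bound_def
  proof
    fix n
    let ?S = "{\<beta> \<in> exponents m. wt m w \<beta> \<le> n}"
    have "(\<Sum>\<beta>\<in>?S. norm (cf F \<beta>) * r ^ wt m w \<beta>) \<le>
        (\<Sum>\<beta>\<in>?S. norm (cf F \<beta>) * r0 ^ wt m w \<beta> * (r / r0) ^ Suc W)"
    proof (rule sum_mono)
      fix \<beta>
      show "norm (cf F \<beta>) * r ^ wt m w \<beta> \<le> norm (cf F \<beta>) * r0 ^ wt m w \<beta> * (r / r0) ^ Suc W"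
      proof (cases "cf F \<beta> = 0")
        case False
        have "(r / r0) ^ wt m w \<beta> \<le> (r / r0) ^ Suc W"
          using W[OF False] r r0 by (intro power_decreasing) (auto simp: b_def)
        then have "r0 ^ wt m w \<beta> * (r / r0) ^ wt m w \<beta> \<le> r0 ^ wt m w \<beta> * (r / r0) ^ Suc W"
          using r0 by (intro mult_left_mono) auto
        also have "r0 ^ wt m w \<beta> * (r / r0) ^ wt m w \<beta> = r ^ wt m w \<beta>"
          using r0 by (simp add: power_mult_distrib[symmetric])
        finally show ?thesis unfolding mult.assoc by (rule mult_left_mono) simp
      qed simp
    qed
    also have "\<dots> = (\<Sum>\<beta>\<in>?S. norm (cf F \<beta>) * r0 ^ wt m w \<beta>) * (r / r0) ^ Suc W"
      by (rule sum_distrib_right[symmetric])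
    also have "\<dots> \<le> C * (r / r0) ^ Suc W"
      using r0 r unfolding norm_bound_def by (intro mult_right_mono) auto
    also have "\<dots> = (C * r / r0 ^ Suc W) * r ^ W" using r0 by (simp add: power_divide)
    also have "\<dots> \<le> \<epsilon> * r ^ W"
    proof (rule mult_right_mono)
      have "C * r \<le> (C + 1) * b" using r C by (intro mult_mono) auto
      also have "\<dots> \<le> \<epsilon> * r0 ^ Suc W"
      proof -
        have "b \<le> \<epsilon> * r0 ^ Suc W / (C + 1)" by (simp add: b_def)
        then show ?thesis using C by (simp add: pos_le_divide_eq mult.commute)
      qed
      finally show "C * r / r0 ^ Suc W \<le> \<epsilon>" using r0 by (simp add: divide_le_eq)
    qed (use r in auto)
    finally show "(\<Sum>\<beta>\<in>?S. norm (cf F \<beta>) * r ^ wt m w \<beta>) \<le> \<epsilon> * r ^ W" .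
  qed
  then show ?thesis unfolding eventually_at_right_field using b by blast
qed

text \<open>
  The data of a division by series \<open>F j\<close> with unique terms \<open>x\<^bsup>\<alpha> j\<^esup>\<close> of least weight. The weights are arbitrary, since
  ideals need weights inducing the ordering of exponents and finiteness needs heavy tail variables.
\<close>

locale division =
  fixes m s :: nat and w :: "nat \<Rightarrow> nat" and \<alpha> :: "nat \<Rightarrow> nat \<Rightarrow> nat"
    and F :: "nat \<Rightarrow> 'a::{real_normed_field,banach} pseries"
  assumes w: "\<forall>i<m. 0 < w i"
    and \<alpha>: "j < s \<Longrightarrow> \<alpha> j \<in> exponents m"
    and F: "j < s \<Longrightarrow> F j \<in> conv m"
    and lead: "j < s \<Longrightarrow> cf (F j) (\<alpha> j) = 1"
    and tail: "j < s \<Longrightarrow> cf (F j) \<beta> \<noteq> 0 \<Longrightarrow> \<beta> \<noteq> \<alpha> j \<Longrightarrow> wt m w (\<alpha> j) < wt m w \<beta>"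
begin

definition least_divisor :: "nat \<Rightarrow> (nat \<Rightarrow> nat) \<Rightarrow> bool" where
  "least_divisor j \<beta> \<longleftrightarrow> \<alpha> j \<le> \<beta> \<and> (\<forall>i<j. \<not> \<alpha> i \<le> \<beta>)"

definition quo :: "nat \<Rightarrow> 'a pseries \<Rightarrow> 'a pseries" where
  "quo j H = shift (\<alpha> j) (least_divisor j) H"

definition remainder :: "'a pseries \<Rightarrow> 'a pseries" where
  "remainder H = series (\<lambda>\<beta>. if \<exists>j<s. \<alpha> j \<le> \<beta> then 0 else cf H \<beta>)"

text \<open>
  Every \<open>H\<close> is \<open>\<Sum>\<^sub>j quo j H * x\<^bsup>\<alpha> j\<^esup> + remainder H\<close>. Replacing \<open>x\<^bsup>\<alpha> j\<^esup>\<close> by \<open>F j\<close> in this sum yields \<open>H - correction H\<close> with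
  the operator \<open>correction\<close> below. So it suffices to solve \<open>h = H - correction H\<close>, which is done by the Neumann series.
\<close>

definition tail_part :: "nat \<Rightarrow> 'a pseries" where
  "tail_part j = F j - xpow (\<alpha> j)"

definition correction :: "'a pseries \<Rightarrow> 'a pseries" where
  "correction H = - (\<Sum>j<s. quo j H * tail_part j)"

lemmas \<alpha>_finsupp = exponents_finsupp[OF \<alpha>]

lemma cf_quo: "j < s \<Longrightarrow> cf (quo j H) \<gamma> = (if least_divisor j (\<gamma> + \<alpha> j) then cf H (\<gamma> + \<alpha> j) else 0)"
  by (simp add: quo_def cf_shift \<alpha>_finsupp)

lemma cf_remainder: "cf (remainder H) \<beta> = (if \<exists>j<s. \<alpha> j \<le> \<beta> then 0 else cf H \<beta>)"
  by (simp add: remainder_def cf_series cf_infinite)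

lemma decompose: "H = (\<Sum>j<s. quo j H * xpow (\<alpha> j)) + remainder H"
proof (rule pseries_eqI)
  fix \<beta>
  have *: "cf (quo j H * xpow (\<alpha> j)) \<beta> = (if least_divisor j \<beta> then cf H \<beta> else 0)" if "j < s" for j
    using that
    by (auto simp: mult.commute[of _ "xpow _"] cf_xpow_times \<alpha>_finsupp cf_quo exponent_diff_add least_divisor_def)
  have "cf (\<Sum>j<s. quo j H * xpow (\<alpha> j)) \<beta> = (if \<exists>j<s. \<alpha> j \<le> \<beta> then cf H \<beta> else 0)"
  proof (cases "\<exists>j<s. \<alpha> j \<le> \<beta>")
    case True
    define j where "j = (LEAST j. \<alpha> j \<le> \<beta>)"
    have j: "\<alpha> j \<le> \<beta>" "\<And>i. i < j \<Longrightarrow> \<not> \<alpha> i \<le> \<beta>"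
      using True LeastI_ex[of "\<lambda>j. \<alpha> j \<le> \<beta>"] not_less_Least[of _ "\<lambda>j. \<alpha> j \<le> \<beta>"] unfolding j_def by blast+
    have js: "j < s"
    proof (rule ccontr)
      assume "\<not> j < s"
      then show False using True j(2) by (meson leI less_le_trans)
    qed
    have "least_divisor i \<beta> \<longleftrightarrow> i = j" for i
    proof
      assume "least_divisor i \<beta>"
      then show "i = j" using j unfolding least_divisor_def by (cases i j rule: linorder_cases) blast+
    qed (use j in \<open>auto simp: least_divisor_def\<close>)
    then show ?thesis using True js by (simp add: *)
  next
    case False
    then show ?thesis by (auto simp: * least_divisor_def intro!: sum.neutral)
  qed
  then show "cf H \<beta> = cf ((\<Sum>j<s. quo j H * xpow (\<alpha> j)) + remainder H) \<beta>"
    by (auto simp: cf_remainder split: if_splits)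
qed

lemma decompose_correction: "H - correction H = (\<Sum>j<s. quo j H * F j) + remainder H"
proof -
  have "H - correction H = (\<Sum>j<s. quo j H * xpow (\<alpha> j)) + remainder H + (\<Sum>j<s. quo j H * tail_part j)"
    by (subst decompose) (simp add: correction_def)
  also have "\<dots> = (\<Sum>j<s. quo j H * (xpow (\<alpha> j) + tail_part j)) + remainder H"
    by (simp add: distrib_left sum.distrib)
  finally show ?thesis by (simp add: tail_part_def)
qed

lemma tail_part_conv: "j < s \<Longrightarrow> tail_part j \<in> conv m"
  unfolding tail_part_def by (intro conv_closed F \<alpha>)

lemma tail_part_weight: "j < s \<Longrightarrow> cf (tail_part j) \<beta> \<noteq> 0 \<Longrightarrow> wt m w (\<alpha> j) < wt m w \<beta>"
  using tail lead by (auto simp: tail_part_def cf_xpow \<alpha>_finsupp split: if_splits)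

lemma quo_conv: "H \<in> conv m \<Longrightarrow> j < s \<Longrightarrow> quo j H \<in> conv m"
  unfolding quo_def by (intro conv_shift \<alpha>)

lemma remainder_conv: "H \<in> conv m \<Longrightarrow> remainder H \<in> conv m"
  by (erule conv_dominated) (simp add: cf_remainder)

lemma correction_conv: "H \<in> conv m \<Longrightarrow> correction H \<in> conv m"
  unfolding correction_def by (intro conv_closed quo_conv tail_part_conv) auto

lemma correction_diff: "correction (G - H) = correction G - correction H"
proof -
  have "quo j (G - H) = quo j G - quo j H" if "j < s" for j
    by (rule pseries_eqI) (simp add: cf_quo that)
  then have "correction (G - H) = - (\<Sum>j<s. (quo j G - quo j H) * tail_part j)" by (simp add: correction_def)
  then show ?thesis by (simp add: correction_def left_diff_distrib sum_subtractf)
qed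

text \<open>The operator \<open>correction\<close> strictly raises weights, so its fixed-point equations can be solved coefficientwise.\<close>

lemma correction_raises_weight:
  assumes "\<And>\<beta>. cf H \<beta> \<noteq> 0 \<Longrightarrow> n \<le> wt m w \<beta>" "cf (correction H) \<beta> \<noteq> 0"
  shows "n < wt m w \<beta>"
proof -
  have "(\<Sum>j<s. cf (quo j H * tail_part j) \<beta>) \<noteq> 0" using assms(2) by (simp add: correction_def)
  then obtain j where j: "j < s" "cf (quo j H * tail_part j) \<beta> \<noteq> 0"
    by (metis (mono_tags, lifting) lessThan_iff sum.neutral)
  then obtain \<gamma> \<delta> where gd: "\<gamma> + \<delta> = \<beta>" "cf (quo j H) \<gamma> \<noteq> 0" "cf (tail_part j) \<delta> \<noteq> 0"
    by (elim cf_times_nonzeroE)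
  have "n \<le> wt m w (\<gamma> + \<alpha> j)" using gd(2) assms(1) by (auto simp: cf_quo j split: if_splits)
  moreover have "wt m w (\<alpha> j) < wt m w \<delta>" by (rule tail_part_weight[OF j(1) gd(3)])
  ultimately show ?thesis using gd(1) by (auto simp: wt_add)
qed

lemma quo_order_ge: "order_ge m p H \<Longrightarrow> j < s \<Longrightarrow> order_ge m (p - deg m (\<alpha> j)) (quo j H)"
  unfolding order_ge_def by (metis cf_quo deg_add le_diff_conv)

lemma correction_order_ge:
  assumes "order_ge m p H" "\<And>j. j < s \<Longrightarrow> order_ge m (deg m (\<alpha> j)) (F j)"
  shows "order_ge m p (correction H)"
  unfolding correction_def order_ge_uminus
proof (rule order_ge_sum)
  fix j assume "j \<in> {..<s}"
  then have j: "j < s" by simp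
  have "order_ge m (p - deg m (\<alpha> j)) (quo j H)"
    using assms(1) by (intro quo_order_ge j)
  moreover have "order_ge m (deg m (\<alpha> j)) (tail_part j)"
    unfolding tail_part_def using assms(2)[OF j] by (intro order_ge_diff) (auto simp: order_ge_def cf_xpow \<alpha>_finsupp j)
  ultimately show "order_ge m p (quo j H * tail_part j)" by (rule order_ge_mult') simp
qed

text \<open>
  The norm of \<open>quo j H\<close> is at most that of \<open>H\<close> divided by \<open>r\<^bsup>w(\<alpha> j)\<^esup>\<close>, while the tail part of \<open>F j\<close> is small compared
  to \<open>r\<^bsup>w(\<alpha> j)\<^esup>\<close>. The bound \<open>\<epsilon>\<close> is chosen so small that the \<open>s\<close> products add up to at most half the norm of \<open>H\<close>.
\<close>

lemma eventually_correction_contracts: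
  "\<forall>\<^sub>F r in at_right 0. \<forall>(H :: 'a pseries) C. norm_bound m w r C H \<longrightarrow> norm_bound m w r (C / 2) (correction H)"
proof -
  define \<epsilon> where "\<epsilon> = 1 / (2 * real (s + 1))"
  have \<epsilon>: "0 < \<epsilon>" by (simp add: \<epsilon>_def)
  have "\<forall>\<^sub>F r in at_right 0. \<forall>j\<in>{..<s}. norm_bound m w r (\<epsilon> * r ^ wt m w (\<alpha> j)) (tail_part j)"
    by (rule eventually_ball_finite)
       (auto intro!: eventually_norm_bound_small tail_part_conv w \<epsilon> dest: tail_part_weight)
  moreover have "\<forall>\<^sub>F r::real in at_right 0. 0 < r"
    by (rule eventually_at_right_less)
  ultimately show ?thesis
  proof eventually_elim
    case (elim r)
    show ?case
    proof (intro allI impI)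
      fix H :: "'a pseries" and C assume H: "norm_bound m w r C H"
      then have C: "0 \<le> C" using norm_bound_nonneg elim by (meson less_imp_le)
      have "norm_bound m w r (\<epsilon> * C) (quo j H * tail_part j)" if "j < s" for j
      proof -
        have "norm_bound m w r (C / r ^ wt m w (\<alpha> j) * (\<epsilon> * r ^ wt m w (\<alpha> j))) (quo j H * tail_part j)"
          using elim that unfolding quo_def
          by (intro norm_bound_mult norm_bound_shift H w \<alpha>) auto
        then show ?thesis using elim by (simp add: mult.commute)
      qed
      then have "norm_bound m w r (real (card {..<s}) * (\<epsilon> * C)) (\<Sum>j<s. quo j H * tail_part j)"
        using elim by (intro norm_bound_sum) auto
      then have "norm_bound m w r (real s * (\<epsilon> * C)) (correction H)"
        unfolding correction_def norm_bound_uminus by simp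
      moreover have "real s * (\<epsilon> * C) \<le> C / 2"
        using C by (simp add: \<epsilon>_def field_simps)
      ultimately show "norm_bound m w r (C / 2) (correction H)" by (rule norm_bound_weaken)
    qed
  qed
qed

primrec iterate :: "'a pseries \<Rightarrow> nat \<Rightarrow> 'a pseries" where
  "iterate h 0 = h"
| "iterate h (Suc n) = h + correction (iterate h n)"

text \<open>
  The iterates stabilize in each weight, \<open>n\<close> iterations determining the coefficients of weight \<open>\<le> n\<close>.
\<close>

definition fixpoint :: "'a pseries \<Rightarrow> 'a pseries" where
  "fixpoint h = series (\<lambda>\<beta>. cf (iterate h (wt m w \<beta>)) \<beta>)"

lemma iterate_conv: "h \<in> conv m \<Longrightarrow> iterate h n \<in> conv m"
  by (induction n) (auto intro: conv_add correction_conv)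

lemma iterate_stable_Suc: "cf (iterate h (Suc n) - iterate h n) \<beta> \<noteq> 0 \<Longrightarrow> n < wt m w \<beta>"
proof (induction n arbitrary: \<beta>)
  case 0
  then show ?case using correction_raises_weight[of h 0 \<beta>] by simp
next
  case (Suc n)
  have "iterate h (Suc (Suc n)) - iterate h (Suc n) = correction (iterate h (Suc n) - iterate h n)"
    by (simp add: correction_diff del: iterate.simps(2)) (simp add: algebra_simps)
  then have "cf (correction (iterate h (Suc n) - iterate h n)) \<beta> \<noteq> 0" using Suc.prems by metis
  then show ?case using correction_raises_weight[of "iterate h (Suc n) - iterate h n" "Suc n" \<beta>] Suc.IH by (meson Suc_leI)
qed

lemma iterate_stable:
  assumes "wt m w \<beta> \<le> n"
  shows "cf (iterate h n) \<beta> = cf (fixpoint h) \<beta>"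
  using assms
proof (induction rule: dec_induct)
  case base
  then show ?case by (simp add: fixpoint_def cf_series cf_infinite)
next
  case (step n)
  have "cf (iterate h (Suc n) - iterate h n) \<beta> = 0" using iterate_stable_Suc[of h n \<beta>] step by fastforce
  then show ?case using step by (simp del: iterate.simps)
qed

lemma fixpoint_eq: "fixpoint h = h + correction (fixpoint h)"
proof (rule pseries_eqI)
  fix \<beta>
  define n where "n = wt m w \<beta>"
  have "cf (correction (fixpoint h - iterate h n)) \<beta> = 0"
  proof (rule ccontr)
    assume "cf (correction (fixpoint h - iterate h n)) \<beta> \<noteq> 0"
    moreover have "Suc n \<le> wt m w \<gamma>" if "cf (fixpoint h - iterate h n) \<gamma> \<noteq> 0" for \<gamma>
      using that iterate_stable[of \<gamma> n h] by (auto simp: not_less_eq_eq[symmetric])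
    ultimately have "Suc n < wt m w \<beta>" using correction_raises_weight by blast
    then show False by (simp add: n_def)
  qed
  then have "cf (h + correction (fixpoint h)) \<beta> = cf (iterate h (Suc n)) \<beta>" by (simp add: correction_diff)
  also have "\<dots> = cf (fixpoint h) \<beta>" by (rule iterate_stable) (simp add: n_def)
  finally show "cf (fixpoint h) \<beta> = cf (h + correction (fixpoint h)) \<beta>" by simp
qed

lemma fixpoint_conv:
  assumes h: "h \<in> conv m"
  shows "fixpoint h \<in> conv m"
proof -
  obtain C where "\<forall>\<^sub>F r in at_right 0. norm_bound m w r C h"
    using conv_eventually_norm_bound[OF h w] .
  moreover note eventually_correction_contracts
  moreover have "\<forall>\<^sub>F r::real in at_right 0. 0 < r" by (rule eventually_at_right_less)
  ultimately have "\<forall>\<^sub>F r in at_right 0. 0 < r \<and> norm_bound m w r C h \<and>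
      (\<forall>(H :: 'a pseries) C. norm_bound m w r C H \<longrightarrow> norm_bound m w r (C / 2) (correction H))"
    by eventually_elim auto
  then obtain r where r: "0 < r" "norm_bound m w r C h"
    "\<And>H C. norm_bound m w r C H \<Longrightarrow> norm_bound m w r (C / 2) (correction H)"
    using eventually_happens'[OF trivial_limit_at_right_real] by blast
  have it: "norm_bound m w r (2 * C) (iterate h n)" for n
  proof (induction n)
    case 0
    then show ?case using r norm_bound_nonneg[OF r(2)] by (auto intro: norm_bound_weaken)
  next
    case (Suc n)
    have "norm_bound m w r (C + 2 * C / 2) (h + correction (iterate h n))"
      using r(1,2) r(3)[OF Suc] by (intro norm_bound_add) auto
    then show ?case by (simp add: field_simps)
  qed
  have "norm_bound m w r (2 * C) (fixpoint h)"
    unfolding norm_bound_def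
  proof
    fix n
    have "(\<Sum>\<beta> | \<beta> \<in> exponents m \<and> wt m w \<beta> \<le> n. norm (cf (fixpoint h) \<beta>) * r ^ wt m w \<beta>) =
        (\<Sum>\<beta> | \<beta> \<in> exponents m \<and> wt m w \<beta> \<le> n. norm (cf (iterate h n) \<beta>) * r ^ wt m w \<beta>)"
      by (rule sum.cong) (auto simp: iterate_stable)
    also have "\<dots> \<le> 2 * C" using it unfolding norm_bound_def by blast
    finally show "(\<Sum>\<beta> | \<beta> \<in> exponents m \<and> wt m w \<beta> \<le> n.
      norm (cf (fixpoint h) \<beta>) * r ^ wt m w \<beta>) \<le> 2 * C" .
  qed
  moreover have "supp_in m (fixpoint h)"
    unfolding supp_in_def using iterate_stable[OF order_refl] conv_suppD[OF iterate_conv[OF h]] by metis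
  ultimately show ?thesis using r w by (auto simp: conv_iff_norm_bound)
qed

lemma fixpoint_order_ge:
  assumes "order_ge m p h" "\<And>j. j < s \<Longrightarrow> order_ge m (deg m (\<alpha> j)) (F j)"
  shows "order_ge m p (fixpoint h)"
proof -
  have "order_ge m p (iterate h n)" for n
    by (induction n) (auto intro!: assms(1) order_ge_add correction_order_ge assms(2))
  then show ?thesis unfolding order_ge_def using iterate_stable[OF order_refl] by metis
qed

theorem divide:
  assumes h: "h \<in> conv m"
  obtains q R where "\<And>j. j < s \<Longrightarrow> q j \<in> conv m" "R \<in> conv m" "h = (\<Sum>j<s. q j * F j) + R"
    "\<And>\<beta> j. cf R \<beta> \<noteq> 0 \<Longrightarrow> j < s \<Longrightarrow> \<not> \<alpha> j \<le> \<beta>"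
    "\<And>p j. order_ge m p h \<Longrightarrow> (\<And>j. j < s \<Longrightarrow> order_ge m (deg m (\<alpha> j)) (F j)) \<Longrightarrow> j < s \<Longrightarrow>
      order_ge m (p - deg m (\<alpha> j)) (q j)"
proof (rule that)
  let ?H = "fixpoint h"
  show "quo j ?H \<in> conv m" if "j < s" for j by (intro quo_conv fixpoint_conv h that)
  show "remainder ?H \<in> conv m" by (intro remainder_conv fixpoint_conv h)
  have "h = ?H - correction ?H" using fixpoint_eq[of h] by (metis add_diff_cancel_right')
  then show "h = (\<Sum>j<s. quo j ?H * F j) + remainder ?H" using decompose_correction by metis
  show "\<not> \<alpha> j \<le> \<beta>" if "cf (remainder ?H) \<beta> \<noteq> 0" "j < s" for \<beta> j
    using that by (auto simp: cf_remainder split: if_splits)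
  show "order_ge m (p - deg m (\<alpha> j)) (quo j ?H)"
    if "order_ge m p h" "\<And>j. j < s \<Longrightarrow> order_ge m (deg m (\<alpha> j)) (F j)" "j < s" for p j
    using fixpoint_order_ge[OF that(1,2)] that(3) by (rule quo_order_ge)
qed

end

text \<open>Division by \<open>U\<close> leaves no room for a remainder, as the exponent \<open>0\<close> divides every exponent.\<close>

lemma conv_unit:
  assumes "U \<in> conv m" "cf U 0 \<noteq> 0"
  obtains V where "V \<in> conv m" "V * U = 1"
proof -
  define c where "c = inverse (cf U 0)"
  interpret division m 1 "\<lambda>_. 1" "\<lambda>_. 0" "\<lambda>_. const c * U"
  proof
    fix j :: nat and \<beta> assume "cf (const c * U) \<beta> \<noteq> 0" "\<beta> \<noteq> 0"
    then have "\<beta> \<in> exponents m" using conv_suppD[OF assms(1)] by (auto simp: cf_const_times)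
    moreover obtain i where "\<beta> i \<noteq> 0" using \<open>\<beta> \<noteq> 0\<close> by (auto simp: fun_eq_iff)
    ultimately have "i < m" by (auto simp: exponents_def not_less[symmetric])
    then have "\<beta> i \<le> deg m \<beta>" unfolding deg_def by (intro member_le_sum) auto
    then show "wt m (\<lambda>_. 1) 0 < wt m (\<lambda>_. 1) \<beta>" using \<open>\<beta> i \<noteq> 0\<close> by (simp add: wt_one[simplified])
  qed (use assms in \<open>auto simp: cf_const_times c_def exponents_zero intro: conv_closed\<close>)
  obtain q R where q: "\<And>j. j < 1 \<Longrightarrow> q j \<in> conv m" "1 = (\<Sum>j<(1::nat). q j * (const c * U)) + R"
    "\<And>\<beta> j. cf R \<beta> \<noteq> 0 \<Longrightarrow> j < (1::nat) \<Longrightarrow> \<not> 0 \<le> \<beta>"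
    by (rule divide[OF conv_one]) blast
  have "cf R \<beta> = 0" for \<beta> using q(3)[of \<beta> 0] by (auto simp: le_fun_def)
  then have "R = 0" by (intro pseries_eqI) simp
  then have "q 0 * const c * U = 1" using q(2) by (simp add: mult.assoc)
  moreover have "q 0 * const c \<in> conv m" using q(1)[of 0] by (intro conv_closed) auto
  ultimately show ?thesis by (rule that[rotated])
qed

section \<open>Initial exponents\<close>

lemma exponent_less_iff:
  "exponent_less m \<beta> \<gamma> \<longleftrightarrow> deg m \<beta> < deg m \<gamma> \<or>
     deg m \<beta> = deg m \<gamma> \<and> (\<exists>i<m. (\<forall>j<i. \<beta> j = \<gamma> j) \<and> \<beta> i < \<gamma> i)"
proof -
  have "(map \<beta> [0..<m], map \<gamma> [0..<m]) \<in> lex less_than \<longleftrightarrow>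
      (\<exists>i<m. take i (map \<beta> [0..<m]) = take i (map \<gamma> [0..<m]) \<and> map \<beta> [0..<m] ! i < map \<gamma> [0..<m] ! i)"
    by (auto simp: lexord_lex lexord_take_index_conv)
  also have "\<dots> \<longleftrightarrow> (\<exists>i<m. (\<forall>j<i. \<beta> j = \<gamma> j) \<and> \<beta> i < \<gamma> i)"
    by (intro ex_cong1 conj_cong refl) (auto simp: take_map)
  finally show ?thesis unfolding exponent_less_def by simp
qed

lemma exponent_less_irrefl: "\<not> exponent_less m \<beta> \<beta>"
  by (simp add: exponent_less_iff)

lemma exponent_less_trans: "exponent_less m \<alpha> \<beta> \<Longrightarrow> exponent_less m \<beta> \<gamma> \<Longrightarrow> exponent_less m \<alpha> \<gamma>"
proof -
  have "trans (lex less_than)" by (rule lex_transI) simp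
  then show "exponent_less m \<alpha> \<beta> \<Longrightarrow> exponent_less m \<beta> \<gamma> \<Longrightarrow> exponent_less m \<alpha> \<gamma>"
    unfolding exponent_less_def by (rule transD)
qed

lemma exponent_less_total:
  assumes "\<beta> \<in> exponents m" "\<gamma> \<in> exponents m" "\<beta> \<noteq> \<gamma>"
  shows "exponent_less m \<beta> \<gamma> \<or> exponent_less m \<gamma> \<beta>"
proof -
  obtain i0 where "\<beta> i0 \<noteq> \<gamma> i0" using assms(3) by blast
  define i where "i = (LEAST i. \<beta> i \<noteq> \<gamma> i)"
  have i: "\<beta> i \<noteq> \<gamma> i" "\<And>j. j < i \<Longrightarrow> \<beta> j = \<gamma> j"
    unfolding i_def using LeastI[of "\<lambda>i. \<beta> i \<noteq> \<gamma> i" i0] \<open>\<beta> i0 \<noteq> \<gamma> i0\<close>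
    by (blast, metis (mono_tags, lifting) not_less_Least)
  have "i < m"
  proof (rule ccontr)
    assume "\<not> i < m"
    then show False using i(1) assms(1,2) by (simp add: exponents_def)
  qed
  then show ?thesis unfolding exponent_less_iff using i by (metis linorder_neqE_nat)
qed

lemma exponent_less_add: "exponent_less m \<beta> \<gamma> \<Longrightarrow> exponent_less m (\<beta> + \<delta>) (\<gamma> + \<delta>)"
  by (auto simp: exponent_less_iff deg_add)

lemma exponent_less_deg: "exponent_less m \<beta> \<gamma> \<Longrightarrow> deg m \<beta> \<le> deg m \<gamma>"
  by (auto simp: exponent_less_iff)

lemma exponent_minimum:
  assumes "S \<subseteq> exponents m" "\<beta> \<in> S"
  obtains \<alpha> where "\<alpha> \<in> S" "\<And>\<gamma>. \<gamma> \<in> S \<Longrightarrow> \<gamma> \<noteq> \<alpha> \<Longrightarrow> exponent_less m \<alpha> \<gamma>"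
proof -
  let ?r = "inv_image (lex less_than) (\<lambda>\<beta>. deg m \<beta> # map \<beta> [0..<m])"
  have "wf ?r" by (intro wf_inv_image wf_lex wf_less_than)
  then obtain \<alpha> where \<alpha>: "\<alpha> \<in> S"
    "\<And>\<gamma>. (\<gamma>, \<alpha>) \<in> ?r \<Longrightarrow> \<gamma> \<notin> S"
    by (rule wfE_min[OF _ assms(2)]) (rule that; blast)
  show ?thesis
  proof (rule that[OF \<alpha>(1)])
    fix \<gamma> assume \<gamma>: "\<gamma> \<in> S" "\<gamma> \<noteq> \<alpha>"
    then have "\<not> exponent_less m \<gamma> \<alpha>" using \<alpha>(2)[of \<gamma>] by (auto simp: exponent_less_def)
    moreover have "\<alpha> \<in> exponents m" "\<gamma> \<in> exponents m" using \<alpha>(1) \<gamma>(1) assms(1) by auto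
    ultimately show "exponent_less m \<alpha> \<gamma>" using exponent_less_total \<gamma>(2) by blast
  qed
qed

text \<open>
  A relational form of the initial exponent, which is not defined for the zero series.
\<close>

definition is_initial :: "nat \<Rightarrow> 'a::comm_ring_1 pseries \<Rightarrow> (nat \<Rightarrow> nat) \<Rightarrow> bool" where
  "is_initial m F \<beta> \<longleftrightarrow> cf F \<beta> \<noteq> 0 \<and> (\<forall>\<gamma>. cf F \<gamma> \<noteq> 0 \<longrightarrow> \<gamma> \<noteq> \<beta> \<longrightarrow> exponent_less m \<beta> \<gamma>)"

lemma is_initial_unique: "is_initial m F \<beta> \<Longrightarrow> is_initial m F \<gamma> \<Longrightarrow> \<beta> = \<gamma>"
  unfolding is_initial_def using exponent_less_irrefl[of m \<beta>] exponent_less_trans[of m \<beta> \<gamma> \<beta>] by blast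

lemma is_initial_exists:
  assumes "F \<in> conv m" "F \<noteq> 0"
  obtains \<beta> where "is_initial m F \<beta>"
proof -
  have "{\<beta>. cf F \<beta> \<noteq> 0} \<subseteq> exponents m" using conv_suppD[OF assms(1)] by auto
  moreover obtain \<beta> where "cf F \<beta> \<noteq> 0" using assms(2) pseries_eqI[of F 0] by auto
  ultimately obtain \<alpha> where "\<alpha> \<in> {\<beta>. cf F \<beta> \<noteq> 0}"
    "\<And>\<gamma>. \<gamma> \<in> {\<beta>. cf F \<beta> \<noteq> 0} \<Longrightarrow> \<gamma> \<noteq> \<alpha> \<Longrightarrow> exponent_less m \<alpha> \<gamma>"
    using exponent_minimum[of "{\<beta>. cf F \<beta> \<noteq> 0}" m \<beta>] by blast
  then show ?thesis using that by (auto simp: is_initial_def)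
qed

lemma initial_exponent_eq:
  assumes "is_initial m F \<beta>"
  shows "initial_exponent m (cf F) = \<beta>"
  unfolding initial_exponent_def series_support_def
proof (rule the_equality)
  show "\<beta> \<in> {\<beta>. cf F \<beta> \<noteq> 0} \<and> (\<forall>\<gamma>\<in>{\<beta>. cf F \<beta> \<noteq> 0}. \<gamma> \<noteq> \<beta> \<longrightarrow> exponent_less m \<beta> \<gamma>)"
    using assms by (auto simp: is_initial_def)
  fix \<gamma> assume "\<gamma> \<in> {\<beta>. cf F \<beta> \<noteq> 0} \<and> (\<forall>\<delta>\<in>{\<beta>. cf F \<beta> \<noteq> 0}. \<delta> \<noteq> \<gamma> \<longrightarrow> exponent_less m \<gamma> \<delta>)"
  then have "is_initial m F \<gamma>" by (auto simp: is_initial_def)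
  then show "\<gamma> = \<beta>" using assms is_initial_unique by blast
qed

lemma is_initial_order_ge: "is_initial m F \<beta> \<Longrightarrow> order_ge m (deg m \<beta>) F"
  unfolding is_initial_def order_ge_def using exponent_less_deg by (metis order_refl)

text \<open>As the ordering refines the degree, the initial exponent only depends on the lowest-degree part.\<close>

lemma is_initial_perturb:
  assumes F: "is_initial m F \<beta>" and G: "order_ge m (Suc (deg m \<beta>)) (G - F)"
  shows "is_initial m G \<beta>"
proof -
  have eq: "cf G \<gamma> = cf F \<gamma>" if "deg m \<gamma> \<le> deg m \<beta>" for \<gamma>
    using G that unfolding order_ge_def by (metis cf_diff diff_eq_eq add_0 not_less_eq_eq)
  show ?thesis unfolding is_initial_def
  proof (intro conjI allI impI)
    show "cf G \<beta> \<noteq> 0" using F eq[of \<beta>] by (simp add: is_initial_def)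
    fix \<gamma> assume \<gamma>: "cf G \<gamma> \<noteq> 0" "\<gamma> \<noteq> \<beta>"
    show "exponent_less m \<beta> \<gamma>"
    proof (cases "deg m \<gamma> \<le> deg m \<beta>")
      case True
      then show ?thesis using F eq \<gamma> by (simp add: is_initial_def)
    qed (simp add: exponent_less_iff)
  qed
qed

text \<open>
  Any other pair of exponents with the same sum would have to be larger in both components.
\<close>

lemma is_initial_mult:
  assumes F: "F \<in> conv m" "is_initial m F \<alpha>" and G: "G \<in> conv m" "is_initial m G \<beta>"
  shows "cf (F * G) (\<alpha> + \<beta>) = cf F \<alpha> * cf G \<beta>"
proof -
  have "finsupp \<alpha>" "finsupp \<beta>"
    using F G conv_suppD exponents_finsupp unfolding is_initial_def by metis+
  then have fin: "finite (splits (\<alpha> + \<beta>))" by (intro finite_splits finsupp_add)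
  have "cf (F * G) (\<alpha> + \<beta>) = (\<Sum>(\<gamma>, \<delta>)\<in>{(\<alpha>, \<beta>)}. cf F \<gamma> * cf G \<delta>)"
    unfolding cf_times
  proof (rule sum.mono_neutral_right[OF fin])
    show "{(\<alpha>, \<beta>)} \<subseteq> splits (\<alpha> + \<beta>)" by (simp add: splits_def)
    show "\<forall>i\<in>splits (\<alpha> + \<beta>) - {(\<alpha>, \<beta>)}. (case i of (\<gamma>, \<delta>) \<Rightarrow> cf F \<gamma> * cf G \<delta>) = 0"
    proof
      fix x assume x: "x \<in> splits (\<alpha> + \<beta>) - {(\<alpha>, \<beta>)}"
      obtain \<gamma> \<delta> where x_eq: "x = (\<gamma>, \<delta>)" by (cases x)
      have s: "(\<gamma>, \<delta>) \<in> splits (\<alpha> + \<beta>)" "(\<gamma>, \<delta>) \<noteq> (\<alpha>, \<beta>)" using x x_eq by auto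
      have "cf F \<gamma> * cf G \<delta> = 0"
      proof (rule ccontr)
        assume "cf F \<gamma> * cf G \<delta> \<noteq> 0"
        then have nz: "cf F \<gamma> \<noteq> 0" "cf G \<delta> \<noteq> 0" by auto
        have eq: "\<gamma> + \<delta> = \<alpha> + \<beta>" using s by (simp add: splits_def)
        then have ne: "\<gamma> \<noteq> \<alpha>" "\<delta> \<noteq> \<beta>" using s(2) by auto
        have "exponent_less m \<alpha> \<gamma>" "exponent_less m \<beta> \<delta>"
          using F(2) G(2) nz ne by (auto simp: is_initial_def)
        then have "exponent_less m (\<alpha> + \<beta>) (\<gamma> + \<beta>)" "exponent_less m (\<beta> + \<gamma>) (\<delta> + \<gamma>)"
          by (auto intro: exponent_less_add)
        then have "exponent_less m (\<alpha> + \<beta>) (\<gamma> + \<delta>)"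
          using exponent_less_trans by (metis add.commute)
        then show False using eq exponent_less_irrefl by metis
      qed
      then show "(case x of (\<gamma>, \<delta>) \<Rightarrow> cf F \<gamma> * cf G \<delta>) = 0" by (simp add: x_eq)
    qed
  qed
  then show ?thesis by simp
qed

lemma conv_no_zero_divisors:
  assumes "F \<in> conv m" "G \<in> conv m" "F * G = 0"
  shows "F = 0 \<or> G = 0"
proof (rule ccontr)
  assume "\<not> (F = 0 \<or> G = 0)"
  then obtain \<alpha> \<beta> where "is_initial m F \<alpha>" "is_initial m G \<beta>"
    using is_initial_exists assms by metis
  then have "cf F \<alpha> * cf G \<beta> = 0" "cf F \<alpha> \<noteq> 0" "cf G \<beta> \<noteq> 0"
    using is_initial_mult[OF assms(1) _ assms(2)] assms(3) by (auto simp: is_initial_def)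
  then show False by simp
qed

text \<open>
  On exponents of bounded degree the ordering is induced by positive weights: a large constant
  accounts for the degree, and perturbing it by decreasing powers of a base exceeding the degree
  bound accounts for the lexicographic comparison.
\<close>

lemma exponent_less_weights:
  "\<exists>w. (\<forall>i. 0 < w i) \<and>
    (\<forall>\<alpha> \<beta>. deg m \<alpha> \<le> D \<longrightarrow> exponent_less m \<alpha> \<beta> \<longrightarrow> wt m w \<alpha> < wt m w \<beta>)"
proof (intro exI conjI allI impI)
  define b where "b = Suc D"
  define c where "c i = b ^ (m - i)" for i
  define B where "B = D * b ^ m + 1"
  let ?w = "\<lambda>i. B + c i"
  show "0 < ?w i" for i by (simp add: B_def)
  fix \<alpha> \<beta> assume D: "deg m \<alpha> \<le> D" and less: "exponent_less m \<alpha> \<beta>"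
  have wt: "wt m ?w \<gamma> = B * deg m \<gamma> + wt m c \<gamma>" for \<gamma>
    by (simp add: wt_def deg_def sum_distrib_left sum.distrib algebra_simps)
  show "wt m ?w \<alpha> < wt m ?w \<beta>"
  proof (cases "deg m \<alpha> < deg m \<beta>")
    case True
    have "wt m c \<alpha> \<le> (\<Sum>i<m. b ^ m * \<alpha> i)"
      unfolding wt_def c_def by (intro sum_mono mult_right_mono power_increasing) (auto simp: b_def)
    also have "\<dots> \<le> b ^ m * D" using D by (simp add: deg_def sum_distrib_left[symmetric])
    finally have "wt m c \<alpha> < B" by (simp add: B_def mult.commute)
    then have "B * deg m \<alpha> + wt m c \<alpha> < B * Suc (deg m \<alpha>)" by simp
    also have "\<dots> \<le> B * deg m \<beta>" using True by (intro mult_left_mono) auto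
    finally show ?thesis unfolding wt by simp
  next
    case False
    then obtain i where i: "deg m \<alpha> = deg m \<beta>" "i < m" "\<And>j. j < i \<Longrightarrow> \<alpha> j = \<beta> j" "\<alpha> i < \<beta> i"
      using less by (auto simp: exponent_less_iff)
    have split: "wt m c \<gamma> = (\<Sum>j<i. c j * \<gamma> j) + c i * \<gamma> i + (\<Sum>j\<in>{i<..<m}. c j * \<gamma> j)" for \<gamma>
    proof -
      have eq: "{..<m} = insert i ({..<i} \<union> {i<..<m})" using i(2) by auto
      have "wt m c \<gamma> = c i * \<gamma> i + (\<Sum>j\<in>{..<i} \<union> {i<..<m}. c j * \<gamma> j)"
        unfolding wt_def eq by (rule sum.insert) auto
      also have "(\<Sum>j\<in>{..<i} \<union> {i<..<m}. c j * \<gamma> j) = (\<Sum>j<i. c j * \<gamma> j) + (\<Sum>j\<in>{i<..<m}. c j * \<gamma> j)"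
        by (rule sum.union_disjoint) auto
      finally show ?thesis by simp
    qed
    have "(\<Sum>j\<in>{i<..<m}. c j * \<alpha> j) \<le> (\<Sum>j\<in>{i<..<m}. b ^ (m - Suc i) * \<alpha> j)"
      unfolding c_def by (intro sum_mono mult_right_mono power_increasing) (auto simp: b_def)
    also have "\<dots> = b ^ (m - Suc i) * (\<Sum>j\<in>{i<..<m}. \<alpha> j)" by (simp add: sum_distrib_left)
    also have "\<dots> \<le> b ^ (m - Suc i) * D"
    proof -
      have "(\<Sum>j\<in>{i<..<m}. \<alpha> j) \<le> deg m \<alpha>" unfolding deg_def by (rule sum_mono2) auto
      then show ?thesis using D by (intro mult_left_mono) auto
    qed
    also have "\<dots> < b ^ (m - Suc i) * b" by (simp add: b_def)
    also have "\<dots> = c i" using i(2) by (simp add: c_def power_Suc2[symmetric] Suc_diff_Suc del: power_Suc2)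
    finally have "(\<Sum>j\<in>{i<..<m}. c j * \<alpha> j) < c i" .
    then have "c i * \<alpha> i + (\<Sum>j\<in>{i<..<m}. c j * \<alpha> j) < c i * Suc (\<alpha> i)" by simp
    also have "\<dots> \<le> c i * \<beta> i" using i(4) by (intro mult_left_mono) auto
    finally have "wt m c \<alpha> < wt m c \<beta>" unfolding split using i(3) by simp
    then show ?thesis unfolding wt using i(1) by simp
  qed
qed

text \<open>
  Dickson's lemma, by induction on the number of variables: forgetting the last coordinate, a finite set \<open>B\<close>
  suffices. It serves all elements whose last coordinate is at least that of the respective element of
  \<open>B\<close>; the others lie in finitely many slices with fixed last coordinate, each of which has a finite basis.
\<close>

lemma dickson:
  assumes "A \<subseteq> exponents m"
  obtains B where "B \<subseteq> A" "finite B" "\<And>a. a \<in> A \<Longrightarrow> \<exists>b\<in>B. b \<le> a"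
proof -
  have "\<forall>A. A \<subseteq> exponents m \<longrightarrow> (\<exists>B. B \<subseteq> A \<and> finite B \<and> (\<forall>a\<in>A. \<exists>b\<in>B. b \<le> a))"
  proof (induction m)
    case 0
    have "exponents 0 = {0}" by (auto simp: exponents_def fun_eq_iff)
    then show ?case by (metis finite.emptyI finite.insertI order_refl rev_finite_subset)
  next
    case (Suc m)
    define proj where "proj a = a(m := 0)" for a :: "nat \<Rightarrow> nat"
    have ind: "\<exists>B. B \<subseteq> A \<and> finite B \<and> (\<forall>a\<in>A. \<exists>b\<in>B. proj b \<le> proj a)" if "A \<subseteq> exponents (Suc m)" for A
    proof -
      have "proj ` A \<subseteq> exponents m"
      proof
        fix x assume "x \<in> proj ` A"
        then obtain a where a: "a \<in> A" "x = proj a" by blast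
        have "x i = 0" if "m \<le> i" for i
          using a that \<open>A \<subseteq> _\<close> by (cases "i = m") (auto simp: proj_def exponents_def)
        then show "x \<in> exponents m" by (simp add: exponents_def)
      qed
      then obtain B where B: "B \<subseteq> proj ` A" "finite B" "\<forall>a\<in>proj ` A. \<exists>b\<in>B. b \<le> a"
        using Suc.IH by meson
      then obtain C where "C \<subseteq> A" "finite C" "B = proj ` C" using finite_subset_image by meson
      then show ?thesis using B(3) by (intro exI[of _ C]) auto
    qed
    show ?case
    proof (intro allI impI)
      fix A assume A: "A \<subseteq> exponents (Suc m)"
      obtain B where B: "B \<subseteq> A" "finite B" "\<forall>a\<in>A. \<exists>b\<in>B. proj b \<le> proj a" using ind[OF A] by blast
      have "\<exists>C. C \<subseteq> {a \<in> A. a m = t} \<and> finite C \<and> (\<forall>a\<in>{a \<in> A. a m = t}. \<exists>b\<in>C. proj b \<le> proj a)" for t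
        by (rule ind) (use A in auto)
      then have "\<exists>C. \<forall>t. C t \<subseteq> {a \<in> A. a m = t} \<and> finite (C t) \<and>
          (\<forall>a\<in>{a \<in> A. a m = t}. \<exists>b\<in>C t. proj b \<le> proj a)" by (intro choice allI)
      then obtain C where "\<forall>t. C t \<subseteq> {a \<in> A. a m = t} \<and> finite (C t) \<and>
          (\<forall>a\<in>{a \<in> A. a m = t}. \<exists>b\<in>C t. proj b \<le> proj a)" by (elim exE)
      then have C: "C t \<subseteq> {a \<in> A. a m = t}" "finite (C t)"
        "\<forall>a\<in>{a \<in> A. a m = t}. \<exists>b\<in>C t. proj b \<le> proj a" for t by blast+
      have le: "b \<le> a" if "proj b \<le> proj a" "b m \<le> a m" for a b
      proof (rule le_funI)
        fix i show "b i \<le> a i"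
          using le_funD[OF that(1), of i] that(2) by (cases "i = m") (auto simp: proj_def)
      qed
      show "\<exists>B. B \<subseteq> A \<and> finite B \<and> (\<forall>a\<in>A. \<exists>b\<in>B. b \<le> a)"
      proof (intro exI conjI ballI)
        let ?T = "\<Union>b\<in>B. {..b m}"
        show "B \<union> (\<Union>t\<in>?T. C t) \<subseteq> A" using B C(1) by blast
        show "finite (B \<union> (\<Union>t\<in>?T. C t))" using B C(2) by blast
        fix a assume a: "a \<in> A"
        obtain b where b: "b \<in> B" "proj b \<le> proj a" using B a by blast
        show "\<exists>b\<in>B \<union> (\<Union>t\<in>?T. C t). b \<le> a"
        proof (cases "b m \<le> a m")
          case True
          then show ?thesis using b le by blast
        next
          case False
          obtain b' where b': "b' \<in> C (a m)" "proj b' \<le> proj a" using C(3)[of "a m"] a by blast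
          have "b' m = a m" using b'(1) C(1)[of "a m"] by blast
          then have "b' \<le> a" using b'(2) by (rule_tac le) auto
          moreover have "a m \<in> ?T" using b False by (intro UN_I[of b]) auto
          ultimately show ?thesis using b' by blast
        qed
      qed
    qed
  qed
  then show ?thesis using assms that by meson
qed

section \<open>Standard bases, the Artin--Rees property and closedness of ideals\<close>

definition ideal_gen :: "nat \<Rightarrow> nat \<Rightarrow> (nat \<Rightarrow> 'a::{real_normed_field,banach} pseries) \<Rightarrow> 'a pseries set" where
  "ideal_gen m k f = {\<Sum>i<k. a i * f i | a. \<forall>i<k. a i \<in> conv m}"

lemma ideal_genI: "(\<And>i. i < k \<Longrightarrow> a i \<in> conv m) \<Longrightarrow> (\<Sum>i<k. a i * f i) \<in> ideal_gen m k f"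
  by (auto simp: ideal_gen_def)

lemma ideal_genE:
  assumes "h \<in> ideal_gen m k f"
  obtains a where "\<And>i. i < k \<Longrightarrow> a i \<in> conv m" "h = (\<Sum>i<k. a i * f i)"
  using assms by (auto simp: ideal_gen_def)

lemma ideal_gen_add: "g \<in> ideal_gen m k f \<Longrightarrow> h \<in> ideal_gen m k f \<Longrightarrow> g + h \<in> ideal_gen m k f"
  by (elim ideal_genE, simp add: sum.distrib[symmetric] distrib_right[symmetric])
     (rule ideal_genI, auto intro: conv_add)

lemma ideal_gen_mult: "c \<in> conv m \<Longrightarrow> h \<in> ideal_gen m k f \<Longrightarrow> c * h \<in> ideal_gen m k f"
  by (elim ideal_genE, simp add: sum_distrib_left mult.assoc[symmetric])
     (rule ideal_genI, auto intro: conv_mult)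

lemma ideal_gen_zero: "0 \<in> ideal_gen m k f"
  using ideal_genI[of k "\<lambda>_. 0" m f] by (simp add: conv_zero)

lemma ideal_gen_uminus: "h \<in> ideal_gen m k f \<Longrightarrow> - h \<in> ideal_gen m k f"
  using ideal_gen_mult[of "- 1" m h k f] by (simp add: conv_uminus conv_one)

lemma ideal_gen_diff: "g \<in> ideal_gen m k f \<Longrightarrow> h \<in> ideal_gen m k f \<Longrightarrow> g - h \<in> ideal_gen m k f"
  using ideal_gen_add[of g m k f "- h"] ideal_gen_uminus by fastforce

lemma ideal_gen_sum: "(\<And>x. x \<in> A \<Longrightarrow> h x \<in> ideal_gen m k f) \<Longrightarrow> sum h A \<in> ideal_gen m k f"
  by (induction A rule: infinite_finite_induct) (auto intro: ideal_gen_zero ideal_gen_add)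

lemma ideal_gen_base: "i < k \<Longrightarrow> f i \<in> ideal_gen m k f"
  using ideal_genI[of k "\<lambda>j. if j = i then 1 else 0" m f]
  by (simp add: conv_one conv_zero if_distrib[of "\<lambda>x. x * _"] cong: if_cong)

lemma ideal_gen_conv: "(\<And>i. i < k \<Longrightarrow> f i \<in> conv m) \<Longrightarrow> ideal_gen m k f \<subseteq> conv m"
  by (auto elim!: ideal_genE intro!: conv_sum conv_mult)

lemma ideal_gen_mono: "k \<le> l \<Longrightarrow> ideal_gen m k f \<subseteq> ideal_gen m l f"
  by (auto elim!: ideal_genE intro!: ideal_gen_sum ideal_gen_mult ideal_gen_base)

text \<open>
  Dickson's lemma provides the finitely many vertices of the diagram, and the weights of
  \<open>exponent_less_weights\<close> for the largest degree of a vertex make the initial exponents of the chosen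
  elements minimal in weight, as the division theorem demands.
\<close>

lemma standard_basis:
  assumes f: "\<And>i. i < k \<Longrightarrow> f i \<in> conv m"
  obtains s w \<alpha> F where "division m s w \<alpha> F" "\<And>j. j < s \<Longrightarrow> F j \<in> ideal_gen m k f"
    "\<And>j. j < s \<Longrightarrow> order_ge m (deg m (\<alpha> j)) (F j)"
    "\<And>G \<beta>. G \<in> ideal_gen m k f \<Longrightarrow> is_initial m G \<beta> \<Longrightarrow> \<exists>j<s. \<alpha> j \<le> \<beta>"
proof -
  let ?I = "ideal_gen m k f"
  define N where "N = {\<beta>. \<exists>G\<in>?I. is_initial m G \<beta>}"
  have I: "?I \<subseteq> conv m" by (rule ideal_gen_conv[OF f])
  have "N \<subseteq> exponents m" using I conv_suppD by (fastforce simp: N_def is_initial_def)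
  then obtain B where B: "B \<subseteq> N" "finite B" "\<And>a. a \<in> N \<Longrightarrow> \<exists>b\<in>B. b \<le> a" by (rule dickson) blast
  obtain \<alpha> where \<alpha>: "bij_betw \<alpha> {0..<card B} B" using ex_bij_betw_nat_finite[OF B(2)] by blast
  define s where "s = card B"
  have \<alpha>N: "\<exists>G\<in>?I. is_initial m G (\<alpha> j)" if "j < s" for j
  proof -
    have "\<alpha> j \<in> N" using bij_betwE[OF \<alpha>] B(1) that by (auto simp: s_def)
    then show ?thesis by (simp add: N_def)
  qed
  then obtain G where G: "\<And>j. j < s \<Longrightarrow> G j \<in> ?I" "\<And>j. j < s \<Longrightarrow> is_initial m (G j) (\<alpha> j)" by metis
  define F where "F j = const (inverse (cf (G j) (\<alpha> j))) * G j" for j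
  have FI: "F j \<in> ?I" if "j < s" for j unfolding F_def by (intro ideal_gen_mult conv_const G that)
  have F: "is_initial m (F j) (\<alpha> j)" "cf (F j) (\<alpha> j) = 1" if "j < s" for j
    using G(2)[OF that] by (auto simp: F_def is_initial_def cf_const_times)
  define D where "D = Max (insert 0 (deg m ` B))"
  obtain w where w: "\<forall>i. 0 < w i"
    "\<forall>\<alpha> \<beta>. deg m \<alpha> \<le> D \<longrightarrow> exponent_less m \<alpha> \<beta> \<longrightarrow> wt m w \<alpha> < wt m w \<beta>"
    using exponent_less_weights[of m D] by (elim exE conjE)
  have "division m s w \<alpha> F"
  proof
    show "\<forall>i<m. 0 < w i" using w by simp
    fix j assume j: "j < s"
    show "F j \<in> conv m" using FI[OF j] I by blast
    show "cf (F j) (\<alpha> j) = 1" by (rule F(2)[OF j])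
    then show "\<alpha> j \<in> exponents m" using conv_suppD[OF \<open>F j \<in> conv m\<close>] by (metis one_neq_zero)
    fix \<beta> assume b: "cf (F j) \<beta> \<noteq> 0" "\<beta> \<noteq> \<alpha> j"
    have "deg m (\<alpha> j) \<le> D"
      unfolding D_def using B(2) j bij_betwE[OF \<alpha>] by (intro Max_ge) (auto simp: s_def)
    then show "wt m w (\<alpha> j) < wt m w \<beta>"
      using w(2) F(1)[OF j] b by (auto simp: is_initial_def)
  qed
  moreover have "\<exists>j<s. \<alpha> j \<le> \<beta>" if "G \<in> ?I" "is_initial m G \<beta>" for G \<beta>
  proof -
    have "\<beta> \<in> N" using that by (auto simp: N_def)
    then obtain b where b: "b \<in> B" "b \<le> \<beta>" using B(3) by blast
    then obtain j where "j < s" "b = \<alpha> j" using bij_betw_imp_surj_on[OF \<alpha>] by (force simp: s_def)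
    then show ?thesis using b by blast
  qed
  moreover have "order_ge m (deg m (\<alpha> j)) (F j)" if "j < s" for j by (rule is_initial_order_ge[OF F(1)[OF that]])
  ultimately show ?thesis using that FI by metis
qed

text \<open>
  Division by a standard basis expresses \<open>h\<close> without remainder, as the initial exponent of a remainder
  would belong to the diagram. The quotients lose at most the degree of a vertex, so \<open>c\<close> can be taken
  as the sum of these degrees.
\<close>

lemma artin_rees:
  assumes f: "\<And>i. i < k \<Longrightarrow> f i \<in> conv m"
  obtains c where "\<And>p h. h \<in> ideal_gen m k f \<Longrightarrow> order_ge m p h \<Longrightarrow>
    \<exists>b. (\<forall>i<k. b i \<in> conv m \<and> order_ge m (p - c) (b i)) \<and> h = (\<Sum>i<k. b i * f i)"
proof -
  obtain s w \<alpha> F where div: "division m s w \<alpha> F" and FI: "\<And>j. j < s \<Longrightarrow> F j \<in> ideal_gen m k f"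
    "\<And>j. j < s \<Longrightarrow> order_ge m (deg m (\<alpha> j)) (F j)"
    "\<And>G \<beta>. G \<in> ideal_gen m k f \<Longrightarrow> is_initial m G \<beta> \<Longrightarrow> \<exists>j<s. \<alpha> j \<le> \<beta>"
    by (rule standard_basis[OF f]) blast+
  interpret division m s w \<alpha> F by (rule div)
  have "\<exists>a. (\<forall>i<k. a i \<in> conv m) \<and> F j = (\<Sum>i<k. a i * f i)" if "j < s" for j
    using FI(1)[OF that] by (auto simp: ideal_gen_def)
  then obtain u where u: "\<And>j i. j < s \<Longrightarrow> i < k \<Longrightarrow> u j i \<in> conv m"
    "\<And>j. j < s \<Longrightarrow> F j = (\<Sum>i<k. u j i * f i)" by metis
  define c where "c = (\<Sum>j<s. deg m (\<alpha> j))"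
  have c: "deg m (\<alpha> j) \<le> c" if "j < s" for j unfolding c_def by (rule member_le_sum) (use that in auto)
  show ?thesis
  proof (rule that[of c])
    fix p h assume h: "h \<in> ideal_gen m k f" "order_ge m p h"
    have "ideal_gen m k f \<subseteq> conv m" by (rule ideal_gen_conv) (rule f)
    then have hc: "h \<in> conv m" using h by blast
    obtain q R where q: "\<And>j. j < s \<Longrightarrow> q j \<in> conv m" "R \<in> conv m" "h = (\<Sum>j<s. q j * F j) + R"
      "\<And>\<beta> j. cf R \<beta> \<noteq> 0 \<Longrightarrow> j < s \<Longrightarrow> \<not> \<alpha> j \<le> \<beta>"
      "\<And>p j. order_ge m p h \<Longrightarrow> (\<And>j. j < s \<Longrightarrow> order_ge m (deg m (\<alpha> j)) (F j)) \<Longrightarrow> j < s \<Longrightarrow>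
        order_ge m (p - deg m (\<alpha> j)) (q j)"
      by (rule divide[OF hc]) blast
    note q5 = q(5)[OF h(2) FI(2)]
    have "R = h - (\<Sum>j<s. q j * F j)" using q(3) by simp
    also have "\<dots> \<in> ideal_gen m k f"
      by (intro ideal_gen_diff h ideal_gen_sum ideal_gen_mult FI(1) q(1)) auto
    finally have R: "R \<in> ideal_gen m k f" .
    have "R = 0"
    proof (rule ccontr)
      assume "R \<noteq> 0"
      then obtain \<beta> where "is_initial m R \<beta>" using is_initial_exists q(2) by metis
      then show False using FI(3)[OF R] q(4) by (auto simp: is_initial_def)
    qed
    then have "h = (\<Sum>j<s. \<Sum>i<k. q j * u j i * f i)"
      using q(3) u(2) by (simp add: sum_distrib_left mult.assoc)
    also have "\<dots> = (\<Sum>i<k. (\<Sum>j<s. q j * u j i) * f i)"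
      by (subst sum.swap) (simp add: sum_distrib_right)
    finally have "h = (\<Sum>i<k. (\<Sum>j<s. q j * u j i) * f i)" .
    moreover have "(\<Sum>j<s. q j * u j i) \<in> conv m" if "i < k" for i
      using that by (intro conv_sum conv_mult q(1) u(1)) auto
    moreover have "order_ge m (p - c) (\<Sum>j<s. q j * u j i)" if "i < k" for i
    proof (rule order_ge_sum)
      fix j assume "j \<in> {..<s}"
      then show "order_ge m (p - c) (q j * u j i)"
        using q5[of j] c[of j] by (intro order_ge_mult'[of m "p - deg m (\<alpha> j)" _ 0]) auto
    qed
    ultimately show "\<exists>b. (\<forall>i<k. b i \<in> conv m \<and> order_ge m (p - c) (b i)) \<and> h = (\<Sum>i<k. b i * f i)"
      by (intro exI[of _ "\<lambda>i. \<Sum>j<s. q j * u j i"]) auto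
  qed
qed

text \<open>
  Krull's intersection theorem. If \<open>h\<close> had a nonzero remainder, then an element of the ideal that approximates
  \<open>h\<close> beyond the degree of the initial exponent of the remainder would put this exponent into the diagram.
\<close>

lemma ideal_closed:
  assumes f: "\<And>i. i < k \<Longrightarrow> f i \<in> conv m" and h: "h \<in> conv m"
    and approx: "\<And>p. \<exists>u\<in>ideal_gen m k f. order_ge m p (h - u)"
  shows "h \<in> ideal_gen m k f"
proof -
  obtain s w \<alpha> F where div: "division m s w \<alpha> F" and FI: "\<And>j. j < s \<Longrightarrow> F j \<in> ideal_gen m k f"
    "\<And>G \<beta>. G \<in> ideal_gen m k f \<Longrightarrow> is_initial m G \<beta> \<Longrightarrow> \<exists>j<s. \<alpha> j \<le> \<beta>"
    by (rule standard_basis[OF f]) blast+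
  interpret division m s w \<alpha> F by (rule div)
  obtain q R where q: "\<And>j. j < s \<Longrightarrow> q j \<in> conv m" "R \<in> conv m" "h = (\<Sum>j<s. q j * F j) + R"
    "\<And>\<beta> j. cf R \<beta> \<noteq> 0 \<Longrightarrow> j < s \<Longrightarrow> \<not> \<alpha> j \<le> \<beta>"
    by (rule divide[OF h]) blast
  have S: "(\<Sum>j<s. q j * F j) \<in> ideal_gen m k f"
    by (intro ideal_gen_sum ideal_gen_mult FI(1) q(1)) auto
  have "R = 0"
  proof (rule ccontr)
    assume "R \<noteq> 0"
    then obtain \<beta> where \<beta>: "is_initial m R \<beta>" using is_initial_exists q(2) by metis
    obtain u where u: "u \<in> ideal_gen m k f" "order_ge m (Suc (deg m \<beta>)) (h - u)" using approx by blast
    have "is_initial m (u - (\<Sum>j<s. q j * F j)) \<beta>"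
    proof (rule is_initial_perturb[OF \<beta>])
      have "u - (\<Sum>j<s. q j * F j) - R = - (h - u)" using q(3) by simp
      then show "order_ge m (Suc (deg m \<beta>)) (u - (\<Sum>j<s. q j * F j) - R)" using u(2) by (metis order_ge_uminus)
    qed
    then have "\<exists>j<s. \<alpha> j \<le> \<beta>" using FI(2) ideal_gen_diff[OF u(1) S] by blast
    then show False using q(4) \<beta> by (auto simp: is_initial_def)
  qed
  then show ?thesis using q(3) S by simp
qed

section \<open>Relations of regular sequences and perturbation\<close>

definition regular :: "nat \<Rightarrow> nat \<Rightarrow> (nat \<Rightarrow> 'a::{real_normed_field,banach} pseries) \<Rightarrow> bool" where
  "regular m k f \<longleftrightarrow> (\<forall>i<k. f i \<in> conv m) \<and>
     (\<forall>i<k. \<forall>b\<in>conv m. b * f i \<in> ideal_gen m i f \<longrightarrow> b \<in> ideal_gen m i f)"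

lemma regular_prefix: "regular m k f \<Longrightarrow> l \<le> k \<Longrightarrow> regular m l f"
  by (auto simp: regular_def)

lemma regular_conv: "regular m k f \<Longrightarrow> i < k \<Longrightarrow> f i \<in> conv m"
  by (simp add: regular_def)

text \<open>
  Coefficients \<open>C\<close> of a combination of the trivial relations \<open>f\<^sub>j f\<^sub>i - f\<^sub>i f\<^sub>j = 0\<close>: the tuple
  \<open>a\<^sub>i = \<Sum>\<^sub>j C\<^sub>i\<^sub>j f\<^sub>j\<close> satisfies \<open>\<Sum>\<^sub>i a\<^sub>i f\<^sub>i = 0\<close>.
\<close>

definition koszul :: "nat \<Rightarrow> nat \<Rightarrow> nat \<Rightarrow> (nat \<Rightarrow> nat \<Rightarrow> 'a::{real_normed_field,banach} pseries) \<Rightarrow> bool" where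
  "koszul m k p C \<longleftrightarrow>
     (\<forall>i<k. \<forall>j<k. C i j \<in> conv m \<and> order_ge m p (C i j) \<and> C i j = - C j i)"

lemma koszul_conv: "koszul m k p C \<Longrightarrow> i < k \<Longrightarrow> j < k \<Longrightarrow> C i j \<in> conv m"
  and koszul_order_ge: "koszul m k p C \<Longrightarrow> i < k \<Longrightarrow> j < k \<Longrightarrow> order_ge m p (C i j)"
  and koszul_antisym: "koszul m k p C \<Longrightarrow> i < k \<Longrightarrow> j < k \<Longrightarrow> C i j = - C j i"
  unfolding koszul_def by blast+

lemma koszulI:
  assumes "\<And>i j. i < k \<Longrightarrow> j < k \<Longrightarrow> C i j \<in> conv m" "\<And>i j. i < k \<Longrightarrow> j < k \<Longrightarrow> order_ge m p (C i j)"
    "\<And>i j. i < k \<Longrightarrow> j < k \<Longrightarrow> C i j = - C j i"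
  shows "koszul m k p C"
  unfolding koszul_def by (intro allI impI conjI assms)

lemma koszul_weaken: "koszul m k p C \<Longrightarrow> q \<le> p \<Longrightarrow> koszul m k q C"
  unfolding koszul_def using order_ge_mono by blast

text \<open>
  By induction on \<open>k\<close>. In a relation of \<open>k + 1\<close> elements the last coefficient lies in the ideal of the others, by
  regularity, and Artin--Rees writes it as \<open>\<Sum>\<^sub>i b\<^sub>i f\<^sub>i\<close> with \<open>b\<^sub>i\<close> of controlled order. Subtracting the
  Koszul relation with coefficients \<open>b\<^sub>i\<close> leaves a relation of the first \<open>k\<close> elements.
\<close>

lemma koszul_syzygy:
  assumes "regular m k f"
  shows "\<exists>c. \<forall>p a. (\<forall>i<k. a i \<in> conv m \<and> order_ge m p (a i)) \<longrightarrow> (\<Sum>i<k. a i * f i) = 0 \<longrightarrow>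
    (\<exists>C. koszul m k (p - c) C \<and> (\<forall>i<k. a i = (\<Sum>j<k. C i j * f j)))"
  using assms
proof (induction k)
  case 0
  show ?case by (intro exI[of _ 0]) (simp add: koszul_def)
next
  case (Suc k)
  note f = regular_conv[OF Suc.prems]
  obtain c1 where c1: "\<And>p h. h \<in> ideal_gen m k f \<Longrightarrow> order_ge m p h \<Longrightarrow>
    \<exists>b. (\<forall>i<k. b i \<in> conv m \<and> order_ge m (p - c1) (b i)) \<and> h = (\<Sum>i<k. b i * f i)"
    by (rule artin_rees[of k f m]) (use f in auto)
  obtain c2 where c2: "\<And>p a. (\<forall>i<k. a i \<in> conv m \<and> order_ge m p (a i)) \<Longrightarrow> (\<Sum>i<k. a i * f i) = 0 \<Longrightarrow>
    (\<exists>C. koszul m k (p - c2) C \<and> (\<forall>i<k. a i = (\<Sum>j<k. C i j * f j)))"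
    using Suc.IH[OF regular_prefix[OF Suc.prems]] by auto
  show ?case
  proof (intro exI[of _ "c1 + c2"] allI impI)
    fix p and a :: "nat \<Rightarrow> 'a pseries"
    assume a: "\<forall>i<Suc k. a i \<in> conv m \<and> order_ge m p (a i)" and rel: "(\<Sum>i<Suc k. a i * f i) = 0"
    have "a k * f k = - (\<Sum>i<k. a i * f i)" using rel by (simp add: add_eq_0_iff)
    also have "\<dots> \<in> ideal_gen m k f" using a by (intro ideal_gen_uminus ideal_genI) auto
    finally have "a k \<in> ideal_gen m k f" using Suc.prems a by (auto simp: regular_def)
    then obtain b where b: "\<And>i. i < k \<Longrightarrow> b i \<in> conv m" "\<And>i. i < k \<Longrightarrow> order_ge m (p - c1) (b i)"
      "a k = (\<Sum>i<k. b i * f i)"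
      using c1[of "a k" p] a by auto
    define a' where "a' i = a i + b i * f k" for i
    have a': "\<forall>i<k. a' i \<in> conv m \<and> order_ge m (p - c1) (a' i)"
    proof (intro allI impI conjI)
      fix i assume i: "i < k"
      show "a' i \<in> conv m" unfolding a'_def using a i b f[of k] by (intro conv_closed) auto
      have "order_ge m p (a i)" using a i by simp
      then have "order_ge m (p - c1) (a i)" by (rule order_ge_mono) simp
      moreover have "order_ge m (p - c1) (b i * f k)" using b(2)[OF i] by (rule order_ge_mult'[of _ _ _ 0]) auto
      ultimately show "order_ge m (p - c1) (a' i)" unfolding a'_def by (rule order_ge_add)
    qed
    have "(\<Sum>i<k. a' i * f i) = (\<Sum>i<k. a i * f i) + (\<Sum>i<k. b i * f i) * f k"
      by (simp add: a'_def distrib_right sum.distrib sum_distrib_right mult.assoc mult.commute[of "f k"])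
    also have "\<dots> = 0" using rel b(3) by simp
    finally obtain C where C: "koszul m k (p - c1 - c2) C" "\<forall>i<k. a' i = (\<Sum>j<k. C i j * f j)"
      using c2[OF a'] by auto
    define D where "D i j = (if i < k then if j < k then C i j else - b i else if j < k then b j else 0)" for i j
    have "koszul m (Suc k) (p - (c1 + c2)) D"
    proof (rule koszulI)
      have C': "order_ge m (p - (c1 + c2)) (C i j)" if "i < k" "j < k" for i j
        using koszul_order_ge[OF C(1) that] by simp
      have b': "order_ge m (p - (c1 + c2)) (b i)" if "i < k" for i
        using b(2)[OF that] by (rule order_ge_mono) simp
      fix i j
      show "D i j \<in> conv m" using koszul_conv[OF C(1)] b(1) by (auto simp: D_def conv_zero intro: conv_uminus)
      show "order_ge m (p - (c1 + c2)) (D i j)" using C' b' by (simp add: D_def)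
      show "D i j = - D j i" using koszul_antisym[OF C(1), of i j] by (cases "i < k"; cases "j < k") (simp_all add: D_def)
    qed
    moreover have "a i = (\<Sum>j<Suc k. D i j * f j)" if "i < Suc k" for i
    proof (cases "i < k")
      case True
      then have "(\<Sum>j<k. D i j * f j) = a' i" using C(2) by (simp add: D_def)
      then show ?thesis using True by (simp add: D_def a'_def)
    next
      case False
      then have "i = k" using that by simp
      then show ?thesis using b(3) by (simp add: D_def)
    qed
    ultimately show "\<exists>C. koszul m (Suc k) (p - (c1 + c2)) C \<and> (\<forall>i<Suc k. a i = (\<Sum>j<Suc k. C i j * f j))"
      by blast
  qed
qed

lemma eq_uminus_zero:
  fixes S :: "'a::{real_normed_field,banach} pseries"
  assumes "S = - S"
  shows "S = 0"
proof (rule pseries_eqI)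
  fix \<beta>
  have "cf S \<beta> = - cf S \<beta>" using assms by (metis cf_uminus)
  then show "cf S \<beta> = cf 0 \<beta>" by (simp add: eq_neg_iff_add_eq_0)
qed

lemma koszul_diagonal: "koszul m k p C \<Longrightarrow> i < k \<Longrightarrow> C i i = 0"
  by (rule eq_uminus_zero) (rule koszul_antisym)

lemma koszul_cancel:
  fixes g :: "nat \<Rightarrow> 'a::{real_normed_field,banach} pseries"
  assumes "koszul m k p C"
  shows "(\<Sum>i<k. (\<Sum>j<k. C i j * g j) * g i) = 0"
proof (rule eq_uminus_zero)
  have "(\<Sum>i<k. (\<Sum>j<k. C i j * g j) * g i) = (\<Sum>i<k. \<Sum>j<k. C i j * g j * g i)"
    by (simp add: sum_distrib_right)
  also have "\<dots> = (\<Sum>j<k. \<Sum>i<k. C i j * g j * g i)" by (rule sum.swap)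
  also have "\<dots> = (\<Sum>j<k. \<Sum>i<k. - (C j i * g i * g j))"
  proof (intro sum.cong refl)
    fix i j assume "j \<in> {..<k}" "i \<in> {..<k}"
    then have "C i j = - C j i" by (intro koszul_antisym[OF assms]) simp_all
    then show "C i j * g j * g i = - (C j i * g i * g j)" by (simp add: mult_ac)
  qed
  also have "\<dots> = - (\<Sum>i<k. (\<Sum>j<k. C i j * g j) * g i)"
    by (simp add: sum_negf sum_distrib_right)
  finally show "(\<Sum>i<k. (\<Sum>j<k. C i j * g j) * g i) = - (\<Sum>i<k. (\<Sum>j<k. C i j * g j) * g i)" .
qed

lemma koszul_add: "koszul m k p C \<Longrightarrow> koszul m k p D \<Longrightarrow> koszul m k p (\<lambda>i j. C i j + D i j)"
proof (rule koszulI)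
  fix i j assume k: "koszul m k p C" "koszul m k p D" "i < k" "j < k"
  show "C i j + D i j \<in> conv m" using k by (intro conv_add koszul_conv)
  show "order_ge m p (C i j + D i j)" using k by (intro order_ge_add koszul_order_ge)
  show "C i j + D i j = - (C j i + D j i)"
    using koszul_antisym[OF k(1,3,4)] koszul_antisym[OF k(2-4)] by simp
qed

text \<open>
  The constant \<open>c\<close> bounds the loss of order both in the Artin--Rees property and in the coefficients of
  Koszul relations; the perturbation has to start beyond it for the corrections to gain order.
\<close>

locale perturbation =
  fixes m k :: nat and f g :: "nat \<Rightarrow> 'a::{real_normed_field,banach} pseries" and c \<mu> :: nat
  assumes f: "i < k \<Longrightarrow> f i \<in> conv m" and g: "i < k \<Longrightarrow> g i \<in> conv m"
    and close: "i < k \<Longrightarrow> order_ge m (Suc \<mu>) (g i - f i)" and c: "c \<le> \<mu>"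
    and artin_rees_f: "h \<in> ideal_gen m k f \<Longrightarrow> order_ge m p h \<Longrightarrow>
      \<exists>b. (\<forall>i<k. b i \<in> conv m \<and> order_ge m (p - c) (b i)) \<and> h = (\<Sum>i<k. b i * f i)"
    and koszul_f: "(\<forall>i<k. a i \<in> conv m \<and> order_ge m p (a i)) \<Longrightarrow> (\<Sum>i<k. a i * f i) = 0 \<Longrightarrow>
      \<exists>C. koszul m k (p - c) C \<and> (\<forall>i<k. a i = (\<Sum>j<k. C i j * f j))"
begin

lemma error_term:
  assumes "\<And>i. i < k \<Longrightarrow> order_ge m p (a i)"
  shows "order_ge m (p + Suc \<mu>) ((\<Sum>i<k. a i * g i) - (\<Sum>i<k. a i * f i))"
proof -
  have "(\<Sum>i<k. a i * g i) - (\<Sum>i<k. a i * f i) = (\<Sum>i<k. a i * (g i - f i))"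
    by (simp add: right_diff_distrib sum_subtractf)
  moreover have "order_ge m (p + Suc \<mu>) (\<Sum>i<k. a i * (g i - f i))"
    using assms close by (intro order_ge_sum order_ge_mult) auto
  ultimately show ?thesis by metis
qed

text \<open>
  If \<open>\<Sum>\<^sub>i a\<^sub>i g\<^sub>i\<close> has higher order than the \<open>a\<^sub>i\<close> suggest, then so has \<open>\<Sum>\<^sub>i a\<^sub>i f\<^sub>i\<close>, and by the
  Artin--Rees property it equals some \<open>\<Sum>\<^sub>i b\<^sub>i f\<^sub>i\<close> with \<open>b\<^sub>i\<close> of higher order. The difference
  \<open>a - b\<close> is a Koszul relation of \<open>f\<close>; the Koszul relation of \<open>g\<close> with the same coefficients
  therefore carries \<open>a\<close> to a tuple of higher order.
\<close>

lemma improve: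
  assumes a: "\<And>i. i < k \<Longrightarrow> a i \<in> conv m" "\<And>i. i < k \<Longrightarrow> order_ge m p (a i)"
    and \<nu>: "order_ge m \<nu> (\<Sum>i<k. a i * g i)" "p + c < \<nu>"
  shows "\<exists>a' C. (\<forall>i<k. a' i \<in> conv m \<and> order_ge m (Suc p) (a' i)) \<and> koszul m k 0 C \<and>
    (\<forall>i<k. a i = a' i + (\<Sum>j<k. C i j * g j))"
proof -
  let ?h = "\<Sum>i<k. a i * f i"
  have "order_ge m (Suc p + c) ((\<Sum>i<k. a i * g i) - ((\<Sum>i<k. a i * g i) - ?h))"
  proof (rule order_ge_diff)
    show "order_ge m (Suc p + c) (\<Sum>i<k. a i * g i)" using \<nu>(1) by (rule order_ge_mono) (use \<nu>(2) in simp)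
    have "order_ge m (p + Suc \<mu>) ((\<Sum>i<k. a i * g i) - ?h)" by (rule error_term) (rule a(2))
    then show "order_ge m (Suc p + c) ((\<Sum>i<k. a i * g i) - ?h)" by (rule order_ge_mono) (use c in simp)
  qed
  then have h: "order_ge m (Suc p + c) ?h" by simp
  obtain b where b: "\<And>i. i < k \<Longrightarrow> b i \<in> conv m" "\<And>i. i < k \<Longrightarrow> order_ge m (Suc p) (b i)"
    "?h = (\<Sum>i<k. b i * f i)"
    using artin_rees_f[OF ideal_genI h] a(1) by auto
  have "\<forall>i<k. a i - b i \<in> conv m \<and> order_ge m p (a i - b i)"
  proof (intro allI impI conjI)
    fix i assume i: "i < k"
    show "a i - b i \<in> conv m" using a(1)[OF i] b(1)[OF i] by (rule conv_diff)
    have "order_ge m p (b i)" using b(2)[OF i] by (rule order_ge_mono) simp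
    then show "order_ge m p (a i - b i)" using a(2)[OF i] by (rule order_ge_diff[rotated])
  qed
  moreover have "(\<Sum>i<k. (a i - b i) * f i) = 0"
    using b(3) by (simp add: left_diff_distrib sum_subtractf)
  ultimately obtain C where C: "koszul m k (p - c) C" "\<forall>i<k. a i - b i = (\<Sum>j<k. C i j * f j)"
    using koszul_f[of "\<lambda>i. a i - b i" p] by auto
  define a' where "a' i = b i - (\<Sum>j<k. C i j * (g j - f j))" for i
  have "order_ge m (Suc p) (a' i)" if i: "i < k" for i
  proof -
    have "order_ge m (Suc p) (C i j * (g j - f j))" if "j < k" for j
      using koszul_order_ge[OF C(1) i that] close[OF that] by (rule order_ge_mult') (use c in simp)
    then have "order_ge m (Suc p) (\<Sum>j<k. C i j * (g j - f j))" by (intro order_ge_sum) auto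
    then show ?thesis unfolding a'_def using b(2)[OF i] by (rule order_ge_diff[rotated])
  qed
  moreover have "a' i \<in> conv m" if i: "i < k" for i
    unfolding a'_def using koszul_conv[OF C(1) i] b(1)[OF i] f g by (intro conv_closed) auto
  moreover have "a i = a' i + (\<Sum>j<k. C i j * g j)" if i: "i < k" for i
  proof -
    have "a i = b i + (\<Sum>j<k. C i j * f j)" using C(2) i by (simp add: algebra_simps)
    also have "\<dots> = a' i + (\<Sum>j<k. C i j * g j)"
      by (simp add: a'_def right_diff_distrib sum_subtractf)
    finally show ?thesis .
  qed
  moreover have "koszul m k 0 C" using C(1) by (rule koszul_weaken) simp
  ultimately show ?thesis by blast
qed

lemma improve_iterated:
  assumes "\<And>i. i < k \<Longrightarrow> a i \<in> conv m" and \<nu>: "order_ge m \<nu> (\<Sum>i<k. a i * g i)" and "p + c \<le> \<nu>"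
  shows "\<exists>a' C. (\<forall>i<k. a' i \<in> conv m \<and> order_ge m p (a' i)) \<and> koszul m k 0 C \<and>
    (\<forall>i<k. a i = a' i + (\<Sum>j<k. C i j * g j))"
  using assms(3)
proof (induction p)
  case 0
  show ?case
    by (rule exI[of _ a], rule exI[of _ "\<lambda>_ _. 0"]) (auto simp: assms(1) koszul_def conv_zero)
next
  case (Suc p)
  then obtain a' C where a': "\<And>i. i < k \<Longrightarrow> a' i \<in> conv m" "\<And>i. i < k \<Longrightarrow> order_ge m p (a' i)"
    "koszul m k 0 C" "\<And>i. i < k \<Longrightarrow> a i = a' i + (\<Sum>j<k. C i j * g j)" by auto
  have "(\<Sum>i<k. a i * g i) = (\<Sum>i<k. a' i * g i) + (\<Sum>i<k. (\<Sum>j<k. C i j * g j) * g i)"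
    using a'(4) by (simp add: distrib_right sum.distrib)
  then have h\<nu>: "order_ge m \<nu> (\<Sum>i<k. a' i * g i)" using \<nu> koszul_cancel[OF a'(3)] by simp
  have less: "p + c < \<nu>" using Suc.prems by simp
  obtain a'' D where a'': "\<And>i. i < k \<Longrightarrow> a'' i \<in> conv m" "\<And>i. i < k \<Longrightarrow> order_ge m (Suc p) (a'' i)"
    "koszul m k 0 D" "\<And>i. i < k \<Longrightarrow> a' i = a'' i + (\<Sum>j<k. D i j * g j)"
  proof -
    have "\<exists>a'' D. (\<forall>i<k. a'' i \<in> conv m \<and> order_ge m (Suc p) (a'' i)) \<and> koszul m k 0 D \<and>
        (\<forall>i<k. a' i = a'' i + (\<Sum>j<k. D i j * g j))"
      by (rule improve[OF _ _ h\<nu> less]) (use a'(1,2) in auto)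
    then show ?thesis using that by blast
  qed
  have "a i = a'' i + (\<Sum>j<k. (C i j + D i j) * g j)" if "i < k" for i
    using a'(4)[OF that] a''(4)[OF that] by (simp add: distrib_right sum.distrib)
  then show ?case using a''(1,2) koszul_add[OF a'(3) a''(3)]
    by (intro exI[of _ a''] exI[of _ "\<lambda>i j. C i j + D i j"]) auto
qed

lemma koszul_sum: "(\<And>i. i < k \<Longrightarrow> a i = a' i + (\<Sum>j<k. C i j * g j)) \<Longrightarrow> koszul m k p C \<Longrightarrow>
    (\<Sum>i<k. a i * g i) = (\<Sum>i<k. a' i * g i)"
  using koszul_cancel[of m k p C g] by (simp add: distrib_right sum.distrib)

text \<open>
  In both directions the coefficients can be chosen of order at least that of \<open>h\<close> minus \<open>c\<close>, for \<open>f\<close> by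
  Artin--Rees and for \<open>g\<close> by \<open>improve_iterated\<close>. Exchanging \<open>f\<close> and \<open>g\<close> then only changes terms of higher
  degree than the initial exponent.
\<close>

lemma initial_exponents_eq:
  "(\<exists>h\<in>ideal_gen m k g. is_initial m h \<beta>) \<longleftrightarrow> (\<exists>h\<in>ideal_gen m k f. is_initial m h \<beta>)"
proof
  assume "\<exists>h\<in>ideal_gen m k f. is_initial m h \<beta>"
  then obtain h where h: "h \<in> ideal_gen m k f" "is_initial m h \<beta>" by blast
  obtain b where b: "\<And>i. i < k \<Longrightarrow> b i \<in> conv m" "\<And>i. i < k \<Longrightarrow> order_ge m (deg m \<beta> - c) (b i)"
    "h = (\<Sum>i<k. b i * f i)"
    using artin_rees_f[OF h(1) is_initial_order_ge[OF h(2)]] by auto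
  have "order_ge m (Suc (deg m \<beta>)) ((\<Sum>i<k. b i * g i) - h)"
    using error_term[of "deg m \<beta> - c" b] b(2) c unfolding b(3) by (auto elim!: order_ge_mono)
  then have "is_initial m (\<Sum>i<k. b i * g i) \<beta>" using h(2) is_initial_perturb by blast
  then show "\<exists>h\<in>ideal_gen m k g. is_initial m h \<beta>" using ideal_genI[of k b m g] b(1) by blast
next
  assume "\<exists>h\<in>ideal_gen m k g. is_initial m h \<beta>"
  then obtain h where h: "h \<in> ideal_gen m k g" "is_initial m h \<beta>" by blast
  then obtain a where a: "\<And>i. i < k \<Longrightarrow> a i \<in> conv m" "h = (\<Sum>i<k. a i * g i)" by (elim ideal_genE) blast
  have "\<exists>a'. (\<forall>i<k. a' i \<in> conv m \<and> order_ge m (deg m \<beta> - c) (a' i)) \<and> h = (\<Sum>i<k. a' i * g i)"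
  proof (cases "c \<le> deg m \<beta>")
    case True
    have "order_ge m (deg m \<beta>) (\<Sum>i<k. a i * g i)" using is_initial_order_ge[OF h(2)] a(2) by simp
    then obtain a' C where a': "\<forall>i<k. a' i \<in> conv m \<and> order_ge m (deg m \<beta> - c) (a' i)" "koszul m k 0 C"
      "\<And>i. i < k \<Longrightarrow> a i = a' i + (\<Sum>j<k. C i j * g j)"
      using improve_iterated[of a "deg m \<beta>" "deg m \<beta> - c"] a(1) True by auto
    have "h = (\<Sum>i<k. a' i * g i)" unfolding a(2) by (rule koszul_sum[OF a'(3,2)])
    then show ?thesis using a'(1) by blast
  next
    case False
    then show ?thesis using a by (intro exI[of _ a]) auto
  qed
  then obtain a' where a': "\<And>i. i < k \<Longrightarrow> a' i \<in> conv m" "\<And>i. i < k \<Longrightarrow> order_ge m (deg m \<beta> - c) (a' i)"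
    "h = (\<Sum>i<k. a' i * g i)" by auto
  have "order_ge m (Suc (deg m \<beta>)) (h - (\<Sum>i<k. a' i * f i))"
    using error_term[of "deg m \<beta> - c" a'] a'(2) c unfolding a'(3) by (auto elim!: order_ge_mono)
  then have "order_ge m (Suc (deg m \<beta>)) ((\<Sum>i<k. a' i * f i) - h)"
    using order_ge_uminus[of m _ "h - (\<Sum>i<k. a' i * f i)"] by simp
  then have "is_initial m (\<Sum>i<k. a' i * f i) \<beta>" using h(2) is_initial_perturb by blast
  then show "\<exists>h\<in>ideal_gen m k f. is_initial m h \<beta>" using ideal_genI[of k a' m f] a'(1) by blast
qed

text \<open>
  A relation between the \<open>g\<^sub>j\<close> is a Koszul relation up to arbitrarily high order. As the diagonal of \<open>C\<close>
  vanishes, the last coefficient is congruent to an element of the ideal of the other \<open>g\<^sub>j\<close>.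
\<close>

lemma last_regular:
  assumes k: "k = Suc i" and b: "b \<in> conv m" "b * g i \<in> ideal_gen m i g"
  shows "b \<in> ideal_gen m i g"
proof (rule ideal_closed[OF _ b(1)])
  show "g j \<in> conv m" if "j < i" for j using g k that by auto
  fix p
  obtain u where u: "\<And>j. j < i \<Longrightarrow> u j \<in> conv m" "b * g i = (\<Sum>j<i. u j * g j)"
    using b(2) by (elim ideal_genE) blast
  define a where "a j = (if j < i then - u j else b)" for j
  have "(\<Sum>j<k. a j * g j) = 0" using u(2) by (simp add: k a_def sum_negf)
  then have "order_ge m (p + c) (\<Sum>j<k. a j * g j)" by simp
  then obtain a' C where a': "\<forall>j<k. a' j \<in> conv m \<and> order_ge m p (a' j)" "koszul m k 0 C"
    "\<forall>j<k. a j = a' j + (\<Sum>l<k. C j l * g l)"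
  proof -
    have "a j \<in> conv m" if "j < k" for j using u(1) b(1) by (simp add: a_def conv_uminus)
    then show ?thesis using improve_iterated[of a "p + c" p] \<open>order_ge m (p + c) _\<close> that by blast
  qed
  have "b = a' i + (\<Sum>l<i. C i l * g l)"
    using a'(3) koszul_diagonal[OF a'(2), of i] by (auto simp: k a_def)
  then have "b - (\<Sum>l<i. C i l * g l) = a' i" by simp
  moreover have "(\<Sum>l<i. C i l * g l) \<in> ideal_gen m i g"
    by (intro ideal_genI koszul_conv[OF a'(2)]) (auto simp: k)
  ultimately show "\<exists>u\<in>ideal_gen m i g. order_ge m p (b - u)" using a'(1) k by (metis lessI)
qed

end

text \<open>
  Regularity is proved for one element at a time, so the constants of all initial segments of the
  sequence are needed; \<open>\<mu>0\<close> is their sum.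
\<close>

theorem regular_perturbation:
  assumes reg: "regular m k f"
  shows "\<exists>\<mu>0. \<forall>g. (\<forall>i<k. g i \<in> conv m \<and> order_ge m (Suc \<mu>0) (g i - f i)) \<longrightarrow>
    regular m k g \<and>
    (\<forall>\<beta>. (\<exists>h\<in>ideal_gen m k g. is_initial m h \<beta>) \<longleftrightarrow> (\<exists>h\<in>ideal_gen m k f. is_initial m h \<beta>))"
proof -
  have "\<exists>c. \<forall>\<mu> g. c \<le> \<mu> \<longrightarrow> (\<forall>i<l. g i \<in> conv m) \<longrightarrow> (\<forall>i<l. order_ge m (Suc \<mu>) (g i - f i)) \<longrightarrow>
      perturbation m l f g c \<mu>" if l: "l \<le> k" for l
  proof -
    have f: "\<And>i. i < l \<Longrightarrow> f i \<in> conv m" using reg l by (auto simp: regular_def)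
    obtain c1 where c1: "\<And>p h. h \<in> ideal_gen m l f \<Longrightarrow> order_ge m p h \<Longrightarrow>
      \<exists>b. (\<forall>i<l. b i \<in> conv m \<and> order_ge m (p - c1) (b i)) \<and> h = (\<Sum>i<l. b i * f i)"
      by (rule artin_rees[of l f m]) (use f in auto)
    obtain c2 where c2: "\<And>p a. (\<forall>i<l. a i \<in> conv m \<and> order_ge m p (a i)) \<Longrightarrow> (\<Sum>i<l. a i * f i) = 0 \<Longrightarrow>
      (\<exists>C. koszul m l (p - c2) C \<and> (\<forall>i<l. a i = (\<Sum>j<l. C i j * f j)))"
      using koszul_syzygy[OF regular_prefix[OF reg l]] by auto
    define c where "c = max c1 c2"
    have ar: "\<exists>b. (\<forall>i<l. b i \<in> conv m \<and> order_ge m (p - c) (b i)) \<and> h = (\<Sum>i<l. b i * f i)"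
      if "h \<in> ideal_gen m l f" "order_ge m p h" for p h
    proof -
      have "p - c \<le> p - c1" by (simp add: c_def)
      then show ?thesis using c1[OF that] order_ge_mono by blast
    qed
    have kz: "\<exists>C. koszul m l (p - c) C \<and> (\<forall>i<l. a i = (\<Sum>j<l. C i j * f j))"
      if "\<forall>i<l. a i \<in> conv m \<and> order_ge m p (a i)" "(\<Sum>i<l. a i * f i) = 0" for p a
    proof -
      have "p - c \<le> p - c2" by (simp add: c_def)
      then show ?thesis using c2[OF that] koszul_weaken by blast
    qed
    show ?thesis by (intro exI[of _ c] allI impI perturbation.intro) (use f ar kz in auto)
  qed
  then obtain c where c: "\<And>l \<mu> g. l \<le> k \<Longrightarrow> c l \<le> \<mu> \<Longrightarrow> (\<forall>i<l. g i \<in> conv m) \<Longrightarrow>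
      (\<forall>i<l. order_ge m (Suc \<mu>) (g i - f i)) \<Longrightarrow> perturbation m l f g (c l) \<mu>"
    by metis
  define \<mu>0 where "\<mu>0 = (\<Sum>l\<le>k. c l)"
  have \<mu>0: "c l \<le> \<mu>0" if "l \<le> k" for l unfolding \<mu>0_def by (rule member_le_sum) (use that in auto)
  show ?thesis
  proof (intro exI[of _ \<mu>0] allI impI)
    fix g assume g: "\<forall>i<k. g i \<in> conv m \<and> order_ge m (Suc \<mu>0) (g i - f i)"
    have pert: "perturbation m l f g (c l) \<mu>0" if "l \<le> k" for l
      using c[OF that \<mu>0[OF that]] g that by auto
    have "regular m k g"
      unfolding regular_def
    proof (intro conjI allI impI ballI)
      fix i b assume "i < k" "b \<in> conv m" "b * g i \<in> ideal_gen m i g"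
      then show "b \<in> ideal_gen m i g"
        using perturbation.last_regular[OF pert[of "Suc i"]] by auto
    qed (use g in auto)
    then show "regular m k g \<and> (\<forall>\<beta>. (\<exists>h\<in>ideal_gen m k g. is_initial m h \<beta>) \<longleftrightarrow>
        (\<exists>h\<in>ideal_gen m k f. is_initial m h \<beta>))"
      using perturbation.initial_exponents_eq[OF pert[OF order_refl]] by blast
  qed
qed

section \<open>Linear substitutions\<close>

definition single :: "nat \<Rightarrow> nat \<Rightarrow> nat \<Rightarrow> nat" where
  "single i n = (\<lambda>l. if l = i then n else 0)"

definition var :: "nat \<Rightarrow> 'a::comm_ring_1 pseries" where
  "var i = xpow (single i 1)"

lemma single_exponents: "i < m \<Longrightarrow> single i n \<in> exponents m"
  by (auto simp: single_def exponents_def)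

lemma finsupp_single: "finsupp (single i n)"
  unfolding finsupp_def by (rule finite_subset[of _ "{i}"]) (auto simp: single_def)

lemma single_add: "single i (a + b) = single i a + single i b"
  by (auto simp: single_def)

lemma single_0: "single i 0 = 0"
  by (auto simp: single_def)

lemma single_inject: "single i a = single i b \<longleftrightarrow> a = b"
  by (metis single_def)

lemma deg_single: "i < m \<Longrightarrow> deg m (single i n) = n"
  by (simp add: deg_def single_def)

lemma xpow_zero: "xpow 0 = 1"
  by (rule pseries_eqI) (simp add: cf_xpow cf_one)

lemma xpow_add:
  assumes "finsupp \<alpha>" "finsupp \<beta>"
  shows "xpow (\<alpha> + \<beta>) = xpow \<alpha> * xpow \<beta>"
proof (rule pseries_eqI)
  fix \<gamma>
  have "\<alpha> \<le> \<gamma> \<and> \<gamma> - \<alpha> = \<beta> \<longleftrightarrow> \<gamma> = \<alpha> + \<beta>"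
    using exponent_diff_add[of \<alpha> \<gamma>] by (auto simp: le_fun_def add.commute)
  then show "cf (xpow (\<alpha> + \<beta>)) \<gamma> = cf (xpow \<alpha> * xpow \<beta>) \<gamma>"
    using assms finsupp_add[OF assms] by (auto simp: cf_xpow cf_xpow_times)
qed

lemma var_power: "var i ^ n = (xpow (single i n) :: 'a::comm_ring_1 pseries)"
proof (induction n)
  case (Suc n)
  have "xpow (single i (Suc n)) = (xpow (single i 1) * xpow (single i n) :: 'a pseries)"
    using xpow_add[OF finsupp_single finsupp_single] single_add[of i 1 n] by simp
  then show ?case using Suc by (simp add: var_def)
next
  case 0
  show ?case by (simp only: single_0 xpow_zero power_0)
qed

lemma var_conv: "i < m \<Longrightarrow> var i \<in> conv m"
  unfolding var_def by (intro conv_xpow single_exponents)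

lemma xpow_prod_var:
  assumes "\<beta> \<in> exponents m"
  shows "xpow \<beta> = (\<Prod>i<m. var i ^ \<beta> i)"
proof -
  have "xpow (\<lambda>l. if l < n then \<beta> l else 0) = (\<Prod>i<n. var i ^ \<beta> i)" for n
  proof (induction n)
    case 0
    have "(\<lambda>l. if l < 0 then \<beta> l else 0) = 0" by (rule ext) simp
    then show ?case by (simp only: xpow_zero lessThan_0 prod.empty)
  next
    case (Suc n)
    have "(\<lambda>l. if l < Suc n then \<beta> l else 0) = (\<lambda>l. if l < n then \<beta> l else 0) + single n (\<beta> n)"
      by (auto simp: single_def less_Suc_eq)
    moreover have "finsupp (\<lambda>l. if l < n then \<beta> l else 0)"
      unfolding finsupp_def by (rule finite_subset[of _ "{..<n}"]) auto
    ultimately show ?case using Suc by (simp add: xpow_add finsupp_single var_power)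
  qed
  from this[of m] have "xpow (\<lambda>l. if l < m then \<beta> l else 0) = (\<Prod>i<m. var i ^ \<beta> i)" .
  moreover have "(\<lambda>l. if l < m then \<beta> l else 0) = \<beta>" using assms by (auto simp: exponents_def)
  ultimately show ?thesis by simp
qed

definition homogeneous :: "nat \<Rightarrow> nat \<Rightarrow> 'a::comm_ring_1 pseries \<Rightarrow> bool" where
  "homogeneous m d F \<longleftrightarrow> (\<forall>\<beta>. cf F \<beta> \<noteq> 0 \<longrightarrow> deg m \<beta> = d)"

lemma homogeneous_one: "homogeneous m 0 1"
  by (auto simp: homogeneous_def cf_one)

lemma homogeneous_mult: "homogeneous m d F \<Longrightarrow> homogeneous m e G \<Longrightarrow> homogeneous m (d + e) (F * G)"
  unfolding homogeneous_def by (auto elim!: cf_times_nonzeroE simp: deg_add)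

lemma homogeneous_power: "homogeneous m d F \<Longrightarrow> homogeneous m (n * d) (F ^ n)"
  by (induction n) (auto intro: homogeneous_one homogeneous_mult)

lemma homogeneous_prod:
  "(\<And>i. i < (n::nat) \<Longrightarrow> homogeneous m (d i) (F i)) \<Longrightarrow> homogeneous m (\<Sum>i<n. d i) (\<Prod>i<n. F i)"
  by (induction n) (auto simp: add.commute mult.commute intro: homogeneous_one homogeneous_mult)

definition lin_form :: "nat \<Rightarrow> 'a mat \<Rightarrow> nat \<Rightarrow> 'a::{real_normed_field,banach} pseries" where
  "lin_form m A i = (\<Sum>j<m. const (A $$ (i, j)) * var j)"

definition lin_monom :: "nat \<Rightarrow> 'a mat \<Rightarrow> (nat \<Rightarrow> nat) \<Rightarrow> 'a::{real_normed_field,banach} pseries" where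
  "lin_monom m A \<beta> = (\<Prod>i<m. lin_form m A i ^ \<beta> i)"

text \<open>
  As in the definition of \<open>linear_change\<close>, only exponents of the degree of \<open>\<gamma>\<close> contribute.
\<close>

definition lin_subst :: "nat \<Rightarrow> 'a mat \<Rightarrow> 'a pseries \<Rightarrow> 'a::{real_normed_field,banach} pseries" where
  "lin_subst m A F = series (\<lambda>\<gamma>. \<Sum>\<beta> | \<beta> \<in> exponents m \<and> deg m \<beta> = deg m \<gamma>. cf F \<beta> * cf (lin_monom m A \<beta>) \<gamma>)"

lemma cf_lin_form: "cf (lin_form m A i) \<beta> = (\<Sum>j<m. if \<beta> = single j 1 then A $$ (i, j) else 0)"
  by (simp add: lin_form_def cf_const_times var_def cf_xpow finsupp_single if_distrib cong: if_cong)

lemma cf_lin_form_nonzeroE: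
  assumes "cf (lin_form m A i) \<beta> \<noteq> 0"
  obtains j where "j < m" "\<beta> = single j 1" "A $$ (i, j) \<noteq> 0"
proof -
  obtain j where "j \<in> {..<m}" "(if \<beta> = single j 1 then A $$ (i, j) else 0) \<noteq> 0"
    using assms unfolding cf_lin_form by (rule sum.not_neutral_contains_not_neutral)
  then show ?thesis using that[of j] by (auto split: if_splits)
qed

lemma lin_form_conv: "lin_form m A i \<in> conv m"
  unfolding lin_form_def by (intro conv_closed var_conv) auto

lemma lin_form_homogeneous: "homogeneous m 1 (lin_form m A i)"
  unfolding homogeneous_def
proof (intro allI impI)
  fix \<beta> assume "cf (lin_form m A i) \<beta> \<noteq> 0"
  then show "deg m \<beta> = 1" by (rule cf_lin_form_nonzeroE) (simp add: deg_single)
qed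

lemma lin_monom_conv: "lin_monom m A \<beta> \<in> conv m"
  unfolding lin_monom_def by (intro conv_closed lin_form_conv)

lemma lin_monom_homogeneous: "homogeneous m (deg m \<beta>) (lin_monom m A \<beta>)"
  unfolding lin_monom_def deg_def
  using homogeneous_prod[of m m \<beta> "\<lambda>i. lin_form m A i ^ \<beta> i"] homogeneous_power[OF lin_form_homogeneous] by auto

lemma lin_monom_add: "lin_monom m A (\<alpha> + \<beta>) = lin_monom m A \<alpha> * lin_monom m A \<beta>"
  by (simp add: lin_monom_def power_add prod.distrib)

lemma lin_monom_zero: "lin_monom m A 0 = 1"
  by (simp add: lin_monom_def)

lemma finite_deg_le: "finite {\<beta> \<in> exponents m. deg m \<beta> \<le> n}"
  using finite_wt_le[of m "\<lambda>_. 1" n] wt_one[of m] by simp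

text \<open>
  The degree of \<open>\<gamma>\<close> can be replaced by any larger bound, which makes the sum range over a set that
  does not depend on \<open>\<gamma>\<close>.
\<close>

lemma cf_lin_subst:
  assumes "deg m \<gamma> \<le> n"
  shows "cf (lin_subst m A F) \<gamma> = (\<Sum>\<beta> | \<beta> \<in> exponents m \<and> deg m \<beta> \<le> n. cf F \<beta> * cf (lin_monom m A \<beta>) \<gamma>)"
proof (cases "finsupp \<gamma>")
  case True
  have "(\<Sum>\<beta> | \<beta> \<in> exponents m \<and> deg m \<beta> \<le> n. cf F \<beta> * cf (lin_monom m A \<beta>) \<gamma>) =
      (\<Sum>\<beta> | \<beta> \<in> exponents m \<and> deg m \<beta> = deg m \<gamma>. cf F \<beta> * cf (lin_monom m A \<beta>) \<gamma>)"
    by (rule sum.mono_neutral_right)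
       (use finite_deg_le assms lin_monom_homogeneous in \<open>fastforce simp: homogeneous_def\<close>)+
  then show ?thesis using True by (simp add: lin_subst_def cf_series)
qed (simp add: cf_infinite)

lemma cf_lin_subst_nonzeroE:
  assumes "cf (lin_subst m A F) \<gamma> \<noteq> 0"
  obtains \<beta> where "cf F \<beta> \<noteq> 0" "cf (lin_monom m A \<beta>) \<gamma> \<noteq> 0"
proof -
  obtain \<beta> where "cf F \<beta> * cf (lin_monom m A \<beta>) \<gamma> \<noteq> 0"
    using assms unfolding cf_lin_subst[OF order_refl] by (rule sum.not_neutral_contains_not_neutral)
  then show ?thesis using that[of \<beta>] by auto
qed

lemma lin_subst_add: "lin_subst m A (F + G) = lin_subst m A F + lin_subst m A G"
  by (rule pseries_eqI) (simp add: cf_lin_subst[OF order_refl] distrib_right sum.distrib)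

lemma lin_subst_diff: "lin_subst m A (F - G) = lin_subst m A F - lin_subst m A G"
  by (rule pseries_eqI) (simp add: cf_lin_subst[OF order_refl] left_diff_distrib sum_subtractf)

lemma lin_subst_const_times: "lin_subst m A (const c * F) = const c * lin_subst m A F"
  by (rule pseries_eqI) (simp add: cf_lin_subst[OF order_refl] cf_const_times sum_distrib_left mult.assoc)

lemma lin_subst_zero: "lin_subst m A 0 = 0"
  using lin_subst_diff[of m A 0 0] by simp

lemma lin_subst_sum: "lin_subst m A (sum h S) = (\<Sum>x\<in>S. lin_subst m A (h x))"
  by (induction S rule: infinite_finite_induct) (auto simp: lin_subst_zero lin_subst_add)

lemma lin_subst_order_ge:
  assumes "order_ge m p F"
  shows "order_ge m p (lin_subst m A F)"
  unfolding order_ge_def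
proof (intro allI impI)
  fix \<gamma> assume "cf (lin_subst m A F) \<gamma> \<noteq> 0"
  then obtain \<beta> where "cf F \<beta> \<noteq> 0" "cf (lin_monom m A \<beta>) \<gamma> \<noteq> 0" by (rule cf_lin_subst_nonzeroE)
  then show "p \<le> deg m \<gamma>" using assms lin_monom_homogeneous[of m \<beta> A] by (auto simp: order_ge_def homogeneous_def)
qed

lemma lin_subst_xpow:
  assumes "\<alpha> \<in> exponents m"
  shows "lin_subst m A (xpow \<alpha>) = lin_monom m A \<alpha>"
proof (rule pseries_eqI)
  fix \<gamma>
  define n where "n = max (deg m \<alpha>) (deg m \<gamma>)"
  have "cf (lin_subst m A (xpow \<alpha>)) \<gamma> =
      (\<Sum>\<beta> | \<beta> \<in> exponents m \<and> deg m \<beta> \<le> n. if \<beta> = \<alpha> then cf (lin_monom m A \<beta>) \<gamma> else 0)"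
    using assms by (subst cf_lin_subst[of _ _ n])
      (auto simp: n_def cf_xpow exponents_finsupp intro!: sum.cong)
  also have "\<dots> = cf (lin_monom m A \<alpha>) \<gamma>"
    using assms finite_deg_le by (simp add: n_def)
  finally show "cf (lin_subst m A (xpow \<alpha>)) \<gamma> = cf (lin_monom m A \<alpha>) \<gamma>" .
qed

text \<open>
  Convergence: \<open>\<parallel>(Ax)\<^sup>\<beta>\<parallel>\<^sub>1 \<le> K\<^bsup>|\<beta>|\<^esup>\<close> for some \<open>K\<close>, so the substitution at most divides the radius by \<open>K\<close>.
\<close>

lemma norm_bound_radius_one_conv:
  fixes F :: "'a::{real_normed_field,banach} pseries"
  assumes "finite S" "\<And>\<beta>. cf F \<beta> \<noteq> 0 \<Longrightarrow> \<beta> \<in> S"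
  shows "norm_bound m (\<lambda>_. 1) 1 (\<Sum>\<beta>\<in>S. norm (cf F \<beta>)) F"
  unfolding norm_bound_def
proof
  fix n
  let ?T = "{\<beta> \<in> exponents m. wt m (\<lambda>_. 1) \<beta> \<le> n}"
  have "(\<Sum>\<beta>\<in>?T. norm (cf F \<beta>) * 1 ^ wt m (\<lambda>_. 1) \<beta>) = (\<Sum>\<beta>\<in>?T \<inter> S. norm (cf F \<beta>))"
    by (rule sum.mono_neutral_cong_right) (use assms finite_wt_le[of m "\<lambda>_. 1"] in auto)
  also have "\<dots> \<le> (\<Sum>\<beta>\<in>S. norm (cf F \<beta>))" by (rule sum_mono2) (use assms in auto)
  finally show "(\<Sum>\<beta>\<in>?T. norm (cf F \<beta>) * 1 ^ wt m (\<lambda>_. 1) \<beta>) \<le> (\<Sum>\<beta>\<in>S. norm (cf F \<beta>))" .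
qed

lemma norm_bound_one: "norm_bound m (\<lambda>_. 1) 1 1 (1 :: 'a::{real_normed_field,banach} pseries)"
proof -
  have "norm_bound m (\<lambda>_. 1) 1 (\<Sum>\<beta>\<in>{0}. norm (cf 1 \<beta> :: 'a)) (1 :: 'a pseries)"
    by (rule norm_bound_radius_one_conv) (auto simp: cf_one split: if_splits)
  then show ?thesis by (simp add: cf_one)
qed

lemma norm_bound_power:
  fixes F :: "'a::{real_normed_field,banach} pseries"
  assumes "norm_bound m (\<lambda>_. 1) 1 C F"
  shows "norm_bound m (\<lambda>_. 1) 1 (C ^ n) (F ^ n)"
proof (induction n)
  case (Suc n)
  show ?case unfolding power_Suc by (rule norm_bound_mult[OF assms Suc]) auto
qed (simp only: power_0 norm_bound_one)

lemma lin_monom_norm_bound: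
  obtains K where "0 < K" "\<And>\<beta>. norm_bound m (\<lambda>_. 1) 1 (K ^ deg m \<beta>) (lin_monom m A \<beta>)"
proof -
  define S :: "(nat \<Rightarrow> nat) set" where "S = (\<lambda>j. single j 1) ` {..<m}"
  define K where "K = 1 + (\<Sum>i<m. \<Sum>\<beta>\<in>S. norm (cf (lin_form m A i) \<beta>))"
  have K: "0 < K" unfolding K_def by (intro add_pos_nonneg sum_nonneg) auto
  have form: "norm_bound m (\<lambda>_. 1) 1 K (lin_form m A i)" if "i < m" for i
  proof (rule norm_bound_weaken)
    show "norm_bound m (\<lambda>_. 1) 1 (\<Sum>\<beta>\<in>S. norm (cf (lin_form m A i) \<beta>)) (lin_form m A i)"
    proof (rule norm_bound_radius_one_conv)
      fix \<beta> assume "cf (lin_form m A i) \<beta> \<noteq> 0"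
      then show "\<beta> \<in> S" by (rule cf_lin_form_nonzeroE) (simp add: S_def)
    qed (simp add: S_def)
    have "(\<Sum>\<beta>\<in>S. norm (cf (lin_form m A i) \<beta>)) \<le> (\<Sum>i<m. \<Sum>\<beta>\<in>S. norm (cf (lin_form m A i) \<beta>))"
      by (rule member_le_sum[of i "{..<m}" "\<lambda>i. \<Sum>\<beta>\<in>S. norm (cf (lin_form m A i) \<beta>)"])
         (use that in \<open>auto intro: sum_nonneg\<close>)
    then show "(\<Sum>\<beta>\<in>S. norm (cf (lin_form m A i) \<beta>)) \<le> K" by (simp add: K_def)
  qed
  have "norm_bound m (\<lambda>_. 1) 1 (K ^ (\<Sum>i<n. \<beta> i)) (\<Prod>i<n. lin_form m A i ^ \<beta> i)" if "n \<le> m" for \<beta> n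
    using that
  proof (induction n)
    case (Suc n)
    then have "norm_bound m (\<lambda>_. 1) 1 (K ^ (\<Sum>i<n. \<beta> i)) (\<Prod>i<n. lin_form m A i ^ \<beta> i)"
      "norm_bound m (\<lambda>_. 1) 1 K (lin_form m A n)" using form by auto
    then have "norm_bound m (\<lambda>_. 1) 1 (K ^ (\<Sum>i<n. \<beta> i) * K ^ \<beta> n) ((\<Prod>i<n. lin_form m A i ^ \<beta> i) * lin_form m A n ^ \<beta> n)"
      by (intro norm_bound_mult norm_bound_power) auto
    then show ?case by (simp add: power_add)
  qed (simp only: lessThan_0 sum.empty prod.empty power_0 norm_bound_one)
  from this[of m] have "norm_bound m (\<lambda>_. 1) 1 (K ^ deg m \<beta>) (lin_monom m A \<beta>)" for \<beta>
    unfolding lin_monom_def deg_def by simp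
  then show ?thesis using that[of K] K by blast
qed

lemma lin_subst_conv:
  assumes F: "F \<in> conv m"
  shows "lin_subst m A F \<in> conv m"
proof -
  obtain K where K: "0 < K" "\<And>\<beta>. norm_bound m (\<lambda>_. 1) 1 (K ^ deg m \<beta>) (lin_monom m A \<beta>)"
    using lin_monom_norm_bound by metis
  obtain r C where r: "0 < r" "norm_bound m (\<lambda>_. 1) r C F" using F by (auto simp: conv_iff_deg)
  have "norm_bound m (\<lambda>_. 1) (r / K) C (lin_subst m A F)"
    unfolding norm_bound_def
  proof
    fix n
    let ?S = "{\<beta> \<in> exponents m. wt m (\<lambda>_. 1) \<beta> \<le> n}"
    have S: "?S = {\<beta> \<in> exponents m. deg m \<beta> \<le> n}" using wt_one[of m] by simp
    have fin: "finite ?S" using finite_deg_le S by simp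
    have "(\<Sum>\<gamma>\<in>?S. norm (cf (lin_subst m A F) \<gamma>) * (r / K) ^ wt m (\<lambda>_. 1) \<gamma>) \<le>
        (\<Sum>\<gamma>\<in>?S. \<Sum>\<beta>\<in>?S. norm (cf F \<beta>) * (r / K) ^ deg m \<beta> * norm (cf (lin_monom m A \<beta>) \<gamma>))"
    proof (rule sum_mono)
      fix \<gamma> assume "\<gamma> \<in> ?S"
      then have \<gamma>: "deg m \<gamma> \<le> n" using S by auto
      have "norm (cf (lin_subst m A F) \<gamma>) * (r / K) ^ deg m \<gamma> \<le>
          (\<Sum>\<beta>\<in>?S. norm (cf F \<beta> * cf (lin_monom m A \<beta>) \<gamma>)) * (r / K) ^ deg m \<gamma>"
        unfolding cf_lin_subst[OF \<gamma>] S by (intro mult_right_mono norm_sum) (use r K in auto)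
      also have "\<dots> = (\<Sum>\<beta>\<in>?S. norm (cf F \<beta>) * (r / K) ^ deg m \<beta> * norm (cf (lin_monom m A \<beta>) \<gamma>))"
        unfolding sum_distrib_right
      proof (rule sum.cong[OF refl])
        fix \<beta>
        have "cf (lin_monom m A \<beta>) \<gamma> \<noteq> 0 \<Longrightarrow> deg m \<gamma> = deg m \<beta>"
          using lin_monom_homogeneous[of m \<beta> A] by (auto simp: homogeneous_def)
        then show "norm (cf F \<beta> * cf (lin_monom m A \<beta>) \<gamma>) * (r / K) ^ deg m \<gamma> =
            norm (cf F \<beta>) * (r / K) ^ deg m \<beta> * norm (cf (lin_monom m A \<beta>) \<gamma>)"
          by (cases "cf (lin_monom m A \<beta>) \<gamma> = 0") (auto simp: norm_mult)
      qed
      finally show "norm (cf (lin_subst m A F) \<gamma>) * (r / K) ^ wt m (\<lambda>_. 1) \<gamma> \<le>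
          (\<Sum>\<beta>\<in>?S. norm (cf F \<beta>) * (r / K) ^ deg m \<beta> * norm (cf (lin_monom m A \<beta>) \<gamma>))"
        by (simp only: wt_one)
    qed
    also have "\<dots> = (\<Sum>\<beta>\<in>?S. norm (cf F \<beta>) * (r / K) ^ deg m \<beta> * (\<Sum>\<gamma>\<in>?S. norm (cf (lin_monom m A \<beta>) \<gamma>)))"
      by (subst sum.swap) (simp add: sum_distrib_left)
    also have "\<dots> \<le> (\<Sum>\<beta>\<in>?S. norm (cf F \<beta>) * r ^ deg m \<beta>)"
    proof (rule sum_mono)
      fix \<beta>
      have "(\<Sum>\<gamma>\<in>?S. norm (cf (lin_monom m A \<beta>) \<gamma>)) \<le> K ^ deg m \<beta>"
        using K(2)[of \<beta>] by (simp add: norm_bound_def)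
      then have "norm (cf F \<beta>) * (r / K) ^ deg m \<beta> * (\<Sum>\<gamma>\<in>?S. norm (cf (lin_monom m A \<beta>) \<gamma>)) \<le>
          norm (cf F \<beta>) * (r / K) ^ deg m \<beta> * K ^ deg m \<beta>"
        using r K by (intro mult_left_mono) auto
      also have "\<dots> = norm (cf F \<beta>) * r ^ deg m \<beta>" using K by (simp add: power_divide)
      finally show "norm (cf F \<beta>) * (r / K) ^ deg m \<beta> * (\<Sum>\<gamma>\<in>?S. norm (cf (lin_monom m A \<beta>) \<gamma>)) \<le>
          norm (cf F \<beta>) * r ^ deg m \<beta>" .
    qed
    also have "\<dots> \<le> C" using r(2) unfolding norm_bound_def by (simp only: wt_one)
    finally show "(\<Sum>\<gamma>\<in>?S. norm (cf (lin_subst m A F) \<gamma>) * (r / K) ^ wt m (\<lambda>_. 1) \<gamma>) \<le> C" .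
  qed
  moreover have "supp_in m (lin_subst m A F)"
    unfolding supp_in_def
  proof (intro allI impI)
    fix \<gamma> assume "cf (lin_subst m A F) \<gamma> \<noteq> 0"
    then obtain \<beta> where "cf F \<beta> \<noteq> 0" "cf (lin_monom m A \<beta>) \<gamma> \<noteq> 0" by (rule cf_lin_subst_nonzeroE)
    then show "\<gamma> \<in> exponents m" using conv_suppD[OF lin_monom_conv] by fastforce
  qed
  moreover have "0 < r / K" using r K by simp
  ultimately show ?thesis unfolding conv_iff_norm_bound[of m "\<lambda>_. 1", simplified]
    by (intro conjI exI[of _ "r / K"] exI[of _ C]) auto
qed

text \<open>
  Identities between substitutions only have to be checked on monomials: every series agrees with
  a polynomial up to terms of arbitrarily high order.
\<close>

definition trunc :: "nat \<Rightarrow> nat \<Rightarrow> 'a::comm_ring_1 pseries \<Rightarrow> 'a pseries" where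
  "trunc m n F = (\<Sum>\<beta> | \<beta> \<in> exponents m \<and> deg m \<beta> < n. const (cf F \<beta>) * xpow \<beta>)"

lemma cf_trunc: "cf (trunc m n F) \<beta> = (if \<beta> \<in> exponents m \<and> deg m \<beta> < n then cf F \<beta> else 0)"
proof -
  have fin: "finite {\<beta> \<in> exponents m. deg m \<beta> < n}"
    by (rule finite_subset[OF _ finite_deg_le[of m n]]) auto
  have "cf (trunc m n F) \<beta> = (\<Sum>\<gamma> | \<gamma> \<in> exponents m \<and> deg m \<gamma> < n. if \<gamma> = \<beta> then cf F \<gamma> else 0)"
    unfolding trunc_def cf_sum
    by (rule sum.cong) (auto simp: cf_const_times cf_xpow exponents_finsupp)
  then show ?thesis using fin by simp
qed

lemma trunc_approx: "F \<in> conv m \<Longrightarrow> order_ge m n (F - trunc m n F)"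
  using conv_suppD[of F m] by (auto simp: order_ge_def cf_trunc split: if_splits)

lemma order_ge_all_zero: "(\<And>n. order_ge m n F) \<Longrightarrow> F = 0"
  by (rule pseries_eqI) (metis cf_zero not_less_eq_eq order_refl order_ge_def)

lemma lin_subst_mult:
  assumes F: "F \<in> conv m" and G: "G \<in> conv m"
  shows "lin_subst m A (F * G) = lin_subst m A F * lin_subst m A G"
proof -
  have mono: "lin_subst m A (xpow \<alpha> * xpow \<beta>) = lin_monom m A \<alpha> * lin_monom m A \<beta>"
    if "\<alpha> \<in> exponents m" "\<beta> \<in> exponents m" for \<alpha> \<beta>
    using that by (simp add: xpow_add[symmetric] exponents_finsupp lin_subst_xpow exponents_add lin_monom_add)
  have poly: "lin_subst m A (trunc m n F * trunc m n G) = lin_subst m A (trunc m n F) * lin_subst m A (trunc m n G)" for n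
  proof -
    let ?S = "{\<beta> \<in> exponents m. deg m \<beta> < n}"
    have "trunc m n F * trunc m n G =
        (\<Sum>\<alpha>\<in>?S. \<Sum>\<beta>\<in>?S. const (cf F \<alpha>) * (const (cf G \<beta>) * (xpow \<alpha> * xpow \<beta>)))"
      by (simp add: trunc_def sum_product mult_ac)
    then have "lin_subst m A (trunc m n F * trunc m n G) =
        (\<Sum>\<alpha>\<in>?S. \<Sum>\<beta>\<in>?S. const (cf F \<alpha>) * (const (cf G \<beta>) * (lin_monom m A \<alpha> * lin_monom m A \<beta>)))"
      by (simp add: lin_subst_sum lin_subst_const_times mono)
    also have "\<dots> = (\<Sum>\<alpha>\<in>?S. const (cf F \<alpha>) * lin_monom m A \<alpha>) * (\<Sum>\<beta>\<in>?S. const (cf G \<beta>) * lin_monom m A \<beta>)"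
      by (simp add: sum_product mult_ac)
    also have "\<dots> = lin_subst m A (trunc m n F) * lin_subst m A (trunc m n G)"
      by (simp add: trunc_def lin_subst_sum lin_subst_const_times lin_subst_xpow)
    finally show ?thesis .
  qed
  have "order_ge m n (lin_subst m A (F * G) - lin_subst m A F * lin_subst m A G)" for n
  proof -
    let ?F = "trunc m n F" and ?G = "trunc m n G"
    have "lin_subst m A (F * G) - lin_subst m A F * lin_subst m A G =
        lin_subst m A ((F - ?F) * G + ?F * (G - ?G)) - (lin_subst m A (F - ?F) * lin_subst m A G + lin_subst m A ?F * lin_subst m A (G - ?G))"
      using poly[of n] by (simp add: lin_subst_add[symmetric] lin_subst_diff algebra_simps)
    moreover have "order_ge m n ((F - ?F) * G + ?F * (G - ?G))"
      using trunc_approx[OF F, of n] trunc_approx[OF G, of n]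
      by (intro order_ge_add) (auto intro: order_ge_mult'[of m n _ 0] order_ge_mult'[of m 0 _ n])
    moreover have "order_ge m n (lin_subst m A (F - ?F) * lin_subst m A G + lin_subst m A ?F * lin_subst m A (G - ?G))"
      using lin_subst_order_ge[OF trunc_approx[OF F, of n]] lin_subst_order_ge[OF trunc_approx[OF G, of n]]
      by (intro order_ge_add) (auto intro: order_ge_mult'[of m n _ 0] order_ge_mult'[of m 0 _ n])
    ultimately show ?thesis using lin_subst_order_ge order_ge_diff by metis
  qed
  then have "lin_subst m A (F * G) - lin_subst m A F * lin_subst m A G = 0" by (rule order_ge_all_zero)
  then show ?thesis by simp
qed

lemma lin_subst_const: "lin_subst m A (const c) = const c"
proof -
  have "lin_subst m A (const c * xpow 0) = const c * lin_monom m A 0"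
    by (simp add: lin_subst_const_times lin_subst_xpow exponents_zero)
  then show ?thesis by (simp add: xpow_zero lin_monom_zero)
qed

lemma lin_subst_one: "lin_subst m A 1 = 1"
  using lin_subst_const[of m A 1] by (simp add: const_one)

lemma lin_subst_power: "F \<in> conv m \<Longrightarrow> lin_subst m A (F ^ n) = lin_subst m A F ^ n"
  by (induction n) (auto simp: lin_subst_one lin_subst_mult conv_power)

lemma lin_subst_prod: "(\<And>x. x \<in> S \<Longrightarrow> F x \<in> conv m) \<Longrightarrow> lin_subst m A (prod F S) = (\<Prod>x\<in>S. lin_subst m A (F x))"
  by (induction S rule: infinite_finite_induct) (auto simp: lin_subst_one lin_subst_mult conv_prod)

lemma lin_subst_var:
  assumes "i < m"
  shows "lin_subst m A (var i) = lin_form m A i"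
proof -
  have "lin_subst m A (var i) = (\<Prod>j<m. lin_form m A j ^ single i 1 j)"
    using assms by (simp add: var_def lin_subst_xpow single_exponents lin_monom_def)
  also have "\<dots> = (\<Prod>j<m. if j = i then lin_form m A i else 1)"
    by (rule prod.cong) (auto simp: single_def)
  also have "\<dots> = lin_form m A i" using assms by simp
  finally show ?thesis .
qed

lemma lin_subst_lin_subst:
  assumes A: "A \<in> carrier_mat m m" and B: "B \<in> carrier_mat m m" and F: "F \<in> conv m"
  shows "lin_subst m B (lin_subst m A F) = lin_subst m (A * B) F"
proof -
  have lin: "lin_subst m B (lin_form m A i) = lin_form m (A * B) i" if "i < m" for i
  proof -
    have "lin_subst m B (lin_form m A i) = (\<Sum>j<m. const (A $$ (i, j)) * lin_form m B j)"
      by (simp add: lin_form_def[of m A] lin_subst_sum lin_subst_const_times lin_subst_var)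
    also have "\<dots> = (\<Sum>l<m. (\<Sum>j<m. const (A $$ (i, j)) * const (B $$ (j, l))) * var l)"
      by (simp add: lin_form_def sum_distrib_left sum_distrib_right mult.assoc) (rule sum.swap)
    also have "\<dots> = lin_form m (A * B) i"
      unfolding lin_form_def
    proof (rule sum.cong[OF refl], rule arg_cong2[where f = "(*)"])
      fix l assume "l \<in> {..<m}"
      then have "(A * B) $$ (i, l) = (\<Sum>j<m. A $$ (i, j) * B $$ (j, l))"
        using that A B by (simp add: scalar_prod_def lessThan_atLeast0)
      then show "(\<Sum>j<m. const (A $$ (i, j)) * const (B $$ (j, l))) = const ((A * B) $$ (i, l))"
        by (intro pseries_eqI) (simp add: cf_const_times cf_const)
    qed simp
    finally show ?thesis .
  qed
  have mono: "lin_subst m B (lin_monom m A \<beta>) = lin_monom m (A * B) \<beta>" for \<beta>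
    unfolding lin_monom_def by (simp add: lin_subst_prod lin_subst_power conv_power lin_form_conv lin)
  have poly: "lin_subst m B (lin_subst m A (trunc m n F)) = lin_subst m (A * B) (trunc m n F)" for n
    unfolding trunc_def lin_subst_sum lin_subst_const_times by (rule sum.cong) (auto simp: lin_subst_xpow mono)
  have "order_ge m n (lin_subst m B (lin_subst m A F) - lin_subst m (A * B) F)" for n
  proof -
    have "lin_subst m B (lin_subst m A F) - lin_subst m (A * B) F =
        lin_subst m B (lin_subst m A (F - trunc m n F)) - lin_subst m (A * B) (F - trunc m n F)"
      by (simp add: lin_subst_diff poly)
    then show ?thesis using lin_subst_order_ge trunc_approx[OF F] order_ge_diff by metis
  qed
  then have "lin_subst m B (lin_subst m A F) - lin_subst m (A * B) F = 0" by (rule order_ge_all_zero)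
  then show ?thesis by simp
qed

lemma lin_subst_id:
  assumes F: "F \<in> conv m"
  shows "lin_subst m (1\<^sub>m m) F = F"
proof -
  have lin: "lin_form m (1\<^sub>m m) i = var i" if "i < m" for i
  proof -
    have "lin_form m (1\<^sub>m m) i = (\<Sum>j<m. if j = i then var j else 0)"
      unfolding lin_form_def by (rule sum.cong) (use that in \<open>auto simp: const_one const_zero\<close>)
    then show ?thesis using that by simp
  qed
  have mono: "lin_monom m (1\<^sub>m m) \<beta> = xpow \<beta>" if "\<beta> \<in> exponents m" for \<beta>
    using that by (simp add: lin_monom_def xpow_prod_var lin)
  have "order_ge m n (lin_subst m (1\<^sub>m m) F - F)" for n
  proof -
    have "lin_subst m (1\<^sub>m m) (trunc m n F) = trunc m n F"
      unfolding trunc_def lin_subst_sum lin_subst_const_times by (rule sum.cong) (auto simp: lin_subst_xpow mono)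
    then have "lin_subst m (1\<^sub>m m) F - F = lin_subst m (1\<^sub>m m) (F - trunc m n F) - (F - trunc m n F)"
      by (simp add: lin_subst_diff)
    then show ?thesis using lin_subst_order_ge trunc_approx[OF F] order_ge_diff by metis
  qed
  then have "lin_subst m (1\<^sub>m m) F - F = 0" by (rule order_ge_all_zero)
  then show ?thesis by simp
qed

lemma general_linear_inverse:
  assumes "A \<in> general_linear m"
  obtains B where "B \<in> carrier_mat m m" "A * B = 1\<^sub>m m" "B * A = 1\<^sub>m m"
proof -
  have A: "A \<in> carrier_mat m m" "invertible_mat A" using assms by (auto simp: general_linear_def)
  then obtain B where B: "A * B = 1\<^sub>m (dim_row A)" "B * A = 1\<^sub>m (dim_row B)"
    by (auto simp: invertible_mat_def inverts_mat_def)
  have "dim_col B = m" using arg_cong[OF B(1), of dim_col] A by simp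
  moreover have "dim_row B = m" using arg_cong[OF B(2), of dim_col] A by simp
  ultimately show ?thesis using that[of B] A B by auto
qed

lemma lin_subst_inverse:
  assumes "A \<in> general_linear m"
  obtains B where "\<And>F. F \<in> conv m \<Longrightarrow> lin_subst m B (lin_subst m A F) = F" "\<And>F. F \<in> conv m \<Longrightarrow> lin_subst m A (lin_subst m B F) = F"
proof -
  obtain B where B: "B \<in> carrier_mat m m" "A * B = 1\<^sub>m m" "B * A = 1\<^sub>m m"
    using general_linear_inverse[OF assms] by blast
  have "A \<in> carrier_mat m m" using assms by (simp add: general_linear_def)
  then show ?thesis using that[of B] lin_subst_lin_subst lin_subst_id B by metis
qed

lemma lin_subst_ideal_gen:
  assumes A: "A \<in> general_linear m" and f: "\<And>i. i < k \<Longrightarrow> f i \<in> conv m"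
  shows "lin_subst m A ` ideal_gen m k f = ideal_gen m k (\<lambda>i. lin_subst m A (f i))"
proof (intro equalityI subsetI)
  fix h assume "h \<in> lin_subst m A ` ideal_gen m k f"
  then obtain a where "\<And>i. i < k \<Longrightarrow> a i \<in> conv m" "h = lin_subst m A (\<Sum>i<k. a i * f i)"
    by (elim imageE ideal_genE) blast
  then have "h = (\<Sum>i<k. lin_subst m A (a i) * lin_subst m A (f i))" "\<And>i. i < k \<Longrightarrow> lin_subst m A (a i) \<in> conv m"
    using f by (simp_all add: lin_subst_sum lin_subst_mult lin_subst_conv)
  then show "h \<in> ideal_gen m k (\<lambda>i. lin_subst m A (f i))" by (simp only:) (rule ideal_genI)
next
  fix h assume "h \<in> ideal_gen m k (\<lambda>i. lin_subst m A (f i))"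
  then obtain a where a: "\<And>i. i < k \<Longrightarrow> a i \<in> conv m" "h = (\<Sum>i<k. a i * lin_subst m A (f i))"
    by (elim ideal_genE) blast
  obtain B where B: "\<And>F. F \<in> conv m \<Longrightarrow> lin_subst m A (lin_subst m B F) = F" using lin_subst_inverse[OF A] by metis
  have "h = lin_subst m A (\<Sum>i<k. lin_subst m B (a i) * f i)"
    using a f by (simp add: lin_subst_sum lin_subst_mult lin_subst_conv B)
  moreover have "(\<Sum>i<k. lin_subst m B (a i) * f i) \<in> ideal_gen m k f" using a by (intro ideal_genI lin_subst_conv)
  ultimately show "h \<in> lin_subst m A ` ideal_gen m k f" by blast
qed

lemma lin_subst_regular:
  assumes A: "A \<in> general_linear m" and f: "regular m k f"
  shows "regular m k (\<lambda>i. lin_subst m A (f i))"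
  unfolding regular_def
proof (intro conjI allI impI ballI)
  note fc = regular_conv[OF f]
  show "lin_subst m A (f i) \<in> conv m" if "i < k" for i using fc[OF that] by (rule lin_subst_conv)
  fix i b assume i: "i < k" and b: "b \<in> conv m" "b * lin_subst m A (f i) \<in> ideal_gen m i (\<lambda>i. lin_subst m A (f i))"
  obtain B where B: "\<And>F. F \<in> conv m \<Longrightarrow> lin_subst m B (lin_subst m A F) = F" "\<And>F. F \<in> conv m \<Longrightarrow> lin_subst m A (lin_subst m B F) = F"
    using lin_subst_inverse[OF A] by metis
  have img: "lin_subst m A ` ideal_gen m i f = ideal_gen m i (\<lambda>i. lin_subst m A (f i))"
    by (rule lin_subst_ideal_gen[OF A]) (use fc i in auto)
  have sub: "ideal_gen m i f \<subseteq> conv m" by (rule ideal_gen_conv) (use fc i in auto)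
  obtain u where u: "u \<in> ideal_gen m i f" "b * lin_subst m A (f i) = lin_subst m A u" using b(2) img by blast
  have "lin_subst m B b * f i = lin_subst m B (b * lin_subst m A (f i))"
    using b(1) fc[OF i] by (simp add: lin_subst_mult lin_subst_conv B)
  also have "\<dots> = u" using u sub B by auto
  finally have "lin_subst m B b \<in> ideal_gen m i f"
    using f i u(1) lin_subst_conv[OF b(1)] unfolding regular_def by metis
  then have "lin_subst m A (lin_subst m B b) \<in> lin_subst m A ` ideal_gen m i f" by blast
  then show "b \<in> ideal_gen m i (\<lambda>i. lin_subst m A (f i))" using B(2)[OF b(1)] img by simp
qed

section \<open>Local Noether normalization\<close>

text \<open>
  The series in the variables \<open>x\<^sub>i, x\<^bsub>i+1\<^esub>, \<dots>\<close> and the ideal generated by these variables. The ideal is described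
  by its support, which makes it manageable without choosing coefficients.
\<close>

definition tail_ring :: "nat \<Rightarrow> nat \<Rightarrow> 'a::{real_normed_field,banach} pseries set" where
  "tail_ring m i = {F \<in> conv m. \<forall>\<beta>. cf F \<beta> \<noteq> 0 \<longrightarrow> (\<forall>l<i. \<beta> l = 0)}"

definition tail_ideal :: "nat \<Rightarrow> nat \<Rightarrow> 'a::{real_normed_field,banach} pseries set" where
  "tail_ideal m i = {F \<in> conv m. \<forall>\<beta>. cf F \<beta> \<noteq> 0 \<longrightarrow> (\<exists>j\<ge>i. \<beta> j \<noteq> 0)}"

lemma tail_ringD: "F \<in> tail_ring m i \<Longrightarrow> F \<in> conv m"
  "F \<in> tail_ring m i \<Longrightarrow> cf F \<beta> \<noteq> 0 \<Longrightarrow> l < i \<Longrightarrow> \<beta> l = 0"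
  by (auto simp: tail_ring_def)

lemma tail_idealD: "F \<in> tail_ideal m i \<Longrightarrow> F \<in> conv m"
  "F \<in> tail_ideal m i \<Longrightarrow> cf F \<beta> \<noteq> 0 \<Longrightarrow> \<exists>j\<ge>i. \<beta> j \<noteq> 0"
  by (auto simp: tail_ideal_def)

lemma tail_ring_const: "const c \<in> tail_ring m i"
  by (auto simp: tail_ring_def conv_const cf_const)

lemma tail_ring_zero: "0 \<in> tail_ring m i" and tail_ring_one: "1 \<in> tail_ring m i"
  using tail_ring_const[of 0] tail_ring_const[of 1] by (simp_all add: const_zero const_one)

lemma tail_ring_add:
  assumes "F \<in> tail_ring m i" "G \<in> tail_ring m i"
  shows "F + G \<in> tail_ring m i"
proof -
  have "\<beta> l = 0" if "cf (F + G) \<beta> \<noteq> 0" "l < i" for \<beta> l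
    using that assms tail_ringD(2)[of F m i \<beta> l] tail_ringD(2)[of G m i \<beta> l] by (cases "cf F \<beta> = 0") auto
  then show ?thesis using assms by (auto simp: tail_ring_def intro: conv_add)
qed

lemma tail_ring_mult:
  assumes "F \<in> tail_ring m i" "G \<in> tail_ring m i"
  shows "F * G \<in> tail_ring m i"
proof -
  have "\<beta> l = 0" if nz: "cf (F * G) \<beta> \<noteq> 0" and l: "l < i" for \<beta> l
  proof -
    obtain \<gamma> \<delta> where "\<gamma> + \<delta> = \<beta>" "cf F \<gamma> \<noteq> 0" "cf G \<delta> \<noteq> 0" using nz by (rule cf_times_nonzeroE)
    then show ?thesis using assms l tail_ringD(2)[of F m i \<gamma> l] tail_ringD(2)[of G m i \<delta> l] by auto
  qed
  then show ?thesis using assms by (auto simp: tail_ring_def intro: conv_mult)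
qed

lemma tail_ring_uminus: "F \<in> tail_ring m i \<Longrightarrow> - F \<in> tail_ring m i"
  by (auto simp: tail_ring_def conv_uminus)

lemma tail_ring_sum: "(\<And>x. x \<in> S \<Longrightarrow> h x \<in> tail_ring m i) \<Longrightarrow> sum h S \<in> tail_ring m i"
  by (induction S rule: infinite_finite_induct) (auto intro: tail_ring_zero tail_ring_add)

lemma tail_ring_prod: "(\<And>x. x \<in> S \<Longrightarrow> h x \<in> tail_ring m i) \<Longrightarrow> prod h S \<in> tail_ring m i"
  by (induction S rule: infinite_finite_induct) (auto intro: tail_ring_one tail_ring_mult)

lemma tail_ring_power: "F \<in> tail_ring m i \<Longrightarrow> F ^ n \<in> tail_ring m i"
  by (induction n) (auto intro: tail_ring_one tail_ring_mult)

lemma tail_ideal_add: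
  assumes "F \<in> tail_ideal m i" "G \<in> tail_ideal m i"
  shows "F + G \<in> tail_ideal m i"
proof -
  have "\<exists>j\<ge>i. \<beta> j \<noteq> 0" if "cf (F + G) \<beta> \<noteq> 0" for \<beta>
    using that assms tail_idealD(2)[of F m i \<beta>] tail_idealD(2)[of G m i \<beta>] by (cases "cf F \<beta> = 0") auto
  then show ?thesis using assms by (auto simp: tail_ideal_def intro: conv_add)
qed

lemma tail_ideal_mult:
  assumes "F \<in> conv m" "G \<in> tail_ideal m i"
  shows "F * G \<in> tail_ideal m i"
proof -
  have "\<exists>j\<ge>i. \<beta> j \<noteq> 0" if nz: "cf (F * G) \<beta> \<noteq> 0" for \<beta>
  proof -
    obtain \<gamma> \<delta> where "\<gamma> + \<delta> = \<beta>" "cf F \<gamma> \<noteq> 0" "cf G \<delta> \<noteq> 0" using nz by (rule cf_times_nonzeroE)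
    moreover from this obtain j where "j \<ge> i" "\<delta> j \<noteq> 0" using tail_idealD(2)[OF assms(2)] by blast
    ultimately show ?thesis by (intro exI[of _ j]) auto
  qed
  then show ?thesis using assms by (auto simp: tail_ideal_def intro: conv_mult)
qed

lemma tail_ideal_uminus: "F \<in> tail_ideal m i \<Longrightarrow> - F \<in> tail_ideal m i"
  by (auto simp: tail_ideal_def conv_uminus)

lemma exponents_less: "\<beta> \<in> exponents m \<Longrightarrow> \<beta> j \<noteq> 0 \<Longrightarrow> j < m"
  by (rule ccontr) (simp add: exponents_def)

text \<open>
  Each \<open>u\<close> is \<open>x\<^sub>l\<^sup>d\<close> up to terms that contain a variable \<open>x\<^sub>j\<close> with \<open>j \<ge> i\<close>. Giving these variables a weight larger
  than all the \<open>d\<close> makes \<open>x\<^sub>l\<^sup>d\<close> the term of least weight. The remainder of a division by the \<open>u\<close> only contains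
  \<open>x\<^sub>l\<close> to powers below \<open>d\<close>, so it is a combination of finitely many monomials over the tail ring.
\<close>

lemma finite_over_tail:
  fixes f :: "nat \<Rightarrow> 'a::{real_normed_field,banach} pseries"
  assumes f: "\<And>j. j < k \<Longrightarrow> f j \<in> conv m" and im: "i \<le> m"
    and pos: "\<forall>l<i. \<exists>d>0. \<exists>u\<in>ideal_gen m k f. var l ^ d - u \<in> tail_ideal m i"
  shows "\<exists>D. finite D \<and> D \<subseteq> exponents m \<and>
    (\<forall>h\<in>conv m. \<exists>r. (\<forall>\<delta>\<in>D. r \<delta> \<in> tail_ring m i) \<and> h - (\<Sum>\<delta>\<in>D. r \<delta> * xpow \<delta>) \<in> ideal_gen m k f)"
proof -
  obtain d u where du: "\<And>l. l < i \<Longrightarrow> 0 < d l" "\<And>l. l < i \<Longrightarrow> u l \<in> ideal_gen m k f"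
    "\<And>l. l < i \<Longrightarrow> var l ^ d l - u l \<in> tail_ideal m i"
    using pos by metis
  define w where "w x = (if x < i then 1 else Suc (\<Sum>l<i. d l))" for x
  define t where "t l = var l ^ d l - u l" for l
  have t: "t l \<in> tail_ideal m i" if "l < i" for l using du(3)[OF that] by (simp add: t_def)
  have cu: "cf (u l) \<beta> = (if \<beta> = single l (d l) then 1 else 0) - cf (t l) \<beta>" for l \<beta>
    by (simp add: t_def var_power cf_xpow finsupp_single)
  have wts: "wt m w (single l n) = n" if "l < i" for l n
  proof -
    have "wt m w (single l n) = (\<Sum>x<m. if x = l then n else 0)"
      unfolding wt_def using that by (intro sum.cong) (auto simp: single_def w_def)
    then show ?thesis using that im by simp
  qed
  interpret division m i w "\<lambda>l. single l (d l)" u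
  proof
    show "\<forall>i<m. 0 < w i" by (simp add: w_def)
    fix l assume l: "l < i"
    show "single l (d l) \<in> exponents m" using l im by (intro single_exponents) simp
    show "u l \<in> conv m" using du(2)[OF l] ideal_gen_conv[of k f m] f by blast
    have "cf (t l) (single l (d l)) = 0"
    proof (rule ccontr)
      assume "cf (t l) (single l (d l)) \<noteq> 0"
      then obtain j where "j \<ge> i" "single l (d l) j \<noteq> 0" using tail_idealD(2)[OF t[OF l]] by blast
      then show False using l by (auto simp: single_def split: if_splits)
    qed
    then show "cf (u l) (single l (d l)) = 1" using cu[of l "single l (d l)"] by simp
    fix \<beta> assume b: "cf (u l) \<beta> \<noteq> 0" "\<beta> \<noteq> single l (d l)"
    then have nz: "cf (t l) \<beta> \<noteq> 0" using cu[of l \<beta>] by simp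
    then obtain j where j: "j \<ge> i" "\<beta> j \<noteq> 0" using tail_idealD(2)[OF t[OF l]] by blast
    have "\<beta> \<in> exponents m" using conv_suppD[OF tail_idealD(1)[OF t[OF l]] nz] .
    then have "j < m" using j(2) by (rule exponents_less)
    have "d l \<le> (\<Sum>l<i. d l)" by (rule member_le_sum) (use l in auto)
    also have "\<dots> < w j * 1" using j by (simp add: w_def)
    also have "\<dots> \<le> w j * \<beta> j" using j by (intro mult_left_mono) auto
    also have "\<dots> \<le> wt m w \<beta>" unfolding wt_def by (rule member_le_sum) (use \<open>j < m\<close> in auto)
    finally show "wt m w (single l (d l)) < wt m w \<beta>" using wts[OF l] by simp
  qed
  define D where "D = {\<delta>. (\<forall>l<i. \<delta> l < d l) \<and> (\<forall>l\<ge>i. \<delta> l = 0)}"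
  have "D \<subseteq> {\<delta>. \<forall>x. (x \<in> {..<i} \<longrightarrow> \<delta> x \<in> {..<\<Sum>l<i. d l}) \<and> (x \<notin> {..<i} \<longrightarrow> \<delta> x = 0)}"
  proof clarsimp
    fix \<delta> x assume \<delta>: "\<delta> \<in> D"
    have "\<delta> x < sum d {..<i}" if "x < i"
    proof -
      have "\<delta> x < d x" using \<delta> that by (simp add: D_def)
      also have "\<dots> \<le> sum d {..<i}" by (rule member_le_sum) (use that in auto)
      finally show ?thesis .
    qed
    then show "(x < i \<longrightarrow> \<delta> x < sum d {..<i}) \<and> (\<not> x < i \<longrightarrow> \<delta> x = 0)" using \<delta> by (auto simp: D_def)
  qed
  then have fin: "finite D"
    by (rule finite_subset) (rule finite_set_of_finite_funs; simp)
  have Dexp: "D \<subseteq> exponents m" using im by (auto simp: D_def exponents_def)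
  have "\<exists>r. (\<forall>\<delta>\<in>D. r \<delta> \<in> tail_ring m i) \<and> h - (\<Sum>\<delta>\<in>D. r \<delta> * xpow \<delta>) \<in> ideal_gen m k f"
    if h: "h \<in> conv m" for h
  proof -
    obtain q R where q: "\<And>j. j < i \<Longrightarrow> q j \<in> conv m" "R \<in> conv m" "h = (\<Sum>j<i. q j * u j) + R"
      "\<And>\<beta> j. cf R \<beta> \<noteq> 0 \<Longrightarrow> j < i \<Longrightarrow> \<not> single j (d j) \<le> \<beta>"
      by (rule divide[OF h]) blast
    define r where "r \<delta> = shift \<delta> (\<lambda>\<beta>. \<forall>l<i. \<beta> l = \<delta> l) R" for \<delta>
    have cr: "cf (r \<delta>) \<gamma> = (if \<forall>l<i. \<gamma> l + \<delta> l = \<delta> l then cf R (\<gamma> + \<delta>) else 0)" if "\<delta> \<in> D" for \<delta> \<gamma>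
      using that Dexp exponents_finsupp by (subst r_def, subst cf_shift) auto
    have "r \<delta> \<in> tail_ring m i" if "\<delta> \<in> D" for \<delta>
      using that Dexp q(2) by (auto simp: tail_ring_def cr r_def[symmetric] split: if_splits)
         (auto simp: r_def intro: conv_shift)
    moreover have "R = (\<Sum>\<delta>\<in>D. r \<delta> * xpow \<delta>)"
    proof (rule pseries_eqI)
      fix \<beta> :: "nat \<Rightarrow> nat"
      define \<beta>' where "\<beta>' = (\<lambda>l. if l < i then \<beta> l else 0)"
      have "cf (r \<delta> * xpow \<delta>) \<beta> = (if \<delta> = \<beta>' then cf R \<beta> else 0)" if \<delta>: "\<delta> \<in> D" for \<delta>
      proof (cases "\<delta> \<le> \<beta>")
        case True
        have "(\<forall>l<i. (\<beta> - \<delta>) l + \<delta> l = \<delta> l) \<longleftrightarrow> \<delta> = \<beta>'"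
          using \<delta> True by (force simp: \<beta>'_def D_def le_fun_def fun_eq_iff)
        then show ?thesis
          using True \<delta> Dexp exponents_finsupp
          by (subst mult.commute, subst cf_xpow_times) (auto simp: cr exponent_diff_add)
      next
        case False
        moreover have "\<beta>' \<le> \<beta>" by (rule le_funI) (simp add: \<beta>'_def)
        ultimately have "\<delta> \<noteq> \<beta>'" by blast
        then show ?thesis using False \<delta> Dexp exponents_finsupp
          by (subst mult.commute, subst cf_xpow_times) auto
      qed
      then have "cf (\<Sum>\<delta>\<in>D. r \<delta> * xpow \<delta>) \<beta> = (if \<beta>' \<in> D then cf R \<beta> else 0)"
        using fin by simp
      moreover have "\<beta>' \<in> D" if "cf R \<beta> \<noteq> 0"
      proof -
        have "\<beta> l < d l" if "l < i" for l
          using q(4)[OF \<open>cf R \<beta> \<noteq> 0\<close> that] by (auto simp: single_def le_fun_def split: if_splits)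
        then show ?thesis by (simp add: D_def \<beta>'_def)
      qed
      ultimately show "cf R \<beta> = cf (\<Sum>\<delta>\<in>D. r \<delta> * xpow \<delta>) \<beta>" by auto
    qed
    then have "h - (\<Sum>\<delta>\<in>D. r \<delta> * xpow \<delta>) = (\<Sum>j<i. q j * u j)" using q(3) by simp
    moreover have "(\<Sum>j<i. q j * u j) \<in> ideal_gen m k f"
      using q(1) du(2) by (intro ideal_gen_sum ideal_gen_mult) auto
    ultimately show ?thesis by metis
  qed
  then show ?thesis using fin Dexp by blast
qed

text \<open>
  Induction on the set of coordinates. A vector with a nonzero entry at \<open>x\<close> serves to eliminate the coordinate \<open>x\<close>
  from the other vectors, and a nontrivial relation between the results gives one between the vectors.
\<close>

lemma linear_dependence:
  fixes S :: "'r::comm_ring_1 set" and v :: "'j \<Rightarrow> 'd \<Rightarrow> 'r"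
  assumes S: "0 \<in> S" "1 \<in> S" "\<And>a b. a \<in> S \<Longrightarrow> b \<in> S \<Longrightarrow> a + b \<in> S" "\<And>a b. a \<in> S \<Longrightarrow> b \<in> S \<Longrightarrow> a * b \<in> S"
      "\<And>a. a \<in> S \<Longrightarrow> - a \<in> S" "\<And>a b. a \<in> S \<Longrightarrow> b \<in> S \<Longrightarrow> a * b = 0 \<Longrightarrow> a = 0 \<or> b = 0"
    and "finite D" "finite J" "card D < card J" "\<And>j \<delta>. j \<in> J \<Longrightarrow> \<delta> \<in> D \<Longrightarrow> v j \<delta> \<in> S"
  shows "\<exists>s. (\<forall>j\<in>J. s j \<in> S) \<and> (\<exists>j\<in>J. s j \<noteq> 0) \<and> (\<forall>\<delta>\<in>D. (\<Sum>j\<in>J. s j * v j \<delta>) = 0)"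
  using assms(7-)
proof (induction D arbitrary: J v rule: finite_induct)
  case empty
  then have "J \<noteq> {}" by auto
  then show ?case using S by (intro exI[of _ "\<lambda>_. 1"]) auto
next
  case (insert x D)
  have Ssum: "sum h A \<in> S" if "\<And>a. a \<in> A \<Longrightarrow> h a \<in> S" for h and A :: "'j set"
    using that by (induction A rule: infinite_finite_induct) (auto intro: S)
  show ?case
  proof (cases "\<forall>j\<in>J. v j x = 0")
    case True
    then show ?thesis using insert.IH[of J v] insert.prems insert.hyps by simp
  next
    case False
    then obtain j0 where j0: "j0 \<in> J" "v j0 x \<noteq> 0" by blast
    define J' where "J' = J - {j0}"
    have J: "J = insert j0 J'" "j0 \<notin> J'" "finite J'" using j0 insert.prems by (auto simp: J'_def)
    have "card D < card J'" using insert.prems insert.hyps J by simp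
    moreover have "v j0 x * v j \<delta> + - (v j x * v j0 \<delta>) \<in> S" if "j \<in> J'" "\<delta> \<in> D" for j \<delta>
      using that insert.prems(3) J by (intro S) auto
    ultimately obtain t where t: "\<forall>j\<in>J'. t j \<in> S" "\<exists>j\<in>J'. t j \<noteq> 0"
      "\<forall>\<delta>\<in>D. (\<Sum>j\<in>J'. t j * (v j0 x * v j \<delta> + - (v j x * v j0 \<delta>))) = 0"
      using insert.IH[of J' "\<lambda>j \<delta>. v j0 x * v j \<delta> + - (v j x * v j0 \<delta>)"] J(3) by blast
    define s where "s j = (if j = j0 then - (\<Sum>j\<in>J'. t j * v j x) else v j0 x * t j)" for j
    have "s j \<in> S" if "j \<in> J" for j
    proof (cases "j = j0")
      case True
      have "(\<Sum>j\<in>J'. t j * v j x) \<in> S" using t(1) insert.prems(3) J by (intro Ssum S) auto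
      then show ?thesis using True S by (simp add: s_def)
    next
      case False
      then show ?thesis using that t(1) j0 insert.prems(3) J by (auto simp: s_def intro!: S)
    qed
    moreover have "\<exists>j\<in>J. s j \<noteq> 0"
    proof -
      obtain j where j: "j \<in> J'" "t j \<noteq> 0" using t(2) by blast
      then have "v j0 x * t j \<noteq> 0" using S(6)[of "v j0 x" "t j"] t(1) j0 insert.prems(3) by auto
      then show ?thesis using j J by (intro bexI[of _ j]) (auto simp: s_def)
    qed
    moreover have "(\<Sum>j\<in>J. s j * v j \<delta>) = 0" if \<delta>: "\<delta> \<in> insert x D" for \<delta>
    proof -
      have "(\<Sum>j\<in>J'. s j * v j \<delta>) = (\<Sum>j\<in>J'. t j * (v j0 x * v j \<delta>))"
        using J(2) by (intro sum.cong) (auto simp: s_def mult_ac)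
      then have "(\<Sum>j\<in>J. s j * v j \<delta>) = (\<Sum>j\<in>J'. t j * (v j0 x * v j \<delta> + - (v j x * v j0 \<delta>)))"
        using J by (simp add: s_def sum_distrib_left sum_distrib_right sum_subtractf right_diff_distrib mult_ac)
      also have "\<dots> = 0"
      proof (cases "\<delta> = x")
        case True
        then show ?thesis by (simp add: mult_ac)
      next
        case False
        then show ?thesis using \<delta> t(3) by auto
      qed
      finally show ?thesis .
    qed
    ultimately show ?thesis by blast
  qed
qed

lemma regular_power:
  assumes "regular m k f" "i < k" "b \<in> conv m" "f i ^ e * b \<in> ideal_gen m i f"
  shows "b \<in> ideal_gen m i f"
  using assms(4)
proof (induction e)
  case (Suc e)
  have "(f i ^ e * b) * f i \<in> ideal_gen m i f" using Suc.prems by (simp add: mult_ac)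
  moreover have "f i ^ e * b \<in> conv m" using assms by (intro conv_closed) (auto simp: regular_def)
  ultimately show ?case using Suc.IH assms(1,2) by (auto simp: regular_def)
qed simp

text \<open>
  As the quotient by the first \<open>i\<close> elements is finite over the tail ring, the powers of the next one are
  linearly dependent over that ring. Cancelling the lowest power, which is possible by regularity,
  leaves a nonzero element of the tail ring in the ideal of the first \<open>i + 1\<close> elements.
\<close>

lemma tail_element:
  assumes reg: "regular m (Suc i) f" and im: "i \<le> m"
    and pos: "\<forall>l<i. \<exists>d>0. \<exists>u\<in>ideal_gen m i f. var l ^ d - u \<in> tail_ideal m i"
  obtains c where "c \<in> tail_ring m i" "c \<in> ideal_gen m (Suc i) f" "c \<noteq> 0"
proof -
  let ?I = "ideal_gen m i f"
  have fc: "\<And>j. j < Suc i \<Longrightarrow> f j \<in> conv m" using reg by (simp add: regular_def)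
  obtain D where D: "finite D" "D \<subseteq> exponents m"
    "\<forall>h\<in>conv m. \<exists>r. (\<forall>\<delta>\<in>D. r \<delta> \<in> tail_ring m i) \<and> h - (\<Sum>\<delta>\<in>D. r \<delta> * xpow \<delta>) \<in> ?I"
    using finite_over_tail[of i f m i] fc im pos by auto
  have "\<forall>e. \<exists>r. (\<forall>\<delta>\<in>D. r \<delta> \<in> tail_ring m i) \<and> f i ^ e - (\<Sum>\<delta>\<in>D. r \<delta> * xpow \<delta>) \<in> ?I"
    using D(3) fc conv_power by blast
  then obtain v where v: "\<And>e \<delta>. \<delta> \<in> D \<Longrightarrow> v e \<delta> \<in> tail_ring m i"
    "\<And>e. f i ^ e - (\<Sum>\<delta>\<in>D. v e \<delta> * xpow \<delta>) \<in> ?I" by metis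
  define n where "n = card D"
  have "\<exists>s. (\<forall>j\<in>{..n}. s j \<in> tail_ring m i) \<and> (\<exists>j\<in>{..n}. s j \<noteq> 0) \<and>
      (\<forall>\<delta>\<in>D. (\<Sum>j\<in>{..n}. s j * v j \<delta>) = 0)"
  proof (rule linear_dependence)
    show "a = 0 \<or> b = 0" if "a \<in> tail_ring m i" "b \<in> tail_ring m i" "a * b = 0" for a b :: "'a pseries"
      using conv_no_zero_divisors[OF tail_ringD(1) tail_ringD(1)] that by blast
  qed (use D(1) v(1) in
    \<open>auto simp: n_def intro: tail_ring_zero tail_ring_one tail_ring_add tail_ring_mult tail_ring_uminus\<close>)
  then obtain s where s: "\<And>j. j \<le> n \<Longrightarrow> s j \<in> tail_ring m i" "\<exists>j\<le>n. s j \<noteq> 0"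
    "\<And>\<delta>. \<delta> \<in> D \<Longrightarrow> (\<Sum>j\<le>n. s j * v j \<delta>) = 0" by auto
  have "(\<Sum>e\<le>n. s e * (\<Sum>\<delta>\<in>D. v e \<delta> * xpow \<delta>)) = (\<Sum>e\<le>n. \<Sum>\<delta>\<in>D. s e * v e \<delta> * xpow \<delta>)"
    by (simp add: sum_distrib_left mult.assoc)
  also have "\<dots> = (\<Sum>\<delta>\<in>D. (\<Sum>e\<le>n. s e * v e \<delta>) * xpow \<delta>)"
    by (subst sum.swap) (simp add: sum_distrib_right)
  also have "\<dots> = 0" using s(3) by simp
  finally have "(\<Sum>e\<le>n. s e * f i ^ e) = (\<Sum>e\<le>n. s e * (f i ^ e - (\<Sum>\<delta>\<in>D. v e \<delta> * xpow \<delta>)))"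
    by (simp add: right_diff_distrib sum_subtractf)
  also have "\<dots> \<in> ?I" using s(1) tail_ringD(1) v(2) by (intro ideal_gen_sum ideal_gen_mult) auto
  finally have rel: "(\<Sum>e\<le>n. s e * f i ^ e) \<in> ?I" .
  define e0 where "e0 = (LEAST e. e \<le> n \<and> s e \<noteq> 0)"
  have e0: "e0 \<le> n" "s e0 \<noteq> 0" using LeastI_ex[of "\<lambda>e. e \<le> n \<and> s e \<noteq> 0"] s(2) by (auto simp: e0_def)
  have low: "s e = 0" if "e < e0" for e
    using not_less_Least[of e "\<lambda>e. e \<le> n \<and> s e \<noteq> 0"] that e0(1) by (auto simp: e0_def)
  define Q where "Q = (\<Sum>e\<in>{Suc e0..n}. s e * f i ^ (e - Suc e0))"
  have Qc: "Q \<in> conv m" unfolding Q_def using s(1) tail_ringD(1) fc by (intro conv_closed) auto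
  have "(\<Sum>e\<le>n. s e * f i ^ e) = (\<Sum>e\<in>insert e0 {Suc e0..n}. s e * f i ^ e)"
  proof (rule sum.mono_neutral_right)
    show "\<forall>e\<in>{..n} - insert e0 {Suc e0..n}. s e * f i ^ e = 0"
    proof
      fix e assume "e \<in> {..n} - insert e0 {Suc e0..n}"
      then have "e < e0" by auto
      then show "s e * f i ^ e = 0" by (simp add: low)
    qed
  qed (use e0(1) in auto)
  also have "\<dots> = s e0 * f i ^ e0 + (\<Sum>e\<in>{Suc e0..n}. s e * f i ^ e)" by simp
  also have "(\<Sum>e\<in>{Suc e0..n}. s e * f i ^ e) = f i ^ e0 * (Q * f i)"
    unfolding Q_def sum_distrib_left sum_distrib_right
  proof (rule sum.cong[OF refl])
    fix e assume "e \<in> {Suc e0..n}"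
    then have "e = e0 + (e - Suc e0) + 1" by simp
    then have "f i ^ e = f i ^ e0 * f i ^ (e - Suc e0) * f i" by (metis power_add power_one_right)
    then show "s e * f i ^ e = f i ^ e0 * (s e * f i ^ (e - Suc e0) * f i)" by (simp add: mult_ac)
  qed
  finally have "f i ^ e0 * (s e0 + Q * f i) \<in> ?I" using rel by (simp add: distrib_left mult_ac)
  moreover have "s e0 + Q * f i \<in> conv m" using s(1)[OF e0(1)] tail_ringD(1) Qc fc by (intro conv_closed) auto
  ultimately have "s e0 + Q * f i \<in> ?I" using regular_power[OF reg, of i] by auto
  then have "s e0 + Q * f i \<in> ideal_gen m (Suc i) f" using ideal_gen_mono[of i "Suc i" m f] by auto
  moreover have "Q * f i \<in> ideal_gen m (Suc i) f" using Qc by (intro ideal_gen_mult ideal_gen_base) auto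
  ultimately have "s e0 + Q * f i - Q * f i \<in> ideal_gen m (Suc i) f" by (rule ideal_gen_diff)
  then show ?thesis using that[of "s e0"] s(1)[OF e0(1)] e0(2) by simp
qed

lemma lin_subst_tail_ideal:
  assumes B: "\<And>l. i \<le> l \<Longrightarrow> l < m \<Longrightarrow> lin_form m B l \<in> tail_ideal m i" and F: "F \<in> tail_ideal m i"
  shows "lin_subst m B F \<in> tail_ideal m i"
  unfolding tail_ideal_def mem_Collect_eq
proof (intro conjI allI impI)
  show "lin_subst m B F \<in> conv m" using F tail_idealD(1) lin_subst_conv by blast
  fix \<gamma> assume "cf (lin_subst m B F) \<gamma> \<noteq> 0"
  then obtain \<beta> where \<beta>: "cf F \<beta> \<noteq> 0" "cf (lin_monom m B \<beta>) \<gamma> \<noteq> 0" by (rule cf_lin_subst_nonzeroE)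
  then obtain j where j: "j \<ge> i" "\<beta> j \<noteq> 0" using tail_idealD(2)[OF F] by blast
  have "\<beta> \<in> exponents m" using \<beta> conv_suppD[OF tail_idealD(1)[OF F]] by auto
  then have jm: "j < m" using j(2) by (rule exponents_less)
  obtain b where b: "\<beta> j = Suc b" using j by (metis not0_implies_Suc)
  have "lin_monom m B \<beta> = lin_form m B j ^ \<beta> j * (\<Prod>l\<in>{..<m} - {j}. lin_form m B l ^ \<beta> l)"
    unfolding lin_monom_def by (rule prod.remove) (use jm in auto)
  also have "\<dots> = (lin_form m B j ^ b * (\<Prod>l\<in>{..<m} - {j}. lin_form m B l ^ \<beta> l)) * lin_form m B j"
    by (simp add: b mult_ac)
  also have "\<dots> \<in> tail_ideal m i" using B[OF j(1) jm] by (intro tail_ideal_mult conv_closed lin_form_conv)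
  finally show "\<exists>j\<ge>i. \<gamma> j \<noteq> 0" using \<beta> tail_idealD(2) by auto
qed

lemma lin_subst_tail_ring:
  assumes B: "\<And>l. i \<le> l \<Longrightarrow> l < m \<Longrightarrow> lin_form m B l \<in> tail_ring m i" and F: "F \<in> tail_ring m i"
  shows "lin_subst m B F \<in> tail_ring m i"
  unfolding tail_ring_def mem_Collect_eq
proof (intro conjI allI impI)
  show "lin_subst m B F \<in> conv m" using F tail_ringD(1) lin_subst_conv by blast
  fix \<gamma> l assume nz: "cf (lin_subst m B F) \<gamma> \<noteq> 0" and l: "l < i"
  obtain \<beta> where \<beta>: "cf F \<beta> \<noteq> 0" "cf (lin_monom m B \<beta>) \<gamma> \<noteq> 0" using nz by (rule cf_lin_subst_nonzeroE)
  have "lin_form m B j ^ \<beta> j \<in> tail_ring m i" if "j < m" for j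
  proof (cases "j < i")
    case True
    then have "\<beta> j = 0" using \<beta> tail_ringD(2)[OF F] by auto
    then show ?thesis by (simp add: tail_ring_one)
  qed (use B that in \<open>auto intro: tail_ring_power\<close>)
  then have "lin_monom m B \<beta> \<in> tail_ring m i" unfolding lin_monom_def by (intro tail_ring_prod) auto
  from tail_ringD(2)[OF this \<beta>(2) l] show "\<gamma> l = 0" .
qed

text \<open>
  Exponents that add up to a multiple of the \<open>i\<close>-th unit vector are such multiples themselves, and for two forms
  their degrees are determined.
\<close>

lemma cf_single_mult:
  assumes F: "homogeneous m a F" and G: "homogeneous m b G" and i: "i < m"
  shows "cf (F * G) (single i (a + b)) = cf F (single i a) * cf G (single i b)"
proof -
  have "cf (F * G) (single i (a + b)) = (\<Sum>(\<gamma>, \<delta>)\<in>{(single i a, single i b)}. cf F \<gamma> * cf G \<delta>)"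
    unfolding cf_times
  proof (rule sum.mono_neutral_right[OF finite_splits[OF finsupp_single]])
    show "{(single i a, single i b)} \<subseteq> splits (single i (a + b))" by (simp add: splits_def single_add)
    show "\<forall>x\<in>splits (single i (a + b)) - {(single i a, single i b)}. (case x of (\<gamma>, \<delta>) \<Rightarrow> cf F \<gamma> * cf G \<delta>) = 0"
    proof (rule ballI, rule ccontr)
      fix x assume x: "x \<in> splits (single i (a + b)) - {(single i a, single i b)}"
        and "(case x of (\<gamma>, \<delta>) \<Rightarrow> cf F \<gamma> * cf G \<delta>) \<noteq> 0"
      moreover obtain \<gamma> \<delta> where "x = (\<gamma>, \<delta>)" by (cases x)
      ultimately have s: "(\<gamma>, \<delta>) \<in> splits (single i (a + b))"
        and ne: "(\<gamma>, \<delta>) \<noteq> (single i a, single i b)" and nz: "cf F \<gamma> * cf G \<delta> \<noteq> 0" by auto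
      have eq: "\<gamma> l + \<delta> l = single i (a + b) l" for l using s by (auto simp: splits_def fun_eq_iff)
      have "\<gamma> l = 0" "\<delta> l = 0" if "l \<noteq> i" for l using eq[of l] that by (auto simp: single_def)
      then have g: "\<gamma> = single i (\<gamma> i)" "\<delta> = single i (\<delta> i)" by (auto simp: single_def)
      then have "deg m \<gamma> = \<gamma> i" "deg m \<delta> = \<delta> i" using deg_single[OF i] by metis+
      moreover have "cf F \<gamma> \<noteq> 0" "cf G \<delta> \<noteq> 0" using nz by auto
      ultimately have "\<gamma> i = a" "\<delta> i = b" using F G unfolding homogeneous_def by metis+
      then show False using g ne by auto
    qed
  qed
  then show ?thesis by simp
qed

lemma cf_single_power:
  assumes "homogeneous m 1 F" "i < m"
  shows "cf (F ^ n) (single i n) = cf F (single i 1) ^ n"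
proof (induction n)
  case 0
  show ?case by (simp only: single_0 power_0 cf_one refl if_True)
next
  case (Suc n)
  have "homogeneous m n (F ^ n)" using homogeneous_power[OF assms(1), of n] by simp
  then have "cf (F * F ^ n) (single i (1 + n)) = cf F (single i 1) * cf (F ^ n) (single i n)"
    by (rule cf_single_mult[OF assms(1) _ assms(2)])
  then show ?case using Suc by simp
qed

lemma cf_single_lin_monom:
  assumes i: "i < m"
  shows "cf (lin_monom m A \<beta>) (single i (deg m \<beta>)) = (\<Prod>r<m. A $$ (r, i) ^ \<beta> r)"
proof -
  have form: "cf (lin_form m A r) (single i 1) = A $$ (r, i)" for r
    using i by (simp add: cf_lin_form single_inject)
      (subst sum.cong[of _ _ _ "\<lambda>j. if j = i then A $$ (r, i) else 0"], auto simp: single_def fun_eq_iff)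
  have hom: "homogeneous m (\<beta> r) (lin_form m A r ^ \<beta> r)" for r
    using homogeneous_power[OF lin_form_homogeneous[of m A r], of "\<beta> r"] by simp
  have "cf (\<Prod>r<n. lin_form m A r ^ \<beta> r) (single i (\<Sum>r<n. \<beta> r)) = (\<Prod>r<n. A $$ (r, i) ^ \<beta> r)" for n
  proof (induction n)
    case 0
    show ?case by (simp only: single_0 lessThan_0 sum.empty prod.empty cf_one refl if_True)
  next
    case (Suc n)
    have "cf ((\<Prod>r<n. lin_form m A r ^ \<beta> r) * lin_form m A n ^ \<beta> n) (single i ((\<Sum>r<n. \<beta> r) + \<beta> n)) =
        cf (\<Prod>r<n. lin_form m A r ^ \<beta> r) (single i (\<Sum>r<n. \<beta> r)) * cf (lin_form m A n ^ \<beta> n) (single i (\<beta> n))"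
      by (rule cf_single_mult[OF homogeneous_prod hom i]) (rule hom)
    moreover have "cf (lin_form m A n ^ \<beta> n) (single i (\<beta> n)) = A $$ (n, i) ^ \<beta> n"
      using cf_single_power[OF lin_form_homogeneous i, of A n "\<beta> n"] form[of n] by simp
    ultimately show ?case using Suc by simp
  qed
  from this[of m] show ?thesis by (simp add: lin_monom_def deg_def)
qed

text \<open>
  A nonzero form does not vanish at some point of the shape \<open>(t\<^bsup>w 0\<^esup>, t\<^bsup>w 1\<^esup>, \<dots>)\<close> with \<open>t \<noteq> 0\<close>, provided
  the weights \<open>w\<close> separate its exponents: its restriction to this curve is a nonzero polynomial in \<open>t\<close>.
  Making this point the image of the \<open>i\<close>-th unit vector produces a pure power of \<open>x\<^sub>i\<close>.
\<close>

lemma make_regular: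
  fixes c :: "'a::{real_normed_field,banach} pseries"
  assumes c: "c \<in> tail_ring m i" and i: "i < m" and ord: "order_ge m d c" and \<beta>0: "cf c \<beta>0 \<noteq> 0" "deg m \<beta>0 = d"
  obtains B where "B \<in> general_linear m" "\<And>l. l < i \<Longrightarrow> lin_form m B l = var l"
    "\<And>l. i \<le> l \<Longrightarrow> l < m \<Longrightarrow> lin_form m B l \<in> tail_ring m i \<inter> tail_ideal m i"
    "cf (lin_subst m B c) (single i d) \<noteq> 0"
proof -
  obtain w where w: "\<forall>i. 0 < w i"
    "\<forall>\<alpha> \<beta>. deg m \<alpha> \<le> d \<longrightarrow> exponent_less m \<alpha> \<beta> \<longrightarrow> wt m w \<alpha> < wt m w \<beta>"
    using exponent_less_weights[of m d] by (elim exE conjE)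
  have exp: "\<beta> \<in> exponents m" if "cf c \<beta> \<noteq> 0" for \<beta> using conv_suppD[OF tail_ringD(1)[OF c] that] .
  have inj: "\<beta> = \<beta>0" if "cf c \<beta> \<noteq> 0" "deg m \<beta> \<le> d" "wt m w \<beta> = wt m w \<beta>0" for \<beta>
    using exponent_less_total[OF exp[OF that(1)] exp[OF \<beta>0(1)]] w(2) that \<beta>0(2) by fastforce
  let ?S = "{\<beta> \<in> exponents m. deg m \<beta> \<le> d}"
  define p where "p = (\<Sum>\<beta>\<in>?S. Polynomial.monom (cf c \<beta>) (wt m w \<beta>))"
  have "coeff p (wt m w \<beta>0) = (\<Sum>\<beta>\<in>?S. if \<beta> = \<beta>0 then cf c \<beta> else 0)"
    unfolding p_def coeff_sum using inj by (intro sum.cong) auto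
  also have "\<dots> = cf c \<beta>0" using finite_deg_le exp[OF \<beta>0(1)] \<beta>0(2) by simp
  finally have "p \<noteq> 0" using \<beta>0(1) by auto
  then have "finite (insert 0 {t. poly p t = 0})" by (simp add: poly_roots_finite)
  then have "\<exists>t. t \<notin> insert 0 {t. poly p t = 0}" by (rule ex_new_if_finite[OF infinite_UNIV_char_0])
  then obtain t where t: "t \<noteq> 0" "poly p t \<noteq> 0" by blast
  define B where "B = mat m m (\<lambda>(r, s). if s = i \<and> i \<le> r then t ^ w r else if r = s then 1 else 0)"
  have Bc: "B \<in> carrier_mat m m" by (simp add: B_def)
  have Bi: "B $$ (r, s) = (if s = i \<and> i \<le> r then t ^ w r else if r = s then 1 else 0)" if "r < m" "s < m" for r s
    using that by (simp add: B_def)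
  have "det B = prod_list (diag_mat B)"
    by (rule det_lower_triangular[OF _ Bc]) (use Bi in auto)
  moreover have "0 \<notin> set (diag_mat B)" using Bc Bi t(1) by (auto simp: diag_mat_def)
  ultimately have "det B \<noteq> 0" by (simp add: prod_list_zero_iff)
  then have "B \<in> Units (ring_mat TYPE('a) m ())" by (rule det_non_zero_imp_unit[OF Bc])
  then obtain C where "C \<in> carrier_mat m m" "C * B = 1\<^sub>m m" "B * C = 1\<^sub>m m"
    by (auto simp: Units_def ring_mat_def)
  then have GL: "B \<in> general_linear m"
    using Bc by (auto simp: general_linear_def invertible_mat_def inverts_mat_def)
  have low: "lin_form m B l = var l" if "l < i" for l
  proof -
    have "lin_form m B l = (\<Sum>j<m. if j = l then var j else 0)"
      unfolding lin_form_def using that i by (intro sum.cong) (auto simp: Bi const_one const_zero)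
    then show ?thesis using that i by simp
  qed
  have high: "lin_form m B l \<in> tail_ring m i \<inter> tail_ideal m i" if "i \<le> l" "l < m" for l
  proof -
    have "\<exists>j\<ge>i. \<beta> = single j 1" if nz: "cf (lin_form m B l) \<beta> \<noteq> 0" for \<beta>
    proof -
      obtain j where j: "j < m" "\<beta> = single j 1" "B $$ (l, j) \<noteq> 0"
        using nz by (rule cf_lin_form_nonzeroE)
      then have "i \<le> j" using Bi[of l j] \<open>i \<le> l\<close> \<open>l < m\<close> by (auto split: if_splits)
      then show ?thesis using j by blast
    qed
    then show ?thesis using lin_form_conv[of m B l]
      by (fastforce simp: tail_ring_def tail_ideal_def single_def)
  qed
  have "cf (lin_subst m B c) (single i d) = (\<Sum>\<beta>\<in>?S. cf c \<beta> * cf (lin_monom m B \<beta>) (single i d))"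
    by (rule cf_lin_subst) (simp add: deg_single i)
  also have "\<dots> = (\<Sum>\<beta>\<in>?S. cf c \<beta> * t ^ wt m w \<beta>)"
  proof (rule sum.cong[OF refl])
    fix \<beta> assume \<beta>: "\<beta> \<in> ?S"
    show "cf c \<beta> * cf (lin_monom m B \<beta>) (single i d) = cf c \<beta> * t ^ wt m w \<beta>"
    proof (cases "cf c \<beta> = 0")
      case False
      then have dg: "deg m \<beta> = d" using ord \<beta> by (force simp: order_ge_def)
      have "cf (lin_monom m B \<beta>) (single i d) = (\<Prod>r<m. B $$ (r, i) ^ \<beta> r)"
        using cf_single_lin_monom[OF i, of B \<beta>] dg by simp
      also have "\<dots> = (\<Prod>r<m. t ^ (w r * \<beta> r))"
        using tail_ringD(2)[OF c False] i by (intro prod.cong) (auto simp: Bi power_mult)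
      also have "\<dots> = t ^ wt m w \<beta>" by (simp add: power_sum wt_def)
      finally show ?thesis by simp
    qed simp
  qed
  also have "\<dots> = poly p t" by (simp add: p_def poly_sum poly_monom)
  finally have "cf (lin_subst m B c) (single i d) \<noteq> 0" using t(2) by simp
  then show ?thesis using that[OF GL low high] by blast
qed

lemma power_add_in_ideal:
  assumes Q: "\<And>a b. a \<in> Q \<Longrightarrow> b \<in> Q \<Longrightarrow> a + b \<in> Q" "\<And>a b. a \<in> conv m \<Longrightarrow> b \<in> Q \<Longrightarrow> a * b \<in> Q"
    and q: "q \<in> Q" "q \<in> conv m" and y: "y \<in> conv m" "y ^ n \<in> Q"
  shows "(q + y) ^ n \<in> Q"
proof -
  have "\<exists>z\<in>conv m. (q + y) ^ n = y ^ n + z * q"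
  proof (induction n)
    case 0
    show ?case by (intro bexI[of _ 0]) (auto simp: conv_zero)
  next
    case (Suc n)
    then obtain z where z: "z \<in> conv m" "(q + y) ^ n = y ^ n + z * q" by blast
    have "(q + y) ^ Suc n = y ^ Suc n + (y ^ n + z * (q + y)) * q"
      using z(2) by (simp add: algebra_simps)
    moreover have "y ^ n + z * (q + y) \<in> conv m" using z q y by (intro conv_closed)
    ultimately show ?case by blast
  qed
  then show ?thesis using Q q y by auto
qed

text \<open>
  The condition on \<open>x\<^sub>l\<^sup>d\<close> says that the quotient becomes finite-dimensional when \<open>x\<^sub>i, x\<^bsub>i+1\<^esub>, \<dots>\<close> are set to zero.
  The hypothesis on the order excludes units; in particular \<open>k\<close> cannot exceed \<open>m\<close>, as there is no nonzero
  series without constant term in no variables.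
\<close>

theorem noether_normalization:
  assumes reg: "regular m k f" and ord: "\<And>j. j < k \<Longrightarrow> order_ge m 1 (f j)" and "i \<le> k"
  shows "i \<le> m \<and> (\<exists>A\<in>general_linear m. \<forall>l<i. \<exists>d>0.
    \<exists>u\<in>ideal_gen m i (\<lambda>j. lin_subst m A (f j)). var l ^ d - u \<in> tail_ideal m i)"
  using assms(3)
proof (induction i)
  case 0
  have "1\<^sub>m m \<in> general_linear m"
    by (auto simp: general_linear_def invertible_mat_def inverts_mat_def intro!: exI[of _ "1\<^sub>m m"])
  then show ?case by auto
next
  case (Suc i)
  then obtain A where im: "i \<le> m" and A: "A \<in> general_linear m"
    and pos: "\<forall>l<i. \<exists>d>0. \<exists>u\<in>ideal_gen m i (\<lambda>j. lin_subst m A (f j)). var l ^ d - u \<in> tail_ideal m i"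
    by auto
  define fA where "fA = (\<lambda>j. lin_subst m A (f j))"
  have reg': "regular m (Suc i) fA"
    using lin_subst_regular[OF A reg] regular_prefix Suc.prems unfolding fA_def by blast
  obtain c where c: "c \<in> tail_ring m i" "c \<in> ideal_gen m (Suc i) fA" "c \<noteq> 0"
    using tail_element[OF reg' im] pos unfolding fA_def by blast
  have cc: "c \<in> conv m" by (rule tail_ringD(1)[OF c(1)])
  obtain \<beta>0 where \<beta>0: "is_initial m c \<beta>0" using is_initial_exists[OF cc c(3)] .
  define d where "d = deg m \<beta>0"
  have cd: "order_ge m d c" "cf c \<beta>0 \<noteq> 0"
    using is_initial_order_ge[OF \<beta>0] \<beta>0 by (auto simp: d_def is_initial_def)
  have "order_ge m 1 c"
  proof -
    obtain a where ca: "c = (\<Sum>j<Suc i. a j * fA j)" using c(2) by (elim ideal_genE)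
    have "order_ge m 1 (a j * fA j)" if "j < Suc i" for j
      using lin_subst_order_ge[OF ord, of j A] that Suc.prems unfolding fA_def
      by (intro order_ge_mult'[of m 0 _ 1]) auto
    then have "order_ge m 1 (\<Sum>j<Suc i. a j * fA j)" by (intro order_ge_sum) simp
    then show ?thesis unfolding ca .
  qed
  then have d: "0 < d" using cd(2) by (auto simp: order_ge_def d_def)
  have i: "i < m"
  proof (rule ccontr)
    assume "\<not> i < m"
    then have "deg m \<beta>0 = 0" using tail_ringD(2)[OF c(1) cd(2)] by (simp add: deg_def)
    then show False using d by (simp add: d_def)
  qed
  obtain B where B: "B \<in> general_linear m" "\<And>l. l < i \<Longrightarrow> lin_form m B l = var l"
    "\<And>l. i \<le> l \<Longrightarrow> l < m \<Longrightarrow> lin_form m B l \<in> tail_ring m i \<inter> tail_ideal m i"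
    "cf (lin_subst m B c) (single i d) \<noteq> 0"
    using make_regular[OF c(1) i cd(1,2)] d_def by metis
  have AB: "A * B \<in> general_linear m"
  proof -
    obtain A' where A': "A' \<in> carrier_mat m m" "A * A' = 1\<^sub>m m" "A' * A = 1\<^sub>m m"
      using general_linear_inverse[OF A] .
    obtain B' where B': "B' \<in> carrier_mat m m" "B * B' = 1\<^sub>m m" "B' * B = 1\<^sub>m m"
      using general_linear_inverse[OF B(1)] .
    have AC: "A \<in> carrier_mat m m" and BC: "B \<in> carrier_mat m m" using A B(1) by (auto simp: general_linear_def)
    have "A * B * (B' * A') = A * (B * (B' * A'))" using AC BC A'(1) B'(1) by (intro assoc_mult_mat) auto
    also have "B * (B' * A') = B * B' * A'" using BC A'(1) B'(1) by (intro assoc_mult_mat[symmetric]) auto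
    finally have 1: "A * B * (B' * A') = 1\<^sub>m m" using A' B' AC by simp
    have "B' * A' * (A * B) = B' * (A' * (A * B))" using AC BC A'(1) B'(1) by (intro assoc_mult_mat) auto
    also have "A' * (A * B) = A' * A * B" using AC BC A'(1) by (intro assoc_mult_mat[symmetric]) auto
    finally have 2: "B' * A' * (A * B) = 1\<^sub>m m" using A' B' BC by simp
    show ?thesis using 1 2 AC BC A'(1) B'(1)
      by (auto simp: general_linear_def invertible_mat_def inverts_mat_def intro!: exI[of _ "B' * A'"])
  qed
  define g where "g = (\<lambda>j. lin_subst m (A * B) (f j))"
  have gB: "g j = lin_subst m B (fA j)" if "j < Suc i" for j
    using lin_subst_lin_subst[of A m B "f j"] A B(1) regular_conv[OF reg, of j] that Suc.prems
    by (simp add: g_def fA_def general_linear_def)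
  have gc: "g j \<in> conv m" if "j < Suc i" for j
    using lin_subst_conv regular_conv[OF reg, of j] that Suc.prems by (simp add: g_def)
  have fAc: "fA j \<in> conv m" if "j < Suc i" for j by (rule regular_conv[OF reg' that])
  have gen: "ideal_gen m n g = lin_subst m B ` ideal_gen m n fA" if "n \<le> Suc i" for n
  proof -
    have "ideal_gen m n g = ideal_gen m n (\<lambda>j. lin_subst m B (fA j))"
      unfolding ideal_gen_def using gB that by (intro Collect_cong ex_cong1 conj_cong refl arg_cong2[where f = "(=)"] sum.cong) auto
    then show ?thesis using lin_subst_ideal_gen[OF B(1), of n fA] fAc that by simp
  qed
  let ?J = "ideal_gen m (Suc i) g"
  define c' where "c' = lin_subst m B c"
  have c'J: "c' \<in> ?J" using gen[of "Suc i"] c(2) by (simp add: c'_def)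
  have c'tail: "c' \<in> tail_ring m i" unfolding c'_def by (rule lin_subst_tail_ring[OF _ c(1)]) (use B(3) in auto)
  have c'ord: "order_ge m d c'" unfolding c'_def by (rule lin_subst_order_ge[OF cd(1)])
  \<comment> \<open>the ideal modulo which powers of \<open>x\<^sub>0, \<dots>, x\<^sub>i\<close> have to vanish\<close>
  define Q where "Q = {q + \<tau> | q \<tau>. q \<in> ?J \<and> \<tau> \<in> tail_ideal m (Suc i)}"
  have Q_add: "a + b \<in> Q" if "a \<in> Q" "b \<in> Q" for a b
  proof -
    obtain q \<tau> q' \<tau>' where "a = q + \<tau>" "b = q' + \<tau>'" "q \<in> ?J" "q' \<in> ?J"
      "\<tau> \<in> tail_ideal m (Suc i)" "\<tau>' \<in> tail_ideal m (Suc i)" using \<open>a \<in> Q\<close> \<open>b \<in> Q\<close> by (auto simp: Q_def)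
    moreover then have "a + b = (q + q') + (\<tau> + \<tau>')" by simp
    ultimately show ?thesis unfolding Q_def using ideal_gen_add tail_ideal_add by blast
  qed
  have Q_mult: "a * b \<in> Q" if "a \<in> conv m" "b \<in> Q" for a b
  proof -
    obtain q \<tau> where "b = q + \<tau>" "q \<in> ?J" "\<tau> \<in> tail_ideal m (Suc i)" using \<open>b \<in> Q\<close> by (auto simp: Q_def)
    moreover then have "a * b = a * q + a * \<tau>" by (simp add: distrib_left)
    ultimately show ?thesis unfolding Q_def using ideal_gen_mult tail_ideal_mult \<open>a \<in> conv m\<close> by blast
  qed
  have QJ: "q \<in> Q" if "q \<in> ?J" for q
  proof -
    have "0 \<in> tail_ideal m (Suc i)" by (simp add: tail_ideal_def conv_zero)
    moreover have "q = q + 0" by simp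
    ultimately show ?thesis unfolding Q_def using that by blast
  qed
  have QT: "\<tau> \<in> Q" if "\<tau> \<in> tail_ideal m (Suc i)" for \<tau>
  proof -
    have "0 \<in> ?J" by (rule ideal_gen_zero)
    moreover have "\<tau> = 0 + \<tau>" by simp
    ultimately show ?thesis unfolding Q_def using that by blast
  qed
  have Q_conv: "q \<in> conv m" if "q \<in> Q" for q
    using that ideal_gen_conv[of "Suc i" g m] gc tail_idealD(1) by (auto simp: Q_def intro!: conv_add)
  \<comment> \<open>the new coordinate: \<open>c'\<close> is \<open>x\<^sub>i\<^sup>d\<close> times a unit up to the later coordinates\<close>
  have xd: "var i ^ d \<in> Q"
  proof -
    define U where "U = shift (single i d) (\<lambda>\<beta>. \<forall>j. j \<noteq> i \<longrightarrow> \<beta> j = 0) c'"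
    have Uc: "U \<in> conv m" unfolding U_def using i tail_ringD(1)[OF c'tail] by (intro conv_shift single_exponents)
    have cU: "cf U \<gamma> = (if \<forall>j. j \<noteq> i \<longrightarrow> \<gamma> j + single i d j = 0 then cf c' (\<gamma> + single i d) else 0)" for \<gamma>
      by (simp add: U_def cf_shift finsupp_single)
    have "cf U 0 \<noteq> 0" using B(4) by (simp add: cU c'_def single_def)
    then obtain V where V: "V \<in> conv m" "V * U = 1" using conv_unit[OF Uc] by blast
    define t where "t = c' - var i ^ d * U"
    have "t \<in> tail_ideal m (Suc i)"
      unfolding tail_ideal_def mem_Collect_eq
    proof (intro conjI allI impI)
      show "t \<in> conv m" unfolding t_def using tail_ringD(1)[OF c'tail] Uc i by (intro conv_closed var_conv)
      fix \<beta> assume nz: "cf t \<beta> \<noteq> 0"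
      show "\<exists>j\<ge>Suc i. \<beta> j \<noteq> 0"
      proof (rule ccontr)
        assume none: "\<not> (\<exists>j\<ge>Suc i. \<beta> j \<noteq> 0)"
        have prod: "cf (var i ^ d * U) \<beta> = (if single i d \<le> \<beta> then cf U (\<beta> - single i d) else 0)"
          by (simp add: var_power cf_xpow_times finsupp_single)
        show False
        proof (cases "\<forall>l<i. \<beta> l = 0")
          case True
          have pure: "\<beta> j = 0" if "j \<noteq> i" for j using none True that by (metis Suc_leI linorder_neqE_nat)
          then have \<beta>: "\<beta> = single i (\<beta> i)" by (auto simp: single_def)
          show False
          proof (cases "d \<le> \<beta> i")
            case True
            then have "single i d \<le> \<beta>" by (auto simp: single_def le_fun_def)
            then have "cf (var i ^ d * U) \<beta> = cf c' \<beta>"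
              using pure by (simp add: prod cU exponent_diff_add) (simp add: single_def)
            then show False using nz by (simp add: t_def)
          next
            case False
            then have "\<not> single i d \<le> \<beta>" by (auto simp: single_def le_fun_def)
            moreover have "deg m \<beta> < d" using \<beta> deg_single[OF i] False by (metis not_le)
            then have "cf c' \<beta> = 0" using c'ord by (auto simp: order_ge_def)
            ultimately show False using nz prod by (simp add: t_def)
          qed
        next
          case False
          then have "cf c' \<beta> = 0" using tail_ringD(2)[OF c'tail] by blast
          moreover have "cf (var i ^ d * U) \<beta> = 0"
          proof -
            obtain l where "l < i" "\<beta> l \<noteq> 0" using False by blast
            then have "\<not> (\<forall>j. j \<noteq> i \<longrightarrow> (\<beta> - single i d) j + single i d j = 0)" by (auto simp: single_def)
            then show ?thesis using prod cU by auto
          qed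
          ultimately show False using nz by (simp add: t_def)
        qed
      qed
    qed
    have "var i ^ d = V * U * var i ^ d" using V(2) by simp
    also have "\<dots> = V * c' + V * (- t)" by (simp add: t_def algebra_simps)
    also have "\<dots> \<in> Q"
      using V(1) c'J \<open>t \<in> _\<close> by (intro Q_add Q_mult QJ QT tail_ideal_uminus)
    finally show ?thesis .
  qed
  \<comment> \<open>an earlier coordinate: a power of it is congruent to a multiple of \<open>x\<^sub>i\<close>, whose \<open>d\<close>-th power lies in \<open>Q\<close>\<close>
  have old: "\<exists>D>0. var l ^ D \<in> Q" if l: "l < i" for l
  proof -
    obtain e u where e: "0 < e" "u \<in> ideal_gen m i fA" "var l ^ e - u \<in> tail_ideal m i"
      using pos l unfolding fA_def by blast
    define t where "t = lin_subst m B (var l ^ e - u)"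
    have t: "t \<in> tail_ideal m i" unfolding t_def by (rule lin_subst_tail_ideal[OF _ e(3)]) (use B(3) in auto)
    have "lin_subst m B (var l ^ e) = var l ^ e"
      using l i B(2) by (simp add: lin_subst_power var_conv lin_subst_var)
    then have xl: "var l ^ e = lin_subst m B u + t" by (simp add: t_def lin_subst_diff)
    have "lin_subst m B u \<in> ideal_gen m i g" using gen[of i] e(2) by simp
    then have uQ: "lin_subst m B u \<in> Q" using ideal_gen_mono[of i "Suc i" m g] QJ by auto
    define t1 where "t1 = shift (single i 1) (\<lambda>\<beta>. \<forall>j\<ge>Suc i. \<beta> j = 0) t"
    have t1: "t1 \<in> conv m" unfolding t1_def using i tail_idealD(1)[OF t] by (intro conv_shift single_exponents)
    define t2 where "t2 = t - var i * t1"
    have "t2 \<in> tail_ideal m (Suc i)"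
      unfolding tail_ideal_def mem_Collect_eq
    proof (intro conjI allI impI)
      show "t2 \<in> conv m" unfolding t2_def using tail_idealD(1)[OF t] t1 i by (intro conv_closed var_conv)
      fix \<beta> assume nz: "cf t2 \<beta> \<noteq> 0"
      show "\<exists>j\<ge>Suc i. \<beta> j \<noteq> 0"
      proof (rule ccontr)
        assume none: "\<not> (\<exists>j\<ge>Suc i. \<beta> j \<noteq> 0)"
        have prod: "cf (var i * t1) \<beta> = (if single i 1 \<le> \<beta> then cf t1 (\<beta> - single i 1) else 0)"
          by (simp add: var_def cf_xpow_times finsupp_single)
        show False
        proof (cases "\<beta> i = 0")
          case True
          then have "cf t \<beta> = 0" using tail_idealD(2)[OF t] none by (metis Suc_leI le_neq_implies_less)
          moreover have "\<not> single i 1 \<le> \<beta>" using True by (auto simp: single_def le_fun_def)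
          ultimately show False using nz prod by (simp add: t2_def)
        next
          case False
          then have le: "single i 1 \<le> \<beta>" by (auto simp: single_def le_fun_def)
          have "cf t1 (\<beta> - single i 1) = cf t \<beta>"
            unfolding t1_def cf_shift[OF finsupp_single] exponent_diff_add[OF le] using none by auto
          then show False using nz prod le by (simp add: t2_def)
        qed
      qed
    qed
    then have q: "lin_subst m B u + t2 \<in> Q" using uQ QT Q_add by blast
    have y: "(var i * t1) ^ d \<in> Q"
      using xd t1 Q_mult[of "t1 ^ d" "var i ^ d"] by (simp add: power_mult_distrib mult.commute conv_power)
    have yc: "var i * t1 \<in> conv m" using i t1 by (intro conv_closed var_conv)
    have "(lin_subst m B u + t2 + var i * t1) ^ d \<in> Q"
      by (rule power_add_in_ideal[OF Q_add Q_mult q Q_conv[OF q] yc y])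
    then have "var l ^ (e * d) \<in> Q" using xl by (simp add: t2_def power_mult)
    then show ?thesis using e(1) d by (intro exI[of _ "e * d"]) auto
  qed
  have "\<exists>D>0. \<exists>u\<in>?J. var l ^ D - u \<in> tail_ideal m (Suc i)" if "l < Suc i" for l
  proof -
    have "\<exists>D>0. var l ^ D \<in> Q" using old xd d that less_Suc_eq by metis
    then obtain D q \<tau> where "0 < D" "var l ^ D = q + \<tau>" "q \<in> ?J" "\<tau> \<in> tail_ideal m (Suc i)"
      by (auto simp: Q_def)
    then show ?thesis by (intro exI[of _ D] conjI bexI[of _ q]) auto
  qed
  then show ?case using i AB unfolding g_def by (auto intro!: bexI[of _ "A * B"])
qed

section \<open>Translation to the ring of convergent power series\<close>

text \<open>
  In this section coefficient functions are compared as functions. The pointwise rules would turn them into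
  abstractions.
\<close>

declare cf_zero [simp del] cf_add [simp del] cf_diff [simp del] cf_uminus [simp del] cf_sum [simp del]

lemma cf_series_convergent:
  assumes "f \<in> convergent_series m"
  shows "cf (series f) = f" "series f \<in> conv m"
proof -
  have fs: "finsupp \<beta>" if "f \<beta> \<noteq> 0" for \<beta>
    using assms that exponents_finsupp by (auto simp: convergent_series_def)
  show "cf (series f) = f" by (rule ext) (use fs in \<open>auto simp: cf_series\<close>)
  then show "series f \<in> conv m" using assms by (simp add: conv_def)
qed

lemma cf_image_conv: "cf ` conv m = convergent_series m"
  using cf_series_convergent by (force simp: conv_def image_iff)

lemma series_mult_cf:
  assumes "F \<in> conv m" "G \<in> conv m"
  shows "series_mult m (cf F) (cf G) = cf (F * G)"
proof
  fix \<beta>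
  have def': "series_mult m (cf F) (cf G) \<beta> =
      (\<Sum>(\<gamma>, \<delta>) | \<gamma> \<in> exponents m \<and> \<delta> \<in> exponents m \<and> \<gamma> + \<delta> = \<beta>. cf F \<gamma> * cf G \<delta>)"
    by (simp only: series_mult_def plus_fun_def)
  show "series_mult m (cf F) (cf G) \<beta> = cf (F * G) \<beta>"
  proof (cases "\<beta> \<in> exponents m")
    case True
    then have "{(\<gamma>, \<delta>). \<gamma> \<in> exponents m \<and> \<delta> \<in> exponents m \<and> \<gamma> + \<delta> = \<beta>} = splits \<beta>"
      unfolding splits_def using exponents_addD exponents_addD' by blast
    then show ?thesis by (simp only: def' cf_times)
  next
    case False
    then have empty: "{(\<gamma>, \<delta>). \<gamma> \<in> exponents m \<and> \<delta> \<in> exponents m \<and> \<gamma> + \<delta> = \<beta>} = {}"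
      using exponents_add by blast
    have "cf (F * G) \<beta> = 0" using conv_suppD[OF conv_mult[OF assms]] False by blast
    then show ?thesis by (simp add: def' empty)
  qed
qed

lemma add_cf: "(\<lambda>\<beta>. cf F \<beta> + cf G \<beta>) = cf (F + G :: 'a::comm_ring_1 pseries)"
  and one_cf: "(\<lambda>\<beta>. if \<beta> = (\<lambda>_. 0) then 1 else 0) = cf (1 :: 'a pseries)"
  and zero_cf: "(\<lambda>_. 0) = cf (0 :: 'a pseries)"
  by (rule ext, simp add: cf_add cf_one cf_zero zero_fun_def)+

lemma cps_carrier: "carrier (cps m) = cf ` conv m"
  and cps_mult: "F \<in> conv m \<Longrightarrow> G \<in> conv m \<Longrightarrow> cf F \<otimes>\<^bsub>cps m\<^esub> cf G = cf (F * G)"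
  and cps_add: "cf F \<oplus>\<^bsub>cps m\<^esub> cf G = cf (F + G)"
  and cps_one: "\<one>\<^bsub>cps m\<^esub> = cf 1"
  and cps_zero: "\<zero>\<^bsub>cps m\<^esub> = cf 0"
  by (simp_all add: cps_def cf_image_conv series_mult_cf add_cf one_cf zero_cf)

lemmas cps_simps = cps_carrier cps_mult cps_add cps_one cps_zero

lemma cps_tail_carrier: "carrier (cps_tail k m) = cf ` tail_ring m k"
proof -
  have "carrier (cps_tail k m) = {f \<in> cf ` conv m. \<forall>\<beta>. f \<beta> \<noteq> 0 \<longrightarrow> (\<forall>i<k. \<beta> i = 0)}"
    by (simp add: cps_tail_def cf_image_conv)
  then show ?thesis by (auto simp: tail_ring_def)
qed

lemma cring_cf_image:
  assumes S: "S \<subseteq> conv m" "0 \<in> S" "1 \<in> S" "\<And>F G. F \<in> S \<Longrightarrow> G \<in> S \<Longrightarrow> F + G \<in> S"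
      "\<And>F G. F \<in> S \<Longrightarrow> G \<in> S \<Longrightarrow> F * G \<in> S" "\<And>F. F \<in> S \<Longrightarrow> - F \<in> S"
    and R: "R = (cps m)\<lparr>carrier := cf ` S\<rparr>"
  shows "cring R"
proof -
  have mult: "cf F \<otimes>\<^bsub>R\<^esub> cf G = cf (F * G)" if "F \<in> S" "G \<in> S" for F G
    using cps_mult[of F m G] that S(1) by (auto simp: R)
  have add: "cf F \<oplus>\<^bsub>R\<^esub> cf G = cf (F + G)" for F G by (simp add: R cps_add)
  have one: "\<one>\<^bsub>R\<^esub> = cf 1" and zero: "\<zero>\<^bsub>R\<^esub> = cf 0" by (simp_all add: R cps_one cps_zero)
  have car: "carrier R = cf ` S" by (simp add: R)
  show ?thesis
  proof (intro cringI abelian_groupI comm_monoidI)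
    fix x assume "x \<in> carrier R"
    then obtain F where F: "F \<in> S" "x = cf F" by (auto simp: car)
    then have "cf (- F) \<oplus>\<^bsub>R\<^esub> x = \<zero>\<^bsub>R\<^esub>" by (simp add: add zero)
    then show "\<exists>y\<in>carrier R. y \<oplus>\<^bsub>R\<^esub> x = \<zero>\<^bsub>R\<^esub>" using F S(6) by (auto simp: car)
  qed (auto simp: car mult add one zero S cf_inject algebra_simps)
qed

lemma cps_cring: "cring (cps m :: ((nat \<Rightarrow> nat) \<Rightarrow> 'a::{real_normed_field,banach}) ring)"
proof (rule cring_cf_image)
  show "(cps m :: ((nat \<Rightarrow> nat) \<Rightarrow> 'a) ring) = (cps m)\<lparr>carrier := cf ` conv m\<rparr>"
    by (simp add: cps_def cf_image_conv)
qed (auto intro: conv_closed)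

lemma cps_tail_cring: "cring (cps_tail k m :: ((nat \<Rightarrow> nat) \<Rightarrow> 'a::{real_normed_field,banach}) ring)"
proof (rule cring_cf_image)
  show "(cps_tail k m :: ((nat \<Rightarrow> nat) \<Rightarrow> 'a) ring) = (cps m)\<lparr>carrier := cf ` tail_ring m k\<rparr>"
    unfolding cps_tail_carrier[symmetric] by (simp add: cps_tail_def)
qed (auto intro: tail_ring_zero tail_ring_one tail_ring_add tail_ring_mult tail_ring_uminus dest: tail_ringD(1))

lemma ideal_cf_ideal_gen:
  fixes F :: "nat \<Rightarrow> 'a::{real_normed_field,banach} pseries"
  assumes F: "\<And>i. i < k \<Longrightarrow> F i \<in> conv m"
  shows "ideal (cf ` ideal_gen m k F) (cps m)"
proof -
  let ?R = "cps m :: ((nat \<Rightarrow> nat) \<Rightarrow> 'a) ring"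
  interpret cring "cps m :: ((nat \<Rightarrow> nat) \<Rightarrow> 'a) ring" by (rule cps_cring)
  have I: "ideal_gen m k F \<subseteq> conv m" by (rule ideal_gen_conv) (rule F)
  show ?thesis
  proof (rule idealI)
    show "ring ?R" by (rule ring_axioms)
    show "subgroup (cf ` ideal_gen m k F) (add_monoid ?R)"
    proof (rule add.subgroupI)
      show "cf ` ideal_gen m k F \<subseteq> carrier ?R" using I by (auto simp: cps_carrier)
      show "cf ` ideal_gen m k F \<noteq> {}" using ideal_gen_zero by blast
      fix a assume "a \<in> cf ` ideal_gen m k F"
      then obtain G where G: "G \<in> ideal_gen m k F" "a = cf G" by blast
      have "\<ominus>\<^bsub>?R\<^esub> a = cf (- G)"
        by (rule minus_equality) (use G I in \<open>auto simp: cps_simps conv_uminus\<close>)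
      then show "\<ominus>\<^bsub>?R\<^esub> a \<in> cf ` ideal_gen m k F" using G ideal_gen_uminus by blast
    next
      fix a b assume "a \<in> cf ` ideal_gen m k F" "b \<in> cf ` ideal_gen m k F"
      then show "a \<oplus>\<^bsub>?R\<^esub> b \<in> cf ` ideal_gen m k F" by (auto simp: cps_add intro: ideal_gen_add)
    qed
    fix a x assume "a \<in> cf ` ideal_gen m k F" "x \<in> carrier ?R"
    then obtain G H where GH: "G \<in> ideal_gen m k F" "a = cf G" "H \<in> conv m" "x = cf H" by (auto simp: cps_carrier)
    then show "x \<otimes>\<^bsub>?R\<^esub> a \<in> cf ` ideal_gen m k F" "a \<otimes>\<^bsub>?R\<^esub> x \<in> cf ` ideal_gen m k F"
      using I ideal_gen_mult[of H m G k F] by (auto simp: cps_mult mult.commute)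
  qed
qed

lemma genideal_cf:
  fixes F :: "nat \<Rightarrow> 'a::{real_normed_field,banach} pseries"
  assumes F: "\<And>i. i < k \<Longrightarrow> F i \<in> conv m" and f: "\<And>i. i < k \<Longrightarrow> f i = cf (F i)"
  shows "Idl\<^bsub>cps m\<^esub> (f ` {..<k}) = cf ` ideal_gen m k F"
proof -
  interpret cring "cps m :: ((nat \<Rightarrow> nat) \<Rightarrow> 'a) ring" by (rule cps_cring)
  have fc: "f ` {..<k} \<subseteq> carrier (cps m)" using F f by (auto simp: cps_carrier)
  have base: "f ` {..<k} \<subseteq> cf ` ideal_gen m k F" using f ideal_gen_base by fastforce
  show ?thesis
  proof
    show "Idl\<^bsub>cps m\<^esub> (f ` {..<k}) \<subseteq> cf ` ideal_gen m k F"
      by (rule genideal_minimal[OF ideal_cf_ideal_gen base]) (rule F)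
    interpret J: ideal "Idl\<^bsub>cps m\<^esub> (f ` {..<k})" "cps m" by (rule genideal_ideal[OF fc])
    have gens: "f ` {..<k} \<subseteq> Idl\<^bsub>cps m\<^esub> (f ` {..<k})" by (rule genideal_self[OF fc])
    show "cf ` ideal_gen m k F \<subseteq> Idl\<^bsub>cps m\<^esub> (f ` {..<k})"
    proof
      fix x assume "x \<in> cf ` ideal_gen m k F"
      then obtain a where a: "\<And>i. i < k \<Longrightarrow> a i \<in> conv m" "x = cf (\<Sum>i<k. a i * F i)"
        by (elim imageE ideal_genE) blast
      have "cf (\<Sum>i<n. a i * F i) \<in> Idl\<^bsub>cps m\<^esub> (f ` {..<k})" if "n \<le> k" for n
        using that
      proof (induction n)
        case 0
        show ?case using J.zero_closed by (simp add: cps_zero)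
      next
        case (Suc n)
        then have n: "n < k" by simp
        have "cf (F n) \<in> Idl\<^bsub>cps m\<^esub> (f ` {..<k})" using gens f[OF n] n by auto
        then have "cf (a n) \<otimes>\<^bsub>cps m\<^esub> cf (F n) \<in> Idl\<^bsub>cps m\<^esub> (f ` {..<k})"
          by (rule J.I_l_closed) (use a(1)[OF n] in \<open>auto simp: cps_carrier\<close>)
        moreover have "cf (\<Sum>i<n. a i * F i) \<in> Idl\<^bsub>cps m\<^esub> (f ` {..<k})" using Suc by simp
        ultimately have "cf (\<Sum>i<n. a i * F i) \<oplus>\<^bsub>cps m\<^esub> (cf (a n) \<otimes>\<^bsub>cps m\<^esub> cf (F n)) \<in> Idl\<^bsub>cps m\<^esub> (f ` {..<k})"
          by (intro J.a_closed)
        then show ?case using a(1)[OF n] F[OF n] by (simp add: cps_mult cps_add)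
      qed
      then show "x \<in> Idl\<^bsub>cps m\<^esub> (f ` {..<k})" using a(2) by blast
    qed
  qed
qed

lemma coset_eq_zero_iff:
  assumes "ideal I R" "x \<in> carrier R"
  shows "I +>\<^bsub>R\<^esub> x = I \<longleftrightarrow> x \<in> I"
proof -
  interpret ideal I R by fact
  show ?thesis using a_coset_join1[OF _ assms(2) a_subgroup] a_rcos_const by blast
qed

text \<open>
  Every element of the quotient is the class of some \<open>b\<close>, and a class vanishes if and only if \<open>b\<close> lies in \<open>I\<close>.
\<close>

lemma nonzerodivisor_Quot_iff:
  assumes "ideal I R" "a \<in> carrier R"
  shows "nonzerodivisor (R Quot I) (I +>\<^bsub>R\<^esub> a) \<longleftrightarrow> (\<forall>b\<in>carrier R. a \<otimes>\<^bsub>R\<^esub> b \<in> I \<longrightarrow> b \<in> I)"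
proof -
  interpret ideal I R by fact
  have car: "carrier (R Quot I) = (\<lambda>x. I +>\<^bsub>R\<^esub> x) ` carrier R"
    by (auto simp: FactRing_simps)
  have mult: "(I +>\<^bsub>R\<^esub> a) \<otimes>\<^bsub>R Quot I\<^esub> (I +>\<^bsub>R\<^esub> b) = I +>\<^bsub>R\<^esub> (a \<otimes>\<^bsub>R\<^esub> b)" if "b \<in> carrier R" for b
    using rcoset_mult_add[OF assms(2) that] by (simp add: FactRing_def)
  have zero: "\<zero>\<^bsub>R Quot I\<^esub> = I" by (simp add: FactRing_def)
  show ?thesis
    unfolding nonzerodivisor_def car zero using assms(2)
    by (auto simp: mult coset_eq_zero_iff[OF assms(1)])
qed

lemma regular_sequence_cf_iff:
  fixes F :: "nat \<Rightarrow> 'a::{real_normed_field,banach} pseries"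
  assumes F: "\<And>i. i < k \<Longrightarrow> F i \<in> conv m" and f: "\<And>i. i < k \<Longrightarrow> f i = cf (F i)"
  shows "regular_sequence (cps m) k f \<longleftrightarrow> regular m k F \<and> 1 \<notin> ideal_gen m k F"
proof -
  have idl: "Idl\<^bsub>cps m\<^esub> (f ` {..<i}) = cf ` ideal_gen m i F" if "i \<le> k" for i
    by (rule genideal_cf) (use F f that in auto)
  have idl': "ideal (cf ` ideal_gen m i F) (cps m)" if "i \<le> k" for i
    by (rule ideal_cf_ideal_gen) (use F that in auto)
  have inj: "cf G \<in> cf ` S \<longleftrightarrow> G \<in> S" for G :: "'a pseries" and S by (auto simp: cf_inject)
  have car: "f i \<in> carrier (cps m)" if "i < k" for i using F[OF that] f[OF that] by (auto simp: cps_carrier)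
  have I: "ideal_gen m k F \<subseteq> conv m" by (rule ideal_gen_conv) (rule F)
  have proper: "Idl\<^bsub>cps m\<^esub> (f ` {..<k}) = carrier (cps m) \<longleftrightarrow> 1 \<in> ideal_gen m k F"
  proof
    assume "Idl\<^bsub>cps m\<^esub> (f ` {..<k}) = carrier (cps m)"
    then have "cf ` ideal_gen m k F = cf ` conv m" by (simp add: idl cps_carrier)
    then have "cf 1 \<in> cf ` ideal_gen m k F" using conv_one by blast
    then show "1 \<in> ideal_gen m k F" using inj by blast
  next
    assume one: "1 \<in> ideal_gen m k F"
    have "h \<in> ideal_gen m k F" if "h \<in> conv m" for h using ideal_gen_mult[OF that one] by simp
    then show "Idl\<^bsub>cps m\<^esub> (f ` {..<k}) = carrier (cps m)" using I by (auto simp: idl cps_carrier)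
  qed
  have nzd: "nonzerodivisor (cps m Quot Idl\<^bsub>cps m\<^esub> (f ` {..<i})) (Idl\<^bsub>cps m\<^esub> (f ` {..<i}) +>\<^bsub>cps m\<^esub> f i) \<longleftrightarrow>
      (\<forall>b\<in>conv m. b * F i \<in> ideal_gen m i F \<longrightarrow> b \<in> ideal_gen m i F)" if "i < k" for i
  proof -
    have "cf (F i) \<otimes>\<^bsub>cps m\<^esub> cf b \<in> cf ` ideal_gen m i F \<longleftrightarrow> b * F i \<in> ideal_gen m i F" if "b \<in> conv m" for b
      using F[OF \<open>i < k\<close>] that by (simp add: cps_mult inj mult.commute)
    moreover have "nonzerodivisor (cps m Quot Idl\<^bsub>cps m\<^esub> (f ` {..<i})) (Idl\<^bsub>cps m\<^esub> (f ` {..<i}) +>\<^bsub>cps m\<^esub> f i) \<longleftrightarrow>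
        (\<forall>b\<in>carrier (cps m). f i \<otimes>\<^bsub>cps m\<^esub> b \<in> cf ` ideal_gen m i F \<longrightarrow> b \<in> cf ` ideal_gen m i F)"
      using nonzerodivisor_Quot_iff[OF idl' car[OF that], of i] idl[of i] that by simp
    ultimately show ?thesis by (simp add: f[OF that] cps_carrier inj)
  qed
  have nzd0: "nonzerodivisor (cps m) (f 0) \<longleftrightarrow>
      (\<forall>b\<in>conv m. b * F 0 \<in> ideal_gen m 0 F \<longrightarrow> b \<in> ideal_gen m 0 F)" if "0 < k"
  proof -
    have "cf (F 0) \<otimes>\<^bsub>cps m\<^esub> cf b = \<zero>\<^bsub>cps m\<^esub> \<longleftrightarrow> b * F 0 = 0" if "b \<in> conv m" for b
      using F[OF \<open>0 < k\<close>] that by (simp add: cps_mult cps_zero cf_inject mult.commute)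
    moreover have "cf b = \<zero>\<^bsub>cps m\<^esub> \<longleftrightarrow> b = 0" for b :: "'a pseries" by (simp add: cps_zero cf_inject)
    ultimately show ?thesis
      using car[OF that] by (simp add: nonzerodivisor_def f[OF that] cps_carrier ideal_gen_def)
  qed
  have "regular_sequence (cps m) k f \<longleftrightarrow> 1 \<notin> ideal_gen m k F \<and>
      (\<forall>i<k. \<forall>b\<in>conv m. b * F i \<in> ideal_gen m i F \<longrightarrow> b \<in> ideal_gen m i F)"
    unfolding regular_sequence_def proper using nzd nzd0 car by (metis gr0I)
  then show ?thesis using F by (auto simp: regular_def)
qed

lemma conv_order_one:
  assumes "H \<in> conv m" "cf H 0 = 0"
  shows "order_ge m 1 H"
  unfolding order_ge_def
proof (intro allI impI)
  fix \<beta> assume nz: "cf H \<beta> \<noteq> 0"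
  then have "\<beta> \<noteq> 0" using assms(2) by auto
  then obtain j where j: "\<beta> j \<noteq> 0" by (auto simp: fun_eq_iff)
  have "j < m" using conv_suppD[OF assms(1) nz] j by (rule exponents_less)
  then have "\<beta> j \<le> deg m \<beta>" unfolding deg_def by (intro member_le_sum) auto
  then show "1 \<le> deg m \<beta>" using j by simp
qed

text \<open>
  By induction, the \<open>n\<close>-th power of the maximal ideal consists of series of order at least \<open>n\<close>; series with
  equal \<open>\<mu>\<close>-jets differ by an element of the power \<open>\<mu> + 1\<close>.
\<close>

lemma jet_eq_order_ge:
  fixes F :: "'a::{real_normed_field,banach} pseries"
  assumes F: "F \<in> conv m" and G: "G \<in> conv m" and jet: "jet m \<mu> (cf G) = jet m \<mu> (cf F)"
  shows "order_ge m (Suc \<mu>) (G - F)"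
proof -
  let ?M = "cps_max_ideal m :: ((nat \<Rightarrow> nat) \<Rightarrow> 'a) set" and ?S = "ideals_set (cps m) :: ((nat \<Rightarrow> nat) \<Rightarrow> 'a) set ring"
  have M: "?M = cf ` {H \<in> conv m. cf H 0 = 0}"
    by (auto simp: cps_max_ideal_def cps_carrier zero_fun_def)
  have Suc_pow: "?M [^]\<^bsub>?S\<^esub> Suc n = ideal_prod (cps m) (?M [^]\<^bsub>?S\<^esub> n) ?M" for n
    by (simp add: ideals_set_def)
  have sub: "?M [^]\<^bsub>?S\<^esub> n \<subseteq> cf ` {H \<in> conv m. order_ge m n H}" for n :: nat
  proof (induction n)
    case 0
    show ?case by (simp add: ideals_set_def cps_carrier)
  next
    case (Suc n)
    show ?case unfolding Suc_pow
    proof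
      fix x assume "x \<in> ideal_prod (cps m) (?M [^]\<^bsub>?S\<^esub> n) ?M"
      then show "x \<in> cf ` {H \<in> conv m. order_ge m (Suc n) H}"
      proof (induction rule: ideal_prod.induct)
        case (prod i j)
        then obtain H K where "i = cf H" "j = cf K" "H \<in> conv m" "order_ge m n H" "K \<in> conv m" "cf K 0 = 0"
          using Suc M by blast
        then show ?case using conv_order_one[of K m] order_ge_mult[of m n H 1 K] by (auto simp: cps_mult intro!: imageI conv_mult)
      next
        case (sum s1 s2)
        then show ?case by (auto simp: cps_add intro!: imageI conv_add order_ge_add)
      qed
    qed
  qed
  have zero: "\<zero>\<^bsub>cps m\<^esub> \<in> ?M [^]\<^bsub>?S\<^esub> n" for n :: nat
  proof (induction n)
    case 0
    show ?case using conv_zero by (auto simp: ideals_set_def cps_simps)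
  next
    case (Suc n)
    have "\<zero>\<^bsub>cps m\<^esub> \<in> ?M" by (auto simp: M cps_zero conv_zero cf_zero)
    then have "\<zero>\<^bsub>cps m\<^esub> \<otimes>\<^bsub>cps m\<^esub> \<zero>\<^bsub>cps m\<^esub> \<in> ?M [^]\<^bsub>?S\<^esub> Suc n"
      unfolding Suc_pow using Suc by (intro ideal_prod.prod)
    then show ?case by (simp add: cps_zero cps_mult conv_zero)
  qed
  have "\<zero>\<^bsub>cps m\<^esub> \<oplus>\<^bsub>cps m\<^esub> cf G \<in> jet m \<mu> (cf G)"
    unfolding jet_def a_r_coset_def' using zero[of "\<mu> + 1"] by blast
  then have "cf G \<in> jet m \<mu> (cf F)" using jet by (simp add: cps_zero cps_add)
  then obtain h where h: "h \<in> ?M [^]\<^bsub>?S\<^esub> (\<mu> + 1)" "cf G = h \<oplus>\<^bsub>cps m\<^esub> cf F"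
    unfolding jet_def a_r_coset_def' by blast
  then obtain H where H: "h = cf H" "order_ge m (\<mu> + 1) H" using sub by blast
  have "G = H + F" using h(2) by (simp add: H cps_add cf_inject)
  then show ?thesis using H(2) by simp
qed

lemma linear_change_cf:
  fixes F :: "'a::{real_normed_field,banach} pseries"
  shows "linear_change m A (cf F) = cf (lin_subst m A F)"
proof
  fix \<gamma>
  interpret cring "cps m :: ((nat \<Rightarrow> nat) \<Rightarrow> 'a) ring" by (rule cps_cring)
  have comp: "linear_component m A i = cf (lin_form m A i)" for i
    by (rule ext) (simp only: linear_component_def cf_lin_form single_def)
  have pow: "cf H [^]\<^bsub>cps m\<^esub> n = cf (H ^ n)" if "H \<in> conv m" for H :: "'a pseries" and n :: nat
    using that by (induction n) (auto simp: cps_one cps_mult conv_power mult.commute)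
  have "(\<Otimes>\<^bsub>cps m\<^esub>i\<in>{..<n}. linear_component m A i [^]\<^bsub>cps m\<^esub> \<beta> i) = cf (\<Prod>i<n. lin_form m A i ^ \<beta> i)" for \<beta> n
  proof (induction n)
    case (Suc n)
    have "(\<Otimes>\<^bsub>cps m\<^esub>i\<in>insert n {..<n}. linear_component m A i [^]\<^bsub>cps m\<^esub> \<beta> i) =
        linear_component m A n [^]\<^bsub>cps m\<^esub> \<beta> n \<otimes>\<^bsub>cps m\<^esub> (\<Otimes>\<^bsub>cps m\<^esub>i\<in>{..<n}. linear_component m A i [^]\<^bsub>cps m\<^esub> \<beta> i)"
      by (rule finprod_insert) (auto simp: comp pow lin_form_conv cps_carrier conv_power)
    also have "\<dots> = cf (lin_form m A n ^ \<beta> n) \<otimes>\<^bsub>cps m\<^esub> cf (\<Prod>i<n. lin_form m A i ^ \<beta> i)"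
      by (simp only: Suc) (simp only: comp pow lin_form_conv)
    also have "\<dots> = cf (lin_form m A n ^ \<beta> n * (\<Prod>i<n. lin_form m A i ^ \<beta> i))"
      by (intro cps_mult conv_closed lin_form_conv)
    finally show ?case by (simp add: lessThan_Suc)
  qed (simp add: cps_one)
  then have mon: "(\<Otimes>\<^bsub>cps m\<^esub>i\<in>{..<m}. linear_component m A i [^]\<^bsub>cps m\<^esub> \<beta> i) = cf (lin_monom m A \<beta>)" for \<beta>
    by (simp add: lin_monom_def)
  show "linear_change m A (cf F) \<gamma> = cf (lin_subst m A F) \<gamma>"
    unfolding linear_change_def mon lin_subst_def cf_series by (simp add: cf_infinite)
qed

lemma diagram_cf:
  assumes A: "A \<in> general_linear m" and F: "\<And>i. i < k \<Longrightarrow> F i \<in> conv m"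
  shows "diagram m (linear_change m A ` cf ` ideal_gen m k F) =
    {\<beta>. \<exists>h\<in>ideal_gen m k (\<lambda>i. lin_subst m A (F i)). is_initial m h \<beta>}"
proof -
  let ?I = "ideal_gen m k (\<lambda>i. lin_subst m A (F i))"
  have img: "linear_change m A ` cf ` ideal_gen m k F = cf ` ?I"
    by (simp add: image_image linear_change_cf lin_subst_ideal_gen[OF A F, symmetric])
  have I: "?I \<subseteq> conv m" by (rule ideal_gen_conv) (use F lin_subst_conv in blast)
  have "cf ` ?I - {\<zero>\<^bsub>cps m\<^esub>} = cf ` (?I - {0})" by (auto simp: cps_zero cf_inject)
  then have "diagram m (cf ` ?I) = (\<lambda>h. initial_exponent m (cf h)) ` (?I - {0})"
    by (simp add: diagram_def image_image)
  also have "\<dots> = {\<beta>. \<exists>h\<in>?I. is_initial m h \<beta>}"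
  proof (intro equalityI subsetI)
    fix \<beta> assume "\<beta> \<in> (\<lambda>h. initial_exponent m (cf h)) ` (?I - {0})"
    then obtain h where h: "h \<in> ?I" "h \<noteq> 0" "\<beta> = initial_exponent m (cf h)" by blast
    obtain \<gamma> where "is_initial m h \<gamma>" using is_initial_exists[of h m] h I by blast
    then show "\<beta> \<in> {\<beta>. \<exists>h\<in>?I. is_initial m h \<beta>}" using h initial_exponent_eq by blast
  next
    fix \<beta> assume "\<beta> \<in> {\<beta>. \<exists>h\<in>?I. is_initial m h \<beta>}"
    then obtain h where h: "h \<in> ?I" "is_initial m h \<beta>" by blast
    then have "h \<noteq> 0" by (auto simp: is_initial_def cf_zero)
    then show "\<beta> \<in> (\<lambda>h. initial_exponent m (cf h)) ` (?I - {0})"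
      using h initial_exponent_eq[OF h(2)] by force
  qed
  finally show ?thesis unfolding img .
qed

text \<open>
  The scalars act through the quotient map, which is a ring homomorphism, so the module axioms are
  ring axioms of the quotient.
\<close>

lemma quotient_module_is_module:
  assumes R: "cring R" and J: "ideal J R" and S: "cring S" "carrier S \<subseteq> carrier R" "mult S = mult R"
    "add S = add R" "one S = one R"
  shows "module S (quotient_module R J)"
proof -
  interpret R: cring R by (rule R)
  interpret J: ideal J R by (rule J)
  interpret Q: cring "R Quot J" by (rule J.quotient_is_cring[OF R])
  have hom: "(+>\<^bsub>R\<^esub>) J \<in> Ring.ring_hom R (R Quot J)" by (rule J.rcos_ring_hom)
  let ?M = "quotient_module R J"
  have sc: "a \<in> carrier R" "J +>\<^bsub>R\<^esub> a \<in> carrier (R Quot J)" if "a \<in> carrier S" for a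
    using that S(2) Ring.ring_hom_closed[OF hom] by auto
  have mc: "x \<in> carrier (R Quot J)" if "x \<in> carrier ?M" for x
    using that by (simp add: quotient_module_def)
  show ?thesis
  proof (rule moduleI)
    show "cring S" by (rule S(1))
    show "abelian_group ?M"
    proof (rule abelian_groupI)
      fix x assume "x \<in> carrier ?M"
      then have x: "x \<in> carrier (R Quot J)" by (simp add: quotient_module_def)
      then show "\<exists>y\<in>carrier ?M. y \<oplus>\<^bsub>?M\<^esub> x = \<zero>\<^bsub>?M\<^esub>"
        using Q.l_neg[OF x] Q.a_inv_closed[OF x] by (auto simp: quotient_module_def)
    qed (simp_all add: quotient_module_def Q.a_ac)
  next
    fix a x assume "a \<in> carrier S" "x \<in> carrier ?M"
    note ax = sc[OF this(1)] mc[OF this(2)]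
    show "a \<odot>\<^bsub>?M\<^esub> x \<in> carrier ?M" using ax by (simp add: quotient_module_def)
  next
    fix x assume "x \<in> carrier ?M"
    then show "\<one>\<^bsub>S\<^esub> \<odot>\<^bsub>?M\<^esub> x = x"
      using mc[of x] Ring.ring_hom_one[OF hom] by (simp add: quotient_module_def S)
  next
    fix a x y assume "a \<in> carrier S" "x \<in> carrier ?M" "y \<in> carrier ?M"
    note axy = sc[OF this(1)] mc[OF this(2)] mc[OF this(3)]
    show "a \<odot>\<^bsub>?M\<^esub> (x \<oplus>\<^bsub>?M\<^esub> y) = a \<odot>\<^bsub>?M\<^esub> x \<oplus>\<^bsub>?M\<^esub> a \<odot>\<^bsub>?M\<^esub> y"
      using axy by (simp add: quotient_module_def Q.r_distr)
  next
    fix a b x assume "a \<in> carrier S" "b \<in> carrier S" "x \<in> carrier ?M"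
    note abx = sc[OF this(1)] sc[OF this(2)] mc[OF this(3)]
    show "(a \<oplus>\<^bsub>S\<^esub> b) \<odot>\<^bsub>?M\<^esub> x = a \<odot>\<^bsub>?M\<^esub> x \<oplus>\<^bsub>?M\<^esub> b \<odot>\<^bsub>?M\<^esub> x"
      using abx Ring.ring_hom_add[OF hom abx(1,3)] by (simp add: quotient_module_def S Q.l_distr)
    show "(a \<otimes>\<^bsub>S\<^esub> b) \<odot>\<^bsub>?M\<^esub> x = a \<odot>\<^bsub>?M\<^esub> (b \<odot>\<^bsub>?M\<^esub> x)"
      using abx Ring.ring_hom_mult[OF hom abx(1,3)] by (simp add: quotient_module_def S Q.m_assoc)
  qed
qed

text \<open>
  Distinct monomials may have the same class. The coefficient of a class is therefore the sum
  of the coefficients of all monomials in it.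
\<close>

lemma finite_module_cf:
  fixes F :: "nat \<Rightarrow> 'a::{real_normed_field,banach} pseries"
  assumes F: "\<And>i. i < k \<Longrightarrow> F i \<in> conv m" and D: "finite D" "D \<subseteq> exponents m"
    and span: "\<forall>h\<in>conv m. \<exists>r. (\<forall>\<delta>\<in>D. r \<delta> \<in> tail_ring m n) \<and>
      h - (\<Sum>\<delta>\<in>D. r \<delta> * xpow \<delta>) \<in> ideal_gen m k F"
  shows "finite_module (cps_tail n m) (quotient_module (cps m) (cf ` ideal_gen m k F))"
proof -
  let ?R = "cps m :: ((nat \<Rightarrow> nat) \<Rightarrow> 'a) ring" and ?I = "ideal_gen m k F"
  let ?J = "cf ` ?I"
  let ?Q = "?R Quot ?J" and ?M = "quotient_module ?R ?J"
  have J: "ideal ?J ?R" by (rule ideal_cf_ideal_gen) (rule F)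
  interpret R: cring ?R by (rule cps_cring)
  interpret J: ideal ?J ?R by (rule J)
  interpret Q: cring ?Q by (rule J.quotient_is_cring[OF cps_cring])
  have hom: "(+>\<^bsub>?R\<^esub>) ?J \<in> Ring.ring_hom ?R ?Q" by (rule J.rcos_ring_hom)
  have tail: "carrier (cps_tail n m) \<subseteq> carrier ?R"
    unfolding cps_tail_carrier cps_carrier using tail_ringD(1) by blast
  have mod: "module (cps_tail n m) ?M"
    by (rule quotient_module_is_module[OF cps_cring J cps_tail_cring tail]) (simp_all add: cps_tail_def)
  define q where "q h = ?J +>\<^bsub>?R\<^esub> cf h" for h
  have q_car: "q h \<in> carrier ?Q" if "h \<in> conv m" for h
    unfolding q_def by (rule Ring.ring_hom_closed[OF hom]) (use that in \<open>auto simp: cps_carrier\<close>)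
  have q_carM: "q h \<in> carrier ?M" if "h \<in> conv m" for h
    using q_car[OF that] by (simp add: quotient_module_def)
  have q_add: "q (g + h) = q g \<oplus>\<^bsub>?Q\<^esub> q h" if "g \<in> conv m" "h \<in> conv m" for g h
    using Ring.ring_hom_add[OF hom, of "cf g" "cf h"] that by (simp add: q_def cps_add cps_carrier)
  have q_mult: "q (g * h) = q g \<otimes>\<^bsub>?Q\<^esub> q h" if "g \<in> conv m" "h \<in> conv m" for g h
    using Ring.ring_hom_mult[OF hom, of "cf g" "cf h"] that by (simp add: q_def cps_mult cps_carrier)
  have q_zero: "q 0 = \<zero>\<^bsub>?Q\<^esub>"
  proof -
    have "cf 0 \<in> carrier ?R" unfolding cps_carrier using conv_zero by (rule imageI)
    moreover have "cf 0 \<in> ?J" using ideal_gen_zero by (rule imageI)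
    ultimately show ?thesis using coset_eq_zero_iff[OF J] by (simp add: q_def FactRing_def)
  qed
  have q_eqI: "q g = q h" if "g - h \<in> ?I" "g \<in> conv m" "h \<in> conv m" for g h
  proof -
    have "q (g - h) = \<zero>\<^bsub>?Q\<^esub>"
    proof -
      have "cf (g - h) \<in> carrier ?R" "cf (g - h) \<in> ?J" using that conv_diff by (auto simp: cps_carrier)
      then show ?thesis using coset_eq_zero_iff[OF J] by (simp add: q_def FactRing_def)
    qed
    moreover have "q (g - h + h) = q (g - h) \<oplus>\<^bsub>?Q\<^esub> q h" using that conv_diff by (intro q_add)
    ultimately show ?thesis using q_car[OF that(3)] by simp
  qed
  have q_eqD: "g - h \<in> ?I" if "q g = q h" "g \<in> conv m" for g h
  proof -
    have "cf g \<in> q h" using J.a_rcos_self[of "cf g"] that by (auto simp: q_def cps_carrier)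
    then obtain u where "u \<in> ?I" "cf g = cf u \<oplus>\<^bsub>?R\<^esub> cf h" unfolding q_def a_r_coset_def' by blast
    then have "g = u + h" by (simp add: cps_add cf_inject)
    then show ?thesis using \<open>u \<in> ?I\<close> by simp
  qed
  interpret M: module "cps_tail n m" ?M by (rule mod)
  have finsum_q: "(\<Oplus>\<^bsub>?M\<^esub>y\<in>A. q (\<phi> y)) = q (\<Sum>y\<in>A. \<phi> y)"
    if "finite A" "\<And>y. y \<in> A \<Longrightarrow> \<phi> y \<in> conv m" for A and \<phi> :: "((nat \<Rightarrow> nat) \<Rightarrow> 'a) set \<Rightarrow> 'a pseries"
    using that
  proof (induction A rule: finite_induct)
    case (insert x A)
    have "(\<Oplus>\<^bsub>?M\<^esub>y\<in>insert x A. q (\<phi> y)) = q (\<phi> x) \<oplus>\<^bsub>?M\<^esub> (\<Oplus>\<^bsub>?M\<^esub>y\<in>A. q (\<phi> y))"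
      by (rule M.finsum_insert) (use insert q_carM in auto)
    also have "\<dots> = q (\<phi> x) \<oplus>\<^bsub>?Q\<^esub> q (\<Sum>y\<in>A. \<phi> y)" using insert by (simp add: quotient_module_def)
    also have "\<dots> = q (\<phi> x + (\<Sum>y\<in>A. \<phi> y))" using insert.prems by (intro q_add[symmetric] conv_sum) auto
    finally show ?case using insert by simp
  next
    case empty
    show ?case by (simp add: q_zero) (simp add: quotient_module_def)
  qed
  define G where "G = (\<lambda>\<delta>. q (xpow \<delta>)) ` D"
  have "\<forall>y\<in>G. \<exists>\<delta>\<in>D. q (xpow \<delta>) = y" by (auto simp: G_def)
  then obtain rep where rep: "\<And>y. y \<in> G \<Longrightarrow> rep y \<in> D" "\<And>y. y \<in> G \<Longrightarrow> q (xpow (rep y)) = y" by metis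
  have xc: "xpow \<delta> \<in> conv m" if "\<delta> \<in> D" for \<delta> :: "nat \<Rightarrow> nat" using that D(2) by (intro conv_xpow) auto
  show ?thesis
    unfolding finite_module_def
  proof (intro conjI exI[of _ G] ballI)
    show "module (cps_tail n m) ?M" by (rule mod)
    show "finite G" using D(1) by (simp add: G_def)
    show "G \<subseteq> carrier ?M" using q_car xc by (auto simp: G_def quotient_module_def)
    fix v assume "v \<in> carrier ?M"
    then have "v \<in> a_rcosets\<^bsub>?R\<^esub> ?J" by (simp add: quotient_module_def FactRing_def)
    then obtain x where "x \<in> carrier ?R" "v = ?J +>\<^bsub>?R\<^esub> x"
      by (auto simp: A_RCOSETS_def' RCOSETS_def a_r_coset_def)
    then obtain h where h: "h \<in> conv m" "v = q h" by (auto simp: cps_carrier q_def)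
    obtain r where r: "\<forall>\<delta>\<in>D. r \<delta> \<in> tail_ring m n" "h - (\<Sum>\<delta>\<in>D. r \<delta> * xpow \<delta>) \<in> ?I"
      using span h(1) by blast
    have rc: "r \<delta> \<in> conv m" if "\<delta> \<in> D" for \<delta> using r(1) that tail_ringD(1) by blast
    define c where "c y = (\<Sum>\<delta> | \<delta> \<in> D \<and> q (xpow \<delta>) = y. r \<delta>)" for y
    have ct: "c y \<in> tail_ring m n" for y unfolding c_def using r(1) by (intro tail_ring_sum) auto
    define \<phi> where "\<phi> y = c y * xpow (rep y)" for y
    have \<phi>c: "\<phi> y \<in> conv m" if "y \<in> G" for y
      unfolding \<phi>_def using tail_ringD(1)[OF ct] xc rep(1)[OF that] by (intro conv_mult) auto
    have "(\<Sum>y\<in>G. \<phi> y) = (\<Sum>y\<in>G. \<Sum>\<delta> | \<delta> \<in> D \<and> q (xpow \<delta>) = y. r \<delta> * xpow (rep (q (xpow \<delta>))))"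
      unfolding \<phi>_def c_def sum_distrib_right by (intro sum.cong refl) auto
    also have "\<dots> = (\<Sum>\<delta>\<in>D. r \<delta> * xpow (rep (q (xpow \<delta>))))"
      unfolding G_def by (rule sum.image_gen[OF D(1), symmetric])
    finally have diff: "h - (\<Sum>y\<in>G. \<phi> y) = (h - (\<Sum>\<delta>\<in>D. r \<delta> * xpow \<delta>)) +
        (\<Sum>\<delta>\<in>D. r \<delta> * (xpow \<delta> - xpow (rep (q (xpow \<delta>)))))"
      by (simp add: right_diff_distrib sum_subtractf)
    have "(\<Sum>\<delta>\<in>D. r \<delta> * (xpow \<delta> - xpow (rep (q (xpow \<delta>))))) \<in> ?I"
    proof (intro ideal_gen_sum ideal_gen_mult rc q_eqD xc)
      fix \<delta> assume "\<delta> \<in> D"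
      then show "q (xpow \<delta>) = q (xpow (rep (q (xpow \<delta>))))" using rep(2) by (simp add: G_def)
    qed
    then have "h - (\<Sum>y\<in>G. \<phi> y) \<in> ?I" unfolding diff by (rule ideal_gen_add[OF r(2)])
    then have "v = q (\<Sum>y\<in>G. \<phi> y)" unfolding h(2) by (rule q_eqI) (use h(1) \<phi>c conv_sum in blast)+
    also have "\<dots> = (\<Oplus>\<^bsub>?M\<^esub>y\<in>G. q (\<phi> y))" using finsum_q[of G \<phi>] \<phi>c \<open>finite G\<close> by simp
    also have "\<dots> = (\<Oplus>\<^bsub>?M\<^esub>y\<in>G. cf (c y) \<odot>\<^bsub>?M\<^esub> y)"
    proof (rule M.finsum_cong')
      fix y assume y: "y \<in> G"
      have "q (\<phi> y) = q (c y) \<otimes>\<^bsub>?Q\<^esub> q (xpow (rep y))"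
        unfolding \<phi>_def using tail_ringD(1)[OF ct] xc rep(1)[OF y] by (intro q_mult) auto
      then show "q (\<phi> y) = cf (c y) \<odot>\<^bsub>?M\<^esub> y"
        using rep(2)[OF y] by (simp add: quotient_module_def q_def)
    next
      have "cf (c y) \<in> carrier (cps_tail n m)" for y using ct by (auto simp: cps_tail_carrier)
      moreover have "y \<in> carrier ?M" if "y \<in> G" for y using that q_carM xc by (auto simp: G_def)
      ultimately show "(\<lambda>y. cf (c y) \<odot>\<^bsub>?M\<^esub> y) \<in> G \<rightarrow> carrier ?M" by (auto intro: M.smult_closed)
    qed simp
    finally show "\<exists>c\<in>G \<rightarrow> carrier (cps_tail n m). v = (\<Oplus>\<^bsub>?M\<^esub>g\<in>G. c g \<odot>\<^bsub>?M\<^esub> g)"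
      using ct by (intro bexI[of _ "\<lambda>y. cf (c y)"]) (auto simp: cps_tail_carrier)
  qed
qed

section \<open>Finite determinacy of the diagram\<close>

theorem theorem5p4:
  fixes m k :: nat
    and f :: "nat \<Rightarrow> (nat \<Rightarrow> nat) \<Rightarrow> 'a::{real_normed_field,banach}"
    and I :: "((nat \<Rightarrow> nat) \<Rightarrow> 'a) set"
  assumes "regular_sequence (cps m) k f"
    and "I = Idl\<^bsub>cps m\<^esub> (f ` {..<k})"
  shows "\<exists>\<mu>\<^sub>0. \<exists>A\<in>general_linear m.
    finite_module (cps_tail k m) (quotient_module (cps m) (linear_change m A ` I)) \<and>
    (\<forall>\<mu>\<ge>\<mu>\<^sub>0. \<forall>g.
      (\<forall>i<k. g i \<in> carrier (cps m) \<and> jet m \<mu> (g i) = jet m \<mu> (f i)) \<longrightarrow>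
        regular_sequence (cps m) k g \<and>
        diagram m (linear_change m A ` (Idl\<^bsub>cps m\<^esub> (g ` {..<k}))) =
          diagram m (linear_change m A ` I))"
proof -
  define F where "F i = series (f i)" for i
  have "f i \<in> convergent_series m" if "i < k" for i
    using assms(1) that by (simp add: regular_sequence_def cps_def)
  then have F: "F i \<in> conv m" "f i = cf (F i)" if "i < k" for i
    using cf_series_convergent[of "f i" m] that by (simp_all add: F_def)
  have reg: "regular m k F" and one: "1 \<notin> ideal_gen m k F"
    using regular_sequence_cf_iff[of k F m f] F assms(1) by auto
  have I: "I = cf ` ideal_gen m k F" unfolding assms(2) by (rule genideal_cf) (use F in auto)
  \<comment> \<open>a series with nonzero constant term is a unit, so the ideal would not be proper\<close>
  have ordF: "order_ge m 1 (F i)" if i: "i < k" for i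
  proof -
    have "cf (F i) 0 = 0"
    proof (rule ccontr)
      assume "cf (F i) 0 \<noteq> 0"
      then obtain V where "V \<in> conv m" "V * F i = 1" using conv_unit[OF F(1)[OF i]] by blast
      then show False using one ideal_gen_mult[OF _ ideal_gen_base[OF i, of F m]] by metis
    qed
    then show ?thesis using conv_order_one F(1)[OF i] by blast
  qed
  obtain A where km: "k \<le> m" and A: "A \<in> general_linear m"
    and pos: "\<forall>l<k. \<exists>d>0. \<exists>u\<in>ideal_gen m k (\<lambda>j. lin_subst m A (F j)). var l ^ d - u \<in> tail_ideal m k"
    using noether_normalization[OF reg ordF order_refl] by auto
  define FA where "FA = (\<lambda>i. lin_subst m A (F i))"
  have FA: "FA i \<in> conv m" if "i < k" for i using F(1)[OF that] lin_subst_conv by (auto simp: FA_def)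
  have regA: "regular m k FA" unfolding FA_def by (rule lin_subst_regular[OF A reg])
  have img: "linear_change m A ` I = cf ` ideal_gen m k FA"
    using lin_subst_ideal_gen[OF A, of k F] F(1) by (simp add: I image_image linear_change_cf FA_def[symmetric])
       (simp add: FA_def image_image[symmetric])
  have "\<exists>D. finite D \<and> D \<subseteq> exponents m \<and> (\<forall>h\<in>conv m. \<exists>r. (\<forall>\<delta>\<in>D. r \<delta> \<in> tail_ring m k) \<and>
      h - (\<Sum>\<delta>\<in>D. r \<delta> * xpow \<delta>) \<in> ideal_gen m k FA)"
    by (rule finite_over_tail[OF _ km]) (use FA pos in \<open>auto simp: FA_def\<close>)
  then obtain D where D: "finite D" "D \<subseteq> exponents m"
    "\<forall>h\<in>conv m. \<exists>r. (\<forall>\<delta>\<in>D. r \<delta> \<in> tail_ring m k) \<and> h - (\<Sum>\<delta>\<in>D. r \<delta> * xpow \<delta>) \<in> ideal_gen m k FA"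
    by (elim exE conjE)
  have fin: "finite_module (cps_tail k m) (quotient_module (cps m) (linear_change m A ` I))"
    unfolding img by (rule finite_module_cf[OF FA D])
  \<comment> \<open>regularity is wanted in the given coordinates, equality of the diagrams in the new ones\<close>
  obtain \<mu>1 where \<mu>1: "\<forall>G. (\<forall>i<k. G i \<in> conv m \<and> order_ge m (Suc \<mu>1) (G i - F i)) \<longrightarrow> regular m k G"
    using regular_perturbation[OF reg] by blast
  obtain \<mu>2 where \<mu>2: "\<forall>G. (\<forall>i<k. G i \<in> conv m \<and> order_ge m (Suc \<mu>2) (G i - FA i)) \<longrightarrow>
      (\<forall>\<beta>. (\<exists>h\<in>ideal_gen m k G. is_initial m h \<beta>) \<longleftrightarrow> (\<exists>h\<in>ideal_gen m k FA. is_initial m h \<beta>))"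
    using regular_perturbation[OF regA] by blast
  show ?thesis
  proof (intro exI[of _ "max \<mu>1 \<mu>2"] bexI[OF _ A] conjI fin allI impI)
    fix \<mu> and g :: "nat \<Rightarrow> (nat \<Rightarrow> nat) \<Rightarrow> 'a"
    assume \<mu>: "max \<mu>1 \<mu>2 \<le> \<mu>" and g: "\<forall>i<k. g i \<in> carrier (cps m) \<and> jet m \<mu> (g i) = jet m \<mu> (f i)"
    define G where "G i = series (g i)" for i
    have G: "G i \<in> conv m" "g i = cf (G i)" if "i < k" for i
      using cf_series_convergent[of "g i" m] g that by (auto simp: G_def cps_carrier cf_image_conv)
    have close: "order_ge m (Suc \<mu>) (G i - F i)" if "i < k" for i
      by (rule jet_eq_order_ge) (use F G g that in auto)
    have "order_ge m (Suc \<mu>1) (G i - F i)" if "i < k" for i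
      using close[OF that] by (rule order_ge_mono) (use \<mu> in simp)
    then have regG: "regular m k G" using \<mu>1 G(1) by blast
    have ordG: "order_ge m 1 (G i)" if "i < k" for i
    proof -
      have "order_ge m 1 (G i - F i)" using close[OF that] by (rule order_ge_mono) simp
      then have "order_ge m 1 (G i - F i + F i)" using ordF[OF that] by (rule order_ge_add)
      then show ?thesis by simp
    qed
    \<comment> \<open>the \<open>g\<^sub>i\<close> have no constant term either, hence generate a proper ideal\<close>
    have "1 \<notin> ideal_gen m k G"
    proof
      assume "1 \<in> ideal_gen m k G"
      then obtain a where a: "1 = (\<Sum>i<k. a i * G i)" by (elim ideal_genE)
      have "order_ge m 1 (\<Sum>i<k. a i * G i)"
        by (rule order_ge_sum) (use ordG in \<open>auto intro: order_ge_mult'[of m 0 _ 1]\<close>)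
      then have "order_ge m 1 (1 :: 'a pseries)" unfolding a[symmetric] .
      then have "1 \<le> deg m 0" unfolding order_ge_def cf_one by (elim allE[of _ 0]) simp
      then show False by simp
    qed
    then show "regular_sequence (cps m) k g"
      using regular_sequence_cf_iff[of k G m g] G regG by auto
    have "(\<exists>h\<in>ideal_gen m k (\<lambda>i. lin_subst m A (G i)). is_initial m h \<beta>) \<longleftrightarrow>
        (\<exists>h\<in>ideal_gen m k FA. is_initial m h \<beta>)" for \<beta>
    proof -
      have "order_ge m (Suc \<mu>2) (lin_subst m A (G i) - FA i)" if "i < k" for i
      proof -
        have "order_ge m (Suc \<mu>) (lin_subst m A (G i) - FA i)"
          using lin_subst_order_ge[OF close[OF that], of A] by (simp add: lin_subst_diff FA_def)
        then show ?thesis by (rule order_ge_mono) (use \<mu> in simp)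
      qed
      moreover have "lin_subst m A (G i) \<in> conv m" if "i < k" for i using G(1)[OF that] by (rule lin_subst_conv)
      ultimately show ?thesis using \<mu>2 by (elim allE[of _ "\<lambda>i. lin_subst m A (G i)"]) simp
    qed
    moreover have "Idl\<^bsub>cps m\<^esub> (g ` {..<k}) = cf ` ideal_gen m k G" by (rule genideal_cf) (use G in auto)
    ultimately show "diagram m (linear_change m A ` (Idl\<^bsub>cps m\<^esub> (g ` {..<k}))) = diagram m (linear_change m A ` I)"
      using diagram_cf[OF A, of k G] diagram_cf[OF A, of k F] G(1) F(1) by (simp add: I FA_def)
  qed
qed

end
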